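(* Let $d\geq2$ be an integer, $w\geq121d^2$ a real number, and $a,b,c$ distinct positive integers. Let $0<\eta<\sqrt{w}/d$ and put $m_i:=\bigl\lfloor(\lfloor w^{i+1}\rfloor-\lfloor w^i-1\rfloor)/\lfloor\eta w^i\rfloor\bigr\rfloor$ for all $i\geq1$. Define $(a_{n,w,\eta})_{n\geq1}$ by: $a_{n,w,\eta}=b$ if $n=\lfloor w^i\rfloor$ for some integer $i\geq0$; $a_{n,w,\eta}=c$ if $n\neq\lfloor w^i\rfloor$ for all integers $i\geq0$ and $n=\lfloor w^j\rfloor+m\lfloor\eta w^j\rfloor$ for some integers $1\leq m\leq m_j$, $j\geq1$; and $a_{n,w,\eta}=a$ otherwise. Let $\xi_{w,\eta}:=[0,a_{1,w,\eta},a_{2,w,\eta},\ldots]\in\mathbb{R}$ (regular continued fraction). Then for all $2\leq n\leq d$, \[ w_n^{*}(\xi_{w,\eta})=\frac{2w-2-\eta}{2+\eta},\qquad w_n(\xi_{w,\eta})=\frac{2w-\eta}{2+\eta}, \] and hence $w_n(\xi_{w,\eta})-w_n^{*}(\xi_{w,\eta})=\dfrac{2}{2+\eta}$.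
   Context: For a real number $\xi$ and an integer $n\geq1$: $w_n(\xi)$ is the supremum of real $w$ such that $0<|P(\xi)|\leq H(P)^{-w}$ for infinitely many $P\in\mathbb{Z}[X]$ of degree at most $n$, where $H(P)$ is the maximum of the absolute values of the coefficients of $P$; $w_n^{*}(\xi)$ is the supremum of real $w^*$ such that $0<|\xi-\alpha|\leq H(\alpha)^{-w^*-1}$ for infinitely many real algebraic numbers $\alpha$ of degree at most $n$, where $H(\alpha)$ is the height of the minimal polynomial of $\alpha$ over $\mathbb{Z}$. *)

theory Defs
  imports
    Complex_Main
    "HOL-Library.Extended_Real"
    "HOL-Computational_Algebra.Polynomial_Factorial"
begin

definition poly_height :: "int poly \<Rightarrow> int" where
  "poly_height P = Max ((\<lambda>i. \<bar>coeff P i\<bar>) ` {..degree P})"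

abbreviation eval_int_poly :: "int poly \<Rightarrow> real \<Rightarrow> real" where
  "eval_int_poly P x \<equiv> poly (map_poly of_int P) x"

(* The minimal polynomial over the integers: the primitive polynomial with positive leading
   coefficient that has least degree among the nonzero integer polynomials vanishing at x. *)
definition is_int_minpoly :: "real \<Rightarrow> int poly \<Rightarrow> bool" where
  "is_int_minpoly x P \<longleftrightarrow>
     content P = 1 \<and> lead_coeff P > 0 \<and> eval_int_poly P x = 0 \<and>
     (\<forall>Q. Q \<noteq> 0 \<and> eval_int_poly Q x = 0 \<longrightarrow> degree P \<le> degree Q)"

definition int_minpoly :: "real \<Rightarrow> int poly" where
  "int_minpoly x = (THE P. is_int_minpoly x P)"

lemma is_int_minpoly_unique:
  assumes P: "is_int_minpoly x P" and Q: "is_int_minpoly x Q"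
  shows "P = Q"
proof -
  have P0: "P \<noteq> 0" and Q0: "Q \<noteq> 0" and lp: "lead_coeff P > 0" and lq: "lead_coeff Q > 0"
    using P Q by (auto simp: is_int_minpoly_def)
  have deg: "degree P = degree Q"
    using P Q P0 Q0 by (auto simp: is_int_minpoly_def intro: antisym)
  define R where "R = smult (lead_coeff Q) P - smult (lead_coeff P) Q"
  have "eval_int_poly R x = 0"
  proof -
    have "map_poly of_int R = smult (of_int (lead_coeff Q)) (map_poly of_int P)
        - smult (of_int (lead_coeff P)) (map_poly (of_int :: int \<Rightarrow> real) Q)"
      by (intro poly_eqI) (simp add: R_def coeff_map_poly)
    then show ?thesis
      using P Q by (simp add: is_int_minpoly_def)
  qed
  moreover have "R = 0 \<or> degree R < degree P"
  proof (rule disjCI)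
    assume "\<not> degree R < degree P"
    moreover have "degree R \<le> degree P"
      by (simp add: R_def deg degree_diff_le)
    ultimately have "degree R = degree P" by simp
    moreover have "coeff R (degree P) = 0"
      by (simp add: R_def deg)
    ultimately show "R = 0" by (metis leading_coeff_0_iff)
  qed
  ultimately have "R = 0"
    using P by (auto simp: is_int_minpoly_def not_le[symmetric])
  then have eq: "smult (lead_coeff Q) P = smult (lead_coeff P) Q"
    by (simp add: R_def)
  then have "content (smult (lead_coeff Q) P) = content (smult (lead_coeff P) Q)"
    by (rule arg_cong)
  then have "lead_coeff Q = lead_coeff P"
    using P Q by (simp add: is_int_minpoly_def)
  with eq lp show ?thesis
    by (metis less_irrefl smult_cancel)
qed

lemma is_int_minpoly_int_minpoly:
  assumes "algebraic x"
  shows "is_int_minpoly x (int_minpoly x)"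
proof -
  have "\<exists>P. P \<noteq> 0 \<and> eval_int_poly P x = 0"
  proof -
    from assms obtain p where p: "\<And>i. coeff p i \<in> \<int>" "p \<noteq> 0" "poly p x = 0"
      by (rule algebraicE) blast
    then obtain q where "p = map_poly of_int q"
      using intpolyE by blast
    with p show ?thesis by (metis map_poly_0)
  qed
  then obtain P where P: "P \<noteq> 0" "eval_int_poly P x = 0"
    and least: "\<And>Q. Q \<noteq> 0 \<and> eval_int_poly Q x = 0 \<Longrightarrow> degree P \<le> degree Q"
    using ex_has_least_nat[of "\<lambda>P. P \<noteq> 0 \<and> eval_int_poly P x = 0" _ degree] by blast
  define R where "R = smult (sgn (lead_coeff P)) (primitive_part P)"
  have "is_int_minpoly x R"
  proof -
    have s: "sgn (lead_coeff P) = 1 \<or> sgn (lead_coeff P) = -1"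
      using P by (auto simp: sgn_if)
    have PP: "P = smult (content P) (primitive_part P)" by simp
    have cpos: "content P > 0"
      using P normalize_content[of P] content_eq_zero_iff[of P]
      by (metis abs_ge_zero normalize_int_def order_le_less)
    have lc: "lead_coeff P = content P * lead_coeff (primitive_part P)"
      using lead_coeff_smult[of "content P" "primitive_part P"] by (simp only: PP[symmetric])
    have "content R = 1"
      using P s by (auto simp: R_def)
    moreover have "lead_coeff R > 0"
    proof -
      have "lead_coeff R = sgn (lead_coeff P) * lead_coeff (primitive_part P)"
        unfolding R_def by (rule lead_coeff_smult)
      also have "\<dots> = \<bar>lead_coeff (primitive_part P)\<bar>"
        using cpos by (simp only: lc sgn_mult) (simp add: abs_sgn mult.commute)
      also have "\<dots> > 0"
        using P by (metis leading_coeff_0_iff primitive_part_eq_0_iff zero_less_abs_iff)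
      finally show ?thesis .
    qed
    moreover have "eval_int_poly R x = 0"
    proof -
      have "map_poly of_int P = smult (of_int (content P)) (map_poly (of_int :: int \<Rightarrow> real) (primitive_part P))"
        using map_poly_smult[of "of_int :: int \<Rightarrow> real" "content P" "primitive_part P"] by simp
      then have "eval_int_poly (primitive_part P) x = 0"
        using P cpos by auto
      moreover have "map_poly of_int R = smult (of_int (sgn (lead_coeff P)))
          (map_poly (of_int :: int \<Rightarrow> real) (primitive_part P))"
        unfolding R_def by (rule map_poly_smult) auto
      ultimately show ?thesis by simp
    qed
    moreover have "degree R = degree P"
      using s by (auto simp: R_def)
    ultimately show ?thesis
      using least by (auto simp: is_int_minpoly_def)
  qed
  then show ?thesis
    unfolding int_minpoly_def by (rule theI) (rule is_int_minpoly_unique[OF _ \<open>is_int_minpoly x R\<close>])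
qed

definition alg_degree :: "real \<Rightarrow> nat" where
  "alg_degree x = degree (int_minpoly x)"

definition alg_height :: "real \<Rightarrow> int" where
  "alg_height x = poly_height (int_minpoly x)"

definition w_exponent :: "nat \<Rightarrow> real \<Rightarrow> ereal" where
  "w_exponent n \<xi> = Sup {ereal w | w :: real.
     infinite {P :: int poly. degree P \<le> n \<and>
       0 < \<bar>eval_int_poly P \<xi>\<bar> \<and>
       \<bar>eval_int_poly P \<xi>\<bar> \<le> of_int (poly_height P) powr (- w)}}"

definition w_star_exponent :: "nat \<Rightarrow> real \<Rightarrow> ereal" where
  "w_star_exponent n \<xi> = Sup {ereal w | w :: real.
     infinite {\<alpha> :: real. algebraic \<alpha> \<and> alg_degree \<alpha> \<le> n \<and>
       0 < \<bar>\<xi> - \<alpha>\<bar> \<and>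
       \<bar>\<xi> - \<alpha>\<bar> \<le> of_int (alg_height \<alpha>) powr (- w - 1)}}"

primrec cfrac_convergent :: "(nat \<Rightarrow> int) \<Rightarrow> nat \<Rightarrow> real" where
  "cfrac_convergent a 0 = of_int (a 0)"
| "cfrac_convergent a (Suc k) = of_int (a 0) + 1 / cfrac_convergent (\<lambda>i. a (Suc i)) k"

definition cfrac_value :: "(nat \<Rightarrow> int) \<Rightarrow> real" where
  "cfrac_value a = lim (cfrac_convergent a)"

(* If \<lfloor>\<eta> * w ^ i\<rfloor> = 0, which happens for at most finitely many i, the quotient is 0 by
   convention. This value is immaterial: the positions \<lfloor>w ^ i\<rfloor> + m * 0 it would govern in
   cf_digit already carry the digit b. *)
definition block_count :: "real \<Rightarrow> real \<Rightarrow> nat \<Rightarrow> int" where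
  "block_count w \<eta> i =
     \<lfloor>of_int (\<lfloor>w ^ (i + 1)\<rfloor> - \<lfloor>w ^ i - 1\<rfloor>) / (of_int \<lfloor>\<eta> * w ^ i\<rfloor> :: real)\<rfloor>"

definition cf_digit :: "int \<Rightarrow> int \<Rightarrow> int \<Rightarrow> real \<Rightarrow> real \<Rightarrow> nat \<Rightarrow> int" where
  "cf_digit a b c w \<eta> n =
     (if \<exists>i::nat. int n = \<lfloor>w ^ i\<rfloor> then b
      else if \<exists>(j::nat) (m::int). 1 \<le> j \<and> 1 \<le> m \<and> m \<le> block_count w \<eta> j \<and>
                int n = \<lfloor>w ^ j\<rfloor> + m * \<lfloor>\<eta> * w ^ j\<rfloor> then c
      else a)"

definition \<xi>_cf :: "int \<Rightarrow> int \<Rightarrow> int \<Rightarrow> real \<Rightarrow> real \<Rightarrow> real" where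
  "\<xi>_cf a b c w \<eta> = cfrac_value (\<lambda>k. if k = 0 then 0 else cf_digit a b c w \<eta> k)"

end

theory Submission
  imports Defs
begin

text \<open>
  Between the positions \<open>k = \<lfloor>w\<^sup>i\<rfloor>\<close> and \<open>k' = \<lfloor>w\<^sup>i\<^sup>+\<^sup>1\<rfloor>\<close> the digits of \<open>\<xi>\<close> are periodic with period
  \<open>L = \<lfloor>\<eta> w\<^sup>i\<rfloor>\<close>, which yields an integer quadratic polynomial \<open>P\<^sub>i\<close>. With \<open>D\<^sub>n = q\<^sub>n \<xi> - p\<^sub>n\<close>, the
  expression \<open>D\<^sub>j\<^sub>-\<^sub>1 D\<^sub>j\<^sub>+\<^sub>L - D\<^sub>j D\<^sub>j\<^sub>+\<^sub>L\<^sub>-\<^sub>1\<close> only changes sign when \<open>j\<close> moves inside the periodic block.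
  Reading it at the start of the block gives the height \<open>\<approx> q\<^sub>k q\<^sub>k\<^sub>+\<^sub>L\<close> and the derivative \<open>\<approx> q\<^sub>k\<^sub>+\<^sub>L / q\<^sub>k\<close>,
  reading it at the end gives \<open>|P\<^sub>i(\<xi>)| \<approx> 1 / (q\<^sub>k\<^sub>' q\<^sub>k\<^sub>'\<^sub>-\<^sub>L)\<close>. All but \<open>O(i)\<close> of the first \<open>w\<^sup>i\<close> digits
  equal \<open>a\<close>, so \<open>ln q\<^sub>n\<close> is asymptotically \<open>n ln M\<close> with \<open>M\<^sup>2 = a M + 1\<close>. Since the content of \<open>P\<^sub>i\<close> divides
  \<open>c - a\<close>, these polynomials and their roots realise exactly the claimed exponents.

  Any other irreducible \<open>R\<close> of degree between 2 and \<open>d\<close> is compared with a suitable \<open>P\<^sub>i\<close> through a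
  nonzero integer obtained by elimination; as \<open>\<eta> < \<surd>w / d\<close>, the ranges of \<open>H(R)\<close> in which \<open>P\<^sub>i\<close> is
  useful overlap for consecutive \<open>i\<close> and give \<open>|R(\<xi>)| \<ge> H(R)\<close> to the power \<open>-w\<^sub>n\<^sup>*\<close>. Linear \<open>R\<close> are harmless
  because the partial quotients are bounded, and reducible polynomials are handled by Gelfond's
  inequality for heights of products.
\<close>

section \<open>Integer polynomials and their heights\<close>

text \<open>The gap between the exponents comes from close conjugates. Let X be the logarithm of the
  denominator at the start of a block. There the quadratic Q has height exp((2 + \<eta>) X) and
  value exp(-(2 w - \<eta>) X) at \<xi>, but derivative only exp(\<eta> X), smaller than the height
  by exp(2 X). So a root lies at distance exp(-2 w X), and the exponents are (2 w - \<eta>)/(2 +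
  \<eta>) and 2 w/(2 + \<eta>) - 1.

  Elimination gives two terms, one with Q(\<xi>) and one with R(\<xi>). The first is negligible
  while ln H(R) is at most (3 w/4) X; then |R(\<xi>)| is at least H(R)^(-1) H(Q)^(-(2 d - 1)) up to
  a constant. The least admissible block has X < (4/3) ln H(R), so the target is 1 + (4/3) (2 d - 1)
  (2 + \<eta>) < 2 w/(2 + \<eta>) - 1. Its leading part compares d \<eta>^2 with w, whence the
  condition \<eta> < sqrt w / d.

  Irreducibility of the quadratics is never established: a factor of degree 2 differs from its
  quadratic by an integer bounded through the content, and the height of the minimal polynomial of a
  root is controlled by the product inequality.\<close>

lemma map_poly_of_int_add:
  "map_poly (of_int :: int \<Rightarrow> real) (P + Q) = map_poly of_int P + map_poly of_int Q"
  by (intro poly_eqI) (simp add: coeff_map_poly)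

lemma map_poly_of_int_mult:
  "map_poly (of_int :: int \<Rightarrow> real) (P * Q) = map_poly of_int P * map_poly of_int Q"
  by (intro poly_eqI) (simp add: coeff_map_poly coeff_mult)

lemma eval_int_poly_add: "eval_int_poly (P + Q) x = eval_int_poly P x + eval_int_poly Q x"
  by (simp add: map_poly_of_int_add)

lemma eval_int_poly_mult: "eval_int_poly (P * Q) x = eval_int_poly P x * eval_int_poly Q x"
  by (simp add: map_poly_of_int_mult)

lemma eval_int_poly_pCons: "eval_int_poly (pCons c P) x = of_int c + x * eval_int_poly P x"
  by (subst map_poly_pCons) auto

lemma eval_int_poly_smult: "eval_int_poly (smult c P) x = of_int c * eval_int_poly P x"
  using eval_int_poly_mult[of "[:c:]" P x] by (simp add: eval_int_poly_pCons)

lemma eval_int_poly_uminus: "eval_int_poly (- P) x = - eval_int_poly P x"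
  using eval_int_poly_smult[of "-1" P x] by simp

lemma eval_int_poly_diff: "eval_int_poly (P - Q) x = eval_int_poly P x - eval_int_poly Q x"
  using eval_int_poly_add[of P "- Q" x] by (simp add: eval_int_poly_uminus)

lemma eval_int_poly_monom: "eval_int_poly (monom c n) x = of_int c * x ^ n"
  by (simp add: map_poly_monom poly_monom)

lemma eval_int_poly_quadratic:
  assumes "degree Q \<le> 2"
  shows "eval_int_poly Q x
    = of_int (coeff Q 0) + of_int (coeff Q 1) * x + of_int (coeff Q 2) * x\<^sup>2"
proof -
  have "Q = [:coeff Q 0, coeff Q 1, coeff Q 2:]"
  proof (rule poly_eqI)
    fix n
    show "coeff Q n = coeff [:coeff Q 0, coeff Q 1, coeff Q 2:] n"
    proof (cases "n \<le> 2")
      case True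
      then have "n = 0 \<or> n = 1 \<or> n = 2" by linarith
      then show ?thesis by (auto simp: numeral_2_eq_2)
    next
      case False
      then have "coeff Q n = 0" using assms by (intro coeff_eq_0) simp
      moreover have "degree [:coeff Q 0, coeff Q 1, coeff Q 2:] \<le> 2"
        by (simp add: degree_pCons_le)
      then have "coeff [:coeff Q 0, coeff Q 1, coeff Q 2:] n = 0"
        using False by (intro coeff_eq_0) linarith
      ultimately show ?thesis by simp
    qed
  qed
  then have "eval_int_poly Q x = eval_int_poly [:coeff Q 0, coeff Q 1, coeff Q 2:] x"
    by simp
  then show ?thesis by (simp add: eval_int_poly_pCons power2_eq_square algebra_simps)
qed

lemma abs_coeff_le_poly_height: "\<bar>coeff P i\<bar> \<le> poly_height P"
proof (cases "i \<le> degree P")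
  case True
  then show ?thesis unfolding poly_height_def by (intro Max_ge) auto
next
  case False
  have "0 \<le> \<bar>coeff P 0\<bar>" by simp
  also have "\<dots> \<le> poly_height P"
    unfolding poly_height_def by (intro Max_ge) auto
  finally show ?thesis using False by (simp add: coeff_eq_0)
qed

lemma poly_height_le_iff: "poly_height P \<le> h \<longleftrightarrow> (\<forall>i. \<bar>coeff P i\<bar> \<le> h)"
proof
  show "poly_height P \<le> h \<Longrightarrow> \<forall>i. \<bar>coeff P i\<bar> \<le> h"
    using abs_coeff_le_poly_height order_trans by blast
  show "\<forall>i. \<bar>coeff P i\<bar> \<le> h \<Longrightarrow> poly_height P \<le> h"
    by (auto simp: poly_height_def)
qed

lemma poly_height_nonneg: "0 \<le> poly_height P"
  using abs_coeff_le_poly_height[of P 0] by linarith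

lemma poly_height_ge_1:
  assumes "P \<noteq> 0"
  shows "1 \<le> poly_height P"
proof -
  have "lead_coeff P \<noteq> 0" using assms by simp
  then show ?thesis using abs_coeff_le_poly_height[of P "degree P"] by linarith
qed

lemma poly_height_eq_Max_coeff: "\<exists>i. poly_height P = \<bar>coeff P i\<bar>"
proof -
  have "poly_height P \<in> (\<lambda>i. \<bar>coeff P i\<bar>) ` {..degree P}"
    unfolding poly_height_def by (intro Max_in) auto
  then show ?thesis by auto
qed

lemma poly_height_smult: "poly_height (smult c P) = \<bar>c\<bar> * poly_height P"
proof (rule antisym)
  show "poly_height (smult c P) \<le> \<bar>c\<bar> * poly_height P"
    by (auto simp: poly_height_le_iff abs_mult abs_coeff_le_poly_height mult_left_mono)
  obtain i where "poly_height P = \<bar>coeff P i\<bar>" using poly_height_eq_Max_coeff by blast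
  then have "\<bar>c\<bar> * poly_height P = \<bar>coeff (smult c P) i\<bar>" by (simp add: abs_mult)
  then show "\<bar>c\<bar> * poly_height P \<le> poly_height (smult c P)"
    by (simp only: abs_coeff_le_poly_height)
qed

text \<open>Northcott's finiteness property. Both upper bounds for the exponents reduce the set in
  question to polynomials of bounded height and end here.\<close>

lemma finite_bounded_height:
  "finite {P. degree P \<le> n \<and> poly_height P \<le> h}"
proof -
  have "P \<in> Poly ` {xs. set xs \<subseteq> {-h..h} \<and> length xs = Suc n}"
    if P: "degree P \<le> n" "poly_height P \<le> h" for P
  proof
    show "P = Poly (map (coeff P) [0..<Suc n])"
    proof (rule poly_eqI)
      fix i
      show "coeff P i = coeff (Poly (map (coeff P) [0..<Suc n])) i"
        using P(1) by (auto simp: nth_default_def coeff_eq_0 simp del: upt_Suc)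
    qed
    have "\<bar>coeff P i\<bar> \<le> h" for i using P(2) poly_height_le_iff by blast
    then show "map (coeff P) [0..<Suc n] \<in> {xs. set xs \<subseteq> {-h..h} \<and> length xs = Suc n}"
      by (auto simp: abs_le_iff simp del: upt_Suc) (metis minus_le_iff)
  qed
  then have "{P. degree P \<le> n \<and> poly_height P \<le> h}
      \<subseteq> Poly ` {xs. set xs \<subseteq> {-h..h} \<and> length xs = Suc n}"
    by blast
  then show ?thesis
    by (rule finite_subset) (intro finite_imageI finite_lists_length_eq, simp)
qed

lemma eval_int_poly_altdef:
  assumes "degree P \<le> n"
  shows "eval_int_poly P x = (\<Sum>i\<le>n. of_int (coeff P i) * x ^ i)"
proof -
  have d: "degree (map_poly (of_int :: int \<Rightarrow> real) P) \<le> n"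
    using assms(1) map_poly_degree_leq order_trans by blast
  have "eval_int_poly P x
      = (\<Sum>i\<le>degree (map_poly (of_int :: int \<Rightarrow> real) P). of_int (coeff P i) * x ^ i)"
    by (simp add: poly_altdef coeff_map_poly)
  also have "\<dots> = (\<Sum>i\<le>n. of_int (coeff P i) * x ^ i)"
  proof (rule sum.mono_neutral_left)
    show "\<forall>i\<in>{..n} - {..degree (map_poly (of_int :: int \<Rightarrow> real) P)}. of_int (coeff P i) * x ^ i = 0"
      using coeff_eq_0[of "map_poly (of_int :: int \<Rightarrow> real) P"] by (auto simp: coeff_map_poly)
  qed (use d in auto)
  finally show ?thesis .
qed

lemma abs_sum_coeff_le:
  assumes "\<And>i. i \<le> n \<Longrightarrow> \<bar>f i\<bar> \<le> b"
  shows "\<bar>\<Sum>i\<le>n. real_of_int (coeff P i) * f i\<bar> \<le> real (Suc n) * b * of_int (poly_height P)"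
proof -
  have "\<bar>\<Sum>i\<le>n. real_of_int (coeff P i) * f i\<bar> \<le> (\<Sum>i\<le>n. \<bar>of_int (coeff P i) * f i\<bar>)"
    by (rule sum_abs)
  also have "\<dots> \<le> (\<Sum>i\<le>n. of_int (poly_height P) * b)"
  proof (rule sum_mono)
    fix i assume "i \<in> {..n}"
    moreover have "\<bar>of_int (coeff P i)\<bar> \<le> (of_int (poly_height P) :: real)"
      using abs_coeff_le_poly_height[of P i] by (metis of_int_abs of_int_le_iff)
    ultimately show "\<bar>of_int (coeff P i) * f i\<bar> \<le> of_int (poly_height P) * b"
      unfolding abs_mult using assms by (intro mult_mono) (auto simp: poly_height_nonneg)
  qed
  finally show ?thesis by (simp add: mult_ac)
qed

lemma abs_eval_int_poly_le:
  assumes "degree P \<le> n" "1 \<le> y" "\<bar>x\<bar> \<le> y"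
  shows "\<bar>eval_int_poly P x\<bar> \<le> real (Suc n) * y ^ n * of_int (poly_height P)"
  unfolding eval_int_poly_altdef[OF assms(1)]
proof (rule abs_sum_coeff_le)
  fix i assume "i \<le> n"
  then have "\<bar>x\<bar> ^ i \<le> y ^ i" "y ^ i \<le> y ^ n"
    using assms by (auto intro: power_mono power_increasing)
  then show "\<bar>x ^ i\<bar> \<le> y ^ n" by (simp add: power_abs)
qed

text \<open>A Lipschitz bound linear in the height. With y a root of P it turns a lower bound for
  |P(x)| into a lower bound for the distance from x to y.\<close>

lemma abs_eval_int_poly_diff_le:
  assumes "degree P \<le> n" "1 \<le> z" "\<bar>x\<bar> \<le> z" "\<bar>y\<bar> \<le> z"
  shows "\<bar>eval_int_poly P x - eval_int_poly P y\<bar>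
    \<le> real (Suc n) * (\<bar>x - y\<bar> * (real n * z ^ n)) * of_int (poly_height P)"
proof -
  have "eval_int_poly P x - eval_int_poly P y = (\<Sum>i\<le>n. of_int (coeff P i) * (x ^ i - y ^ i))"
    unfolding eval_int_poly_altdef[OF assms(1)] by (simp add: sum_subtractf algebra_simps)
  also have "\<bar>\<dots>\<bar> \<le> real (Suc n) * (\<bar>x - y\<bar> * (real n * z ^ n)) * of_int (poly_height P)"
  proof (rule abs_sum_coeff_le)
    fix i assume i: "i \<le> n"
    have "\<bar>\<Sum>j<i. y ^ (i - Suc j) * x ^ j\<bar> \<le> (\<Sum>j<i. \<bar>y ^ (i - Suc j) * x ^ j\<bar>)" by (rule sum_abs)
    also have "\<dots> \<le> (\<Sum>j<i. z ^ n)"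
    proof (rule sum_mono)
      fix j assume j: "j \<in> {..<i}"
      have "\<bar>y ^ (i - Suc j) * x ^ j\<bar> \<le> z ^ (i - Suc j) * z ^ j"
        unfolding abs_mult power_abs using assms by (intro mult_mono power_mono) auto
      also have "\<dots> = z ^ (i - 1)" using j by (simp flip: power_add)
      also have "\<dots> \<le> z ^ n" using i assms by (intro power_increasing) auto
      finally show "\<bar>y ^ (i - Suc j) * x ^ j\<bar> \<le> z ^ n" .
    qed
    also have "\<dots> \<le> real n * z ^ n" using i assms by (simp add: mult_right_mono)
    finally show "\<bar>x ^ i - y ^ i\<bar> \<le> \<bar>x - y\<bar> * (real n * z ^ n)"
      unfolding power_diff_sumr2 abs_mult by (intro mult_left_mono) auto
  qed
  finally show ?thesis .
qed

subsection \<open>Heights of products\<close>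

text \<open>Quantitative interpolation by induction on the nodes: dividing P - P(y) by X - y gives a
  polynomial of smaller degree, whose values at the other nodes grow by at most 2/r, where r is the
  distance from y to the nearest of them.\<close>

lemma interpolation_coeff_bound:
  fixes T :: "real set"
  assumes "finite T" "card T = Suc n"
  shows "\<exists>C>0. \<forall>P :: real poly. \<forall>e. degree P \<le> n \<longrightarrow> (\<forall>x\<in>T. \<bar>poly P x\<bar> \<le> e)
    \<longrightarrow> (\<forall>i. \<bar>coeff P i\<bar> \<le> C * e)"
  using assms
proof (induction n arbitrary: T)
  case 0
  then obtain y where T: "T = {y}" by (auto simp: card_Suc_eq)
  have "\<bar>coeff P i\<bar> \<le> 1 * e"
    if P: "degree P \<le> 0" "\<forall>x\<in>T. \<bar>poly P x\<bar> \<le> e" for P :: "real poly" and e i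
  proof -
    obtain u where u: "P = [:u:]" using P(1) by (auto elim: degree_eq_zeroE)
    have "\<bar>u\<bar> \<le> e" using P(2) T u by simp
    then show ?thesis using u by (cases i) auto
  qed
  then show ?case by (intro exI[of _ 1]) auto
next
  case (Suc n)
  then obtain y S where T: "T = insert y S" "y \<notin> S" "card S = Suc n" "finite S"
    by (metis card_Suc_eq_finite)
  obtain C where C: "C > 0" and IH: "\<And>P e i. degree P \<le> n \<Longrightarrow> (\<forall>x\<in>S. \<bar>poly P x\<bar> \<le> e)
      \<Longrightarrow> \<bar>coeff P i\<bar> \<le> C * e"
    using Suc.IH[OF T(4,3)] by blast
  define r where "r = Min ((\<lambda>x. \<bar>x - y\<bar>) ` S)"
  have S0: "S \<noteq> {}" using T by auto
  have r: "r \<le> \<bar>x - y\<bar>" if "x \<in> S" for x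
    unfolding r_def using that T by (intro Min_le) auto
  have "r \<in> (\<lambda>x. \<bar>x - y\<bar>) ` S"
    unfolding r_def using T S0 by (intro Min_in) auto
  then have r0: "r > 0" using T by auto
  \<comment> \<open>The summand 1 pays for the constant P(y), the factor 1 + |y| for multiplying the
    quotient by X - y.\<close>
  define C' where "C' = 1 + (1 + \<bar>y\<bar>) * (C * (2 / r))"
  have "\<bar>coeff P i\<bar> \<le> C' * e"
    if P: "degree P \<le> Suc n" "\<forall>x\<in>T. \<bar>poly P x\<bar> \<le> e" for P :: "real poly" and e i
  proof -
    have e: "\<bar>poly P y\<bar> \<le> e" and e0: "e \<ge> 0" using P T by force+
    define Q where "Q = synthetic_div P y"
    have PQ: "P = [:poly P y:] + [:- y, 1:] * Q"
      using synthetic_div_correct'[of y P] by (simp add: Q_def algebra_simps)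
    have dQ: "degree Q \<le> n" using P(1) by (simp add: Q_def degree_synthetic_div)
    have "\<bar>poly Q x\<bar> \<le> 2 * e / r" if x: "x \<in> S" for x
    proof -
      have "poly P x = poly P y + (x - y) * poly Q x"
        by (subst PQ) (simp add: algebra_simps)
      then have "\<bar>x - y\<bar> * \<bar>poly Q x\<bar> = \<bar>poly P x - poly P y\<bar>"
        by (simp add: abs_mult[symmetric])
      also have "\<dots> \<le> 2 * e" using e P(2) T x by fastforce
      finally have "r * \<bar>poly Q x\<bar> \<le> 2 * e"
        using r[OF x] by (meson abs_ge_zero mult_right_mono order_trans)
      then show ?thesis using r0 by (simp add: field_simps)
    qed
    then have cQ: "\<bar>coeff Q j\<bar> \<le> C * (2 * e / r)" for j
      using IH[OF dQ] by blast
    have "coeff P i = coeff [:poly P y:] i + coeff ([:- y, 1:] * Q) i"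
      by (subst PQ) (simp only: coeff_add)
    also have "coeff ([:- y, 1:] * Q) i = - y * coeff Q i + (case i of 0 \<Rightarrow> 0 | Suc j \<Rightarrow> coeff Q j)"
      by (simp add: coeff_pCons split: nat.split)
    finally have "\<bar>coeff P i\<bar> \<le> \<bar>coeff [:poly P y:] i\<bar> + \<bar>y\<bar> * \<bar>coeff Q i\<bar>
        + \<bar>case i of 0 \<Rightarrow> 0 | Suc j \<Rightarrow> coeff Q j\<bar>"
      by (simp add: abs_mult[symmetric])
    also have "\<dots> \<le> e + \<bar>y\<bar> * (C * (2 * e / r)) + C * (2 * e / r)"
    proof (intro add_mono mult_left_mono cQ)
      show "\<bar>coeff [:poly P y:] i\<bar> \<le> e" using e e0 by (cases i) auto
      show "\<bar>case i of 0 \<Rightarrow> 0 | Suc j \<Rightarrow> coeff Q j\<bar> \<le> C * (2 * e / r)"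
        using cQ C r0 e0 by (auto split: nat.split)
    qed auto
    also have "\<dots> = C' * e" by (simp add: C'_def algebra_simps add_divide_distrib)
    finally show ?thesis .
  qed
  moreover have "C' > 0" unfolding C'_def using C r0 by (simp add: add_pos_nonneg)
  ultimately show ?case by blast
qed

text \<open>Among \<open>2n + 1\<close> points at most \<open>n\<close> make the first factor small and at most \<open>n\<close> the second,
  so both are large at a common point.\<close>

lemma poly_height_mult_ge:
  "\<exists>C\<ge>1. \<forall>P Q. degree P \<le> n \<longrightarrow> degree Q \<le> n \<longrightarrow>
     of_int (poly_height P) * of_int (poly_height Q) \<le> C * real_of_int (poly_height (P * Q))"
proof -
  define T where "T = real ` {..2 * n}"
  have T: "finite T" "card T = 2 * n + 1"
    by (auto simp: T_def card_image inj_on_def)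
  have fin: "finite {S. S \<subseteq> T \<and> card S = Suc n}" using T by simp
  have "\<forall>S\<in>{S. S \<subseteq> T \<and> card S = Suc n}. \<exists>C>0. \<forall>P :: real poly. \<forall>e. degree P \<le> n \<longrightarrow>
      (\<forall>x\<in>S. \<bar>poly P x\<bar> \<le> e) \<longrightarrow> (\<forall>i. \<bar>coeff P i\<bar> \<le> C * e)"
  proof
    fix S assume "S \<in> {S. S \<subseteq> T \<and> card S = Suc n}"
    then show "\<exists>C>0. \<forall>P :: real poly. \<forall>e. degree P \<le> n \<longrightarrow>
        (\<forall>x\<in>S. \<bar>poly P x\<bar> \<le> e) \<longrightarrow> (\<forall>i. \<bar>coeff P i\<bar> \<le> C * e)"
      using T finite_subset by (intro interpolation_coeff_bound) auto
  qed
  from bchoice[OF this] obtain C where C: "\<forall>S\<in>{S. S \<subseteq> T \<and> card S = Suc n}. C S > 0 \<and> (\<forall>P :: real poly. \<forall>e.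
      degree P \<le> n \<longrightarrow> (\<forall>x\<in>S. \<bar>poly P x\<bar> \<le> e) \<longrightarrow> (\<forall>i. \<bar>coeff P i\<bar> \<le> C S * e))" ..
  \<comment> \<open>The added 1 makes K strictly larger than every \<open>C S\<close>; this
    strictness yields the contradiction in \<open>few\<close>.\<close>
  define K where "K = 1 + (\<Sum>S | S \<subseteq> T \<and> card S = Suc n. C S)"
  have K: "C S < K" if "S \<subseteq> T" "card S = Suc n" for S
  proof -
    have "C S \<le> (\<Sum>S | S \<subseteq> T \<and> card S = Suc n. C S)"
      using that fin C by (intro member_le_sum) (auto simp: less_imp_le)
    then show ?thesis by (simp add: K_def)
  qed
  have K0: "K \<ge> 1" unfolding K_def using C by (auto intro!: sum_nonneg simp: less_imp_le)
  have few: "card {x \<in> T. \<bar>eval_int_poly P x\<bar> * K < of_int (poly_height P)} \<le> n"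
    if P: "degree P \<le> n" for P
  proof (rule ccontr)
    assume "\<not> ?thesis"
    then have "Suc n \<le> card {x \<in> T. \<bar>eval_int_poly P x\<bar> * K < of_int (poly_height P)}" by simp
    then obtain S where S: "S \<subseteq> {x \<in> T. \<bar>eval_int_poly P x\<bar> * K < of_int (poly_height P)}"
      "card S = Suc n"
      by (meson obtain_subset_with_card_n)
    have ST: "S \<subseteq> T" using S by auto
    have h0: "poly_height P > 0"
    proof -
      have "S \<noteq> {}" using S by auto
      then obtain x where "\<bar>eval_int_poly P x\<bar> * K < of_int (poly_height P)" using S by auto
      moreover have "0 \<le> \<bar>eval_int_poly P x\<bar> * K" using K0 by simp
      ultimately have "0 < real_of_int (poly_height P)" by linarith
      then show ?thesis by simp
    qed
    have "\<forall>x\<in>S. \<bar>eval_int_poly P x\<bar> \<le> of_int (poly_height P) / K"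
      using S K0 by (auto simp: field_simps)
    moreover have "degree (map_poly (of_int :: int \<Rightarrow> real) P) \<le> n"
      using P map_poly_degree_leq order_trans by blast
    ultimately have "\<bar>coeff (map_poly (of_int :: int \<Rightarrow> real) P) i\<bar> \<le> C S * (of_int (poly_height P) / K)" for i
      using C ST S(2) by blast
    then have le: "\<bar>real_of_int (coeff P i)\<bar> \<le> C S * (of_int (poly_height P) / K)" for i
      by (simp add: coeff_map_poly)
    obtain i where "poly_height P = \<bar>coeff P i\<bar>" using poly_height_eq_Max_coeff by blast
    then have "of_int (poly_height P) \<le> C S * (of_int (poly_height P) / K)"
      using le[of i] by simp
    also have "\<dots> < K * (of_int (poly_height P) / K)"
      using K[OF ST S(2)] h0 K0 by (intro mult_strict_right_mono) auto
    finally show False using K0 by simp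
  qed
  \<comment> \<open>One K for each factor; the rest bounds the value of the product, of degree at
    most 2 n, at the nodes 0, ..., 2 n.\<close>
  define D where "D = K * K * (real (Suc (2 * n)) * (real (2 * n) + 1) ^ (2 * n))"
  have D1: "D \<ge> 1"
  proof -
    have "1 \<le> K * K" using K0 mult_mono[of 1 K 1 K] by simp
    moreover have "1 \<le> (real (2 * n) + 1) ^ (2 * n)" by (rule one_le_power) simp
    then have "1 \<le> real (Suc (2 * n)) * (real (2 * n) + 1) ^ (2 * n)"
      using mult_mono[of 1 "real (Suc (2 * n))" 1 "(real (2 * n) + 1) ^ (2 * n)"] by simp
    ultimately show ?thesis unfolding D_def
      using mult_mono[of 1 "K * K" 1 "real (Suc (2 * n)) * (real (2 * n) + 1) ^ (2 * n)"] by simp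
  qed
  have "of_int (poly_height P) * of_int (poly_height Q) \<le> D * real_of_int (poly_height (P * Q))"
    if P: "degree P \<le> n" and Q: "degree Q \<le> n" for P Q
  proof -
    define A where "A = (\<lambda>P. {x \<in> T. \<bar>eval_int_poly P x\<bar> * K < of_int (poly_height P)})"
    have "card (A P \<union> A Q) \<le> card (A P) + card (A Q)" by (rule card_Un_le)
    also have "\<dots> \<le> n + n" using few[OF P] few[OF Q] unfolding A_def by linarith
    also have "\<dots> < card T" using T by simp
    finally have "\<not> T \<subseteq> A P \<union> A Q"
      by (metis (no_types, lifting) A_def T(1) card_mono finite_Un finite_subset leD mem_Collect_eq subsetI)
    then obtain x where x: "x \<in> T" "x \<notin> A P" "x \<notin> A Q" by blast
    have xb: "\<bar>x\<bar> \<le> real (2 * n) + 1" using x(1) by (auto simp: T_def)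
    have 1: "of_int (poly_height P) \<le> \<bar>eval_int_poly P x\<bar> * K"
      and 2: "of_int (poly_height Q) \<le> \<bar>eval_int_poly Q x\<bar> * K"
      using x by (auto simp: A_def)
    have "of_int (poly_height P) * of_int (poly_height Q)
        \<le> (\<bar>eval_int_poly P x\<bar> * K) * (\<bar>eval_int_poly Q x\<bar> * K)"
      using 1 2 poly_height_nonneg K0 by (intro mult_mono) auto
    also have "\<dots> = K * K * \<bar>eval_int_poly (P * Q) x\<bar>"
      by (simp add: eval_int_poly_mult abs_mult)
    also have "\<dots> \<le> K * K * (real (Suc (2 * n)) * (real (2 * n) + 1) ^ (2 * n)
        * of_int (poly_height (P * Q)))"
      using P Q K0 xb degree_mult_le[of P Q]
      by (intro mult_left_mono abs_eval_int_poly_le) auto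
    finally show ?thesis by (simp add: D_def mult_ac)
  qed
  with D1 show ?thesis by blast
qed

subsection \<open>Elimination against a quadratic polynomial\<close>

text \<open>One step of pseudo-division replaces P by lc(Q) P - p X^m Q, with p the coefficient of P
  at m + 2, and multiplies the height by at most 2 H(Q). For the quotient a bound on its value at x
  suffices, and there |x| \<le> 1 makes each new monomial harmless.\<close>

lemma pseudo_remainder_quadratic:
  fixes P Q :: "int poly"
  assumes "degree Q = 2" "\<bar>x\<bar> \<le> 1" "degree P \<le> Suc m"
  shows "\<exists>S u v. smult (lead_coeff Q ^ m) P = S * Q + [:v, u:] \<and> (S = 0 \<or> degree S < m) \<and>
    \<bar>u\<bar> \<le> (2 * poly_height Q) ^ m * poly_height P \<and>
    \<bar>v\<bar> \<le> (2 * poly_height Q) ^ m * poly_height P \<and>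
    \<bar>eval_int_poly S x\<bar> \<le> real m * of_int ((2 * poly_height Q) ^ m * poly_height P)"
  using assms(3)
proof (induction m arbitrary: P)
  case 0
  have "P = [:coeff P 0, coeff P 1:]"
  proof (rule poly_eqI)
    fix n
    show "coeff P n = coeff [:coeff P 0, coeff P 1:] n"
      using 0 by (cases n; cases "n - 1") (auto simp: coeff_eq_0)
  qed
  then show ?case using abs_coeff_le_poly_height[of P]
    by (intro exI[of _ 0] exI[of _ "coeff P 1"] exI[of _ "coeff P 0"]) auto
next
  case (Suc m)
  define A where "A = lead_coeff Q"
  define H where "H = poly_height Q"
  define p where "p = coeff P (Suc (Suc m))"
  define P' where "P' = smult A P - monom p m * Q"
  have Q0: "Q \<noteq> 0" using assms(1) by auto
  have H1: "H \<ge> 1" unfolding H_def using poly_height_ge_1[OF Q0] .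
  have AH: "\<bar>A\<bar> \<le> H" unfolding A_def H_def by (rule abs_coeff_le_poly_height)
  have hP: "0 \<le> poly_height P" by (rule poly_height_nonneg)
  have pP: "\<bar>p\<bar> \<le> poly_height P" unfolding p_def by (rule abs_coeff_le_poly_height)
  have "degree P' \<le> Suc m"
  proof (rule degree_le, intro allI impI)
    fix i assume i: "Suc m < i"
    show "coeff P' i = 0"
    proof (cases "i = Suc (Suc m)")
      case True
      then show ?thesis using assms(1)
        by (simp add: P'_def p_def A_def coeff_monom_mult numeral_2_eq_2)
    next
      case False
      then have "coeff P i = 0" "coeff Q (i - m) = 0"
        using i Suc.prems assms(1) by (auto intro!: coeff_eq_0)
      then show ?thesis by (simp add: P'_def coeff_monom_mult)
    qed
  qed
  then obtain S u v where S: "smult (A ^ m) P' = S * Q + [:v, u:]" "S = 0 \<or> degree S < m"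
    "\<bar>u\<bar> \<le> (2 * H) ^ m * poly_height P'" "\<bar>v\<bar> \<le> (2 * H) ^ m * poly_height P'"
    "\<bar>eval_int_poly S x\<bar> \<le> real m * of_int ((2 * H) ^ m * poly_height P')"
    using Suc.IH[of P'] unfolding A_def H_def by blast
  have hP': "poly_height P' \<le> 2 * H * poly_height P"
    unfolding poly_height_le_iff
  proof
    fix i
    have 1: "\<bar>A * coeff P i\<bar> \<le> H * poly_height P"
      unfolding abs_mult using AH abs_coeff_le_poly_height H1 by (intro mult_mono) auto
    have 2: "\<bar>p * coeff Q (i - m)\<bar> \<le> poly_height P * H"
      unfolding abs_mult using pP hP abs_coeff_le_poly_height[of Q] H_def
      by (intro mult_mono) auto
    have "\<bar>coeff P' i\<bar> \<le> \<bar>A * coeff P i\<bar> + \<bar>p * coeff Q (i - m)\<bar>"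
      by (auto simp: P'_def coeff_monom_mult)
    then show "\<bar>coeff P' i\<bar> \<le> 2 * H * poly_height P"
      using 1 2 by (simp add: algebra_simps)
  qed
  have big: "(2 * H) ^ m * poly_height P' \<le> (2 * H) ^ Suc m * poly_height P"
    using mult_left_mono[OF hP', of "(2 * H) ^ m"] H1 by (simp add: algebra_simps)
  define S' where "S' = S + monom (A ^ m * p) m"
  have e1: "smult (A ^ Suc m) P = S' * Q + [:v, u:]"
  proof -
    have "smult (A ^ Suc m) P = smult (A ^ m) (P' + monom p m * Q)"
      by (simp add: P'_def mult.commute)
    also have "\<dots> = S * Q + [:v, u:] + smult (A ^ m) (monom p m) * Q"
      by (simp add: smult_add_right S(1))
    also have "smult (A ^ m) (monom p m) = monom (A ^ m * p) m"
      by (simp add: smult_monom)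
    finally show ?thesis by (simp add: S'_def algebra_simps)
  qed
  have e2: "S' = 0 \<or> degree S' < Suc m"
  proof -
    have "degree S \<le> m" using S(2) by auto
    then have "degree S' \<le> m" unfolding S'_def
      by (intro degree_add_le) (auto intro: degree_monom_le)
    then show ?thesis by simp
  qed
  have e3: "\<bar>eval_int_poly S' x\<bar> \<le> real (Suc m) * of_int ((2 * H) ^ Suc m * poly_height P)"
  proof -
    have "\<bar>A ^ m * p\<bar> \<le> (2 * H) ^ Suc m * poly_height P"
    proof -
      have "\<bar>A\<bar> ^ m \<le> (2 * H) ^ m" using AH H1 by (intro power_mono) auto
      also have "\<dots> \<le> (2 * H) ^ Suc m" using H1 by (intro power_increasing) auto
      finally show ?thesis unfolding abs_mult power_abs using pP H1 by (intro mult_mono) auto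
    qed
    then have 1: "\<bar>of_int (A ^ m * p)\<bar> \<le> real_of_int ((2 * H) ^ Suc m * poly_height P)"
      by (metis of_int_abs of_int_le_iff)
    have "\<bar>of_int (A ^ m * p) * x ^ m\<bar> \<le> \<bar>real_of_int (A ^ m * p)\<bar> * 1"
      unfolding abs_mult[of _ "x ^ m"] power_abs using assms(2)
      by (intro mult_left_mono power_le_one) auto
    with 1 have 2: "\<bar>of_int (A ^ m * p) * x ^ m\<bar> \<le> real_of_int ((2 * H) ^ Suc m * poly_height P)"
      by linarith
    have "real m * of_int ((2 * H) ^ m * poly_height P') \<le> real m * of_int ((2 * H) ^ Suc m * poly_height P)"
      using big by (intro mult_left_mono) (auto simp only: of_int_le_iff of_nat_0_le_iff)
    then have "\<bar>eval_int_poly S x\<bar> \<le> real m * of_int ((2 * H) ^ Suc m * poly_height P)"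
      using S(5) by linarith
    moreover have "eval_int_poly S' x = eval_int_poly S x + of_int (A ^ m * p) * x ^ m"
      unfolding S'_def by (simp only: eval_int_poly_add eval_int_poly_monom)
    ultimately show ?thesis using 2 by (simp add: algebra_simps)
  qed
  show ?case
    using e1 e2 e3 order_trans[OF S(3) big] order_trans[OF S(4) big] unfolding A_def H_def by blast
qed

text \<open>If \<open>u X + v\<close> is the pseudo-remainder of \<open>R\<close> modulo \<open>Q\<close>, then the integer \<open>u\<^sup>2 Q(-v/u)\<close> is
  nonzero; expanding it around \<open>x\<close> bounds it in terms of \<open>Q(x)\<close> and \<open>R(x)\<close>.\<close>

lemma elimination_inequality:
  fixes R Q :: "int poly"
  assumes R: "irreducible R" "2 \<le> degree R" "degree R \<le> Suc m"
    and Q: "degree Q = 2" and ndvd: "\<not> R dvd Q" and x: "\<bar>x\<bar> \<le> 1"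
  shows "1 \<le> (6 + 5 * real m) * 4 ^ m * of_int (poly_height R) * of_int (poly_height Q) ^ (2 * m + 1)
    * (of_int (poly_height R) * \<bar>eval_int_poly Q x\<bar> + \<bar>eval_int_poly R x\<bar>)"
proof -
  define A B C where "A = coeff Q 2" and "B = coeff Q 1" and "C = coeff Q 0"
  define H where "H = poly_height Q"
  define U where "U = (2 * H) ^ m * poly_height R"
  have lcA: "lead_coeff Q = A" using Q by (simp add: A_def)
  have Q0: "Q \<noteq> 0" using Q by auto
  have A0: "A \<noteq> 0" using Q0 lcA by (metis leading_coeff_0_iff)
  have R0: "R \<noteq> 0" using R by auto
  have H1: "H \<ge> 1" unfolding H_def using poly_height_ge_1[OF Q0] .
  have hR: "poly_height R \<ge> 1" by (rule poly_height_ge_1[OF R0])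
  obtain S u v where S: "smult (A ^ m) R = S * Q + [:v, u:]" "S = 0 \<or> degree S < m"
    "\<bar>u\<bar> \<le> U" "\<bar>v\<bar> \<le> U" "\<bar>eval_int_poly S x\<bar> \<le> real m * of_int U"
    using pseudo_remainder_quadratic[OF Q x R(3)] unfolding lcA U_def H_def by blast
  have prime: "prime_elem R" using R(1) by (rule irreducible_imp_prime_poly)
  \<comment> \<open>This is u^2 Q(-v/u), that is, the resultant of Q and u X + v; the homogeneous
    form also makes sense for u = 0.\<close>
  define N where "N = A * v\<^sup>2 - B * u * v + C * u\<^sup>2"
  have "N \<noteq> 0"
  proof
    assume N0: "N = 0"
    show False
    proof (cases "u = 0")
      case True
      \<comment> \<open>Now A^m R = S Q, so the prime R divides S, although the degree of R is that
        of S plus 2.\<close>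
      then have "v = 0" using N0 A0 by (simp add: N_def)
      with True S(1) have SQ: "smult (A ^ m) R = S * Q" by simp
      then have "R dvd S * Q" by (metis dvd_smult dvd_refl)
      with prime ndvd have "R dvd S" using prime_elem_dvd_multD by blast
      moreover have "S \<noteq> 0" using SQ A0 R0 by auto
      ultimately have "degree R \<le> degree S" using dvd_imp_degree_le by blast
      moreover have "degree (smult (A ^ m) R) = degree S + degree Q"
        using SQ \<open>S \<noteq> 0\<close> Q0 by (simp add: degree_mult_eq)
      ultimately show False using Q A0 by simp
    next
      case False
      \<comment> \<open>If N vanished, the rational number -v/u would be a root of Q and hence of R.
        Gauss's lemma then gives a primitive linear factor of R, impossible for an irreducible R of
        degree at least 2.\<close>
      define y where "y = - real_of_int v / of_int u"
      have "eval_int_poly [:v, u:] y = 0" using False by (simp add: eval_int_poly_pCons y_def)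
      moreover have "eval_int_poly Q y = 0"
      proof -
        have "of_int u ^ 2 * eval_int_poly Q y = of_int N"
          using False by (simp add: eval_int_poly_quadratic Q N_def y_def A_def B_def C_def
              field_simps power2_eq_square)
        then show ?thesis using N0 False by simp
      qed
      ultimately have "of_int (A ^ m) * eval_int_poly R y = 0"
        unfolding eval_int_poly_smult[symmetric] S(1) by (simp add: eval_int_poly_add eval_int_poly_mult)
      then have Ry: "eval_int_poly R y = 0" using A0 by simp
      define g where "g = gcd u v"
      obtain u' v' where uv: "u = g * u'" "v = g * v'" "coprime u' v'"
        unfolding g_def using False gcd_coprime_exists[of u v] by (metis mult.commute gcd_eq_0_iff)
      have g0: "g \<noteq> 0" "u' \<noteq> 0" using uv False by auto
      have y': "y = - of_int v' / of_int u'" using uv g0 by (simp add: y_def)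
      have irr: "prime_elem [:v', u':]"
        using g0 uv(3) by (intro prime_elem_linear_poly) (simp_all add: coprime_commute)
      have dv: "[:v', u':] dvd R"
      proof -
        obtain q r where qr: "pseudo_divmod R [:v', u':] = (q, r)" by fastforce
        have "[:v', u':] \<noteq> 0" using g0 by simp
        from pseudo_divmod[OF this qr] have
          e: "smult (u' ^ (Suc (degree R) - 1)) R = [:v', u':] * q + r" and r: "r = 0 \<or> degree r = 0"
          using g0 by auto
        from r obtain c where c: "r = [:c:]" by (metis degree_eq_zeroE degree_0)
        have "eval_int_poly (smult (u' ^ (Suc (degree R) - 1)) R) y = 0"
          using Ry by (simp add: eval_int_poly_smult)
        then have "c = 0"
          unfolding e c eval_int_poly_add eval_int_poly_mult using g0
          by (simp add: eval_int_poly_pCons y')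
        then have "smult (u' ^ degree R) R = [:v', u':] * q" using e c by simp
        then have "[:v', u':] dvd smult (u' ^ degree R) R" by (rule dvdI)
        then have "[:v', u':] dvd [:u' ^ degree R:] * R" by simp
        then have "[:v', u':] dvd [:u' ^ degree R:] \<or> [:v', u':] dvd R"
          using irr prime_elem_dvd_multD by blast
        moreover have "\<not> [:v', u':] dvd [:u' ^ degree R:]"
        proof
          assume "[:v', u':] dvd [:u' ^ degree R:]"
          moreover have "[:u' ^ degree R:] \<noteq> 0" using g0 by simp
          ultimately have "degree [:v', u':] \<le> degree [:u' ^ degree R:]" by (rule dvd_imp_degree_le)
          then show False using g0 by simp
        qed
        ultimately show ?thesis by blast
      qed
      then obtain T where T: "R = [:v', u':] * T" by (elim dvdE)
      have "T \<noteq> 0" using T R0 by auto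
      then have "degree R = degree [:v', u':] + degree T"
        unfolding T using g0 by (intro degree_mult_eq) auto
      then have "degree R = 1 + degree T" using g0 by simp
      then have "degree T \<ge> 1" using R(2) by simp
      then have "\<not> is_unit T" by (auto simp: is_unit_poly_iff)
      moreover have "\<not> is_unit [:v', u':]" using irr by (simp add: prime_elem_not_unit)
      ultimately show False using irreducibleD[OF R(1) T] by blast
    qed
  qed
  define q r e where "q = eval_int_poly Q x" and "r = eval_int_poly R x"
    and "e = of_int u * x + real_of_int v"
  define u' where "u' = real_of_int u"
  define A' B' C' where "A' = real_of_int A" and "B' = real_of_int B" and "C' = real_of_int C"
  define H' U' where "H' = real_of_int H" and "U' = real_of_int U"
  have U1: "U \<ge> 0" using S(3) by linarith
  have real_bounds: "\<bar>u'\<bar> \<le> U'" "\<bar>real_of_int v\<bar> \<le> U'" "\<bar>A'\<bar> \<le> H'" "\<bar>B'\<bar> \<le> H'" "H' \<ge> 1" "U' \<ge> 0"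
    using S(3,4) H1 U1 abs_coeff_le_poly_height[of Q]
    unfolding u'_def U'_def A'_def B'_def H'_def A_def B_def H_def
    by (auto simp flip: of_int_abs)
  have qx: "q = C' + B' * x + A' * x\<^sup>2"
    unfolding q_def using Q by (simp add: eval_int_poly_quadratic A_def B_def C_def A'_def B'_def C'_def)
  \<comment> \<open>Taylor expansion of Q around x at the point -v/u = x - e/u, multiplied by
    u^2.\<close>
  have "real_of_int N = u'\<^sup>2 * q - u' * e * (2 * A' * x + B') + A' * e\<^sup>2"
    unfolding N_def qx e_def u'_def A'_def B'_def C'_def
    by (simp add: algebra_simps power2_eq_square)
  moreover have "1 \<le> \<bar>real_of_int N\<bar>" using \<open>N \<noteq> 0\<close> by (simp flip: of_int_abs)
  ultimately have "1 \<le> \<bar>u'\<^sup>2 * q\<bar> + \<bar>u' * e * (2 * A' * x + B')\<bar> + \<bar>A' * e\<^sup>2\<bar>" by linarith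
  moreover have "\<bar>u'\<^sup>2 * q\<bar> \<le> U'\<^sup>2 * \<bar>q\<bar>"
  proof -
    have "u'\<^sup>2 \<le> U'\<^sup>2" using real_bounds by (simp add: abs_le_square_iff[symmetric])
    then show ?thesis by (simp add: abs_mult mult_right_mono)
  qed
  moreover have "\<bar>u' * e * (2 * A' * x + B')\<bar> \<le> U' * \<bar>e\<bar> * (3 * H')"
  proof -
    have "\<bar>A' * x\<bar> \<le> H' * 1" unfolding abs_mult using real_bounds x by (intro mult_mono) auto
    then have "\<bar>2 * A' * x + B'\<bar> \<le> 3 * H'" using real_bounds by linarith
    then show ?thesis unfolding abs_mult[of "u' * e"] abs_mult[of u' e]
      using real_bounds by (intro mult_mono) auto
  qed
  moreover have "\<bar>A' * e\<^sup>2\<bar> \<le> H' * (2 * U' * \<bar>e\<bar>)"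
  proof -
    have "\<bar>u' * x\<bar> \<le> U' * 1" unfolding abs_mult using real_bounds x by (intro mult_mono) auto
    then have "\<bar>e\<bar> \<le> 2 * U'" using real_bounds unfolding e_def u'_def by linarith
    then have "\<bar>e\<bar> * \<bar>e\<bar> \<le> 2 * U' * \<bar>e\<bar>" by (intro mult_right_mono) auto
    then show ?thesis unfolding abs_mult power2_eq_square
      using real_bounds mult_mono[of "\<bar>A'\<bar>" H' "\<bar>e\<bar> * \<bar>e\<bar>" "2 * U' * \<bar>e\<bar>"] by auto
  qed
  ultimately have main: "1 \<le> U'\<^sup>2 * \<bar>q\<bar> + 5 * (U' * H') * \<bar>e\<bar>" by (simp add: algebra_simps)
  have "e = A' ^ m * r - eval_int_poly S x * q"
  proof -
    have "eval_int_poly (smult (A ^ m) R) x = eval_int_poly (S * Q + [:v, u:]) x" using S(1) by simp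
    then show ?thesis
      by (simp add: eval_int_poly_add eval_int_poly_mult eval_int_poly_smult eval_int_poly_pCons
          e_def r_def q_def A'_def algebra_simps)
  qed
  then have "\<bar>e\<bar> \<le> \<bar>A' ^ m * r\<bar> + \<bar>eval_int_poly S x * q\<bar>" by linarith
  also have "\<bar>A' ^ m * r\<bar> \<le> H' ^ m * \<bar>r\<bar>"
    unfolding abs_mult power_abs using real_bounds by (intro mult_right_mono power_mono) auto
  also have "\<bar>eval_int_poly S x * q\<bar> \<le> real m * U' * \<bar>q\<bar>"
    unfolding abs_mult using S(5) U'_def by (intro mult_right_mono) auto
  finally have eb: "\<bar>e\<bar> \<le> H' ^ m * \<bar>r\<bar> + real m * U' * \<bar>q\<bar>" by simp
  define h where "h = real_of_int (poly_height R)"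
  have h1: "h \<ge> 1" using hR by (simp add: h_def)
  have U'h: "U' = 2 ^ m * H' ^ m * h"
    by (simp add: U'_def U_def H'_def h_def power_mult_distrib)
  have "1 \<le> U'\<^sup>2 * \<bar>q\<bar> + 5 * (U' * H') * (H' ^ m * \<bar>r\<bar> + real m * U' * \<bar>q\<bar>)"
    using main eb mult_left_mono[OF eb, of "5 * (U' * H')"] real_bounds by simp
  also have "\<dots> = U'\<^sup>2 * \<bar>q\<bar> * (1 + 5 * real m * H') + 5 * 2 ^ m * (h * H' ^ (2 * m + 1) * \<bar>r\<bar>)"
    unfolding U'h by (simp add: algebra_simps power2_eq_square power_mult mult_2 power_add)
  \<comment> \<open>The factor 4^m comes from the square of 2^m in U', the power H'^(2 m + 1) from
    the square of H'^m and one further H'. The constant 6 + 5 m covers 1 + 5 m H' divided by H' as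
    well as the 5 of the second term.\<close>
  also have "\<dots> \<le> (6 + 5 * real m) * 4 ^ m * (h * H' ^ (2 * m + 1) * (h * \<bar>q\<bar>))
      + (6 + 5 * real m) * 4 ^ m * (h * H' ^ (2 * m + 1) * \<bar>r\<bar>)"
  proof (rule add_mono)
    have "1 + 5 * real m * H' \<le> (6 + 5 * real m) * H'"
      using real_bounds(5) by (simp add: algebra_simps)
    then have "U'\<^sup>2 * \<bar>q\<bar> * (1 + 5 * real m * H') \<le> U'\<^sup>2 * \<bar>q\<bar> * ((6 + 5 * real m) * H')"
      by (intro mult_left_mono) auto
    also have "\<dots> = (6 + 5 * real m) * 4 ^ m * (h * H' ^ (2 * m + 1) * (h * \<bar>q\<bar>))"
    proof -
      have "(4::real) ^ m = 2 ^ m * 2 ^ m" by (simp flip: power_mult_distrib)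
      moreover have "H' ^ (2 * m + 1) = H' ^ m * H' ^ m * H'" by (simp add: mult_2 power_add)
      ultimately show ?thesis unfolding U'h by (simp only: power2_eq_square) (simp add: algebra_simps)
    qed
    finally show "U'\<^sup>2 * \<bar>q\<bar> * (1 + 5 * real m * H')
      \<le> (6 + 5 * real m) * 4 ^ m * (h * H' ^ (2 * m + 1) * (h * \<bar>q\<bar>))" .
    have "5 * 2 ^ m \<le> (6 + 5 * real m) * 4 ^ m"
      by (intro mult_mono power_mono) auto
    then show "5 * 2 ^ m * (h * H' ^ (2 * m + 1) * \<bar>r\<bar>)
      \<le> (6 + 5 * real m) * 4 ^ m * (h * H' ^ (2 * m + 1) * \<bar>r\<bar>)"
      using h1 real_bounds by (intro mult_right_mono) auto
  qed
  finally show ?thesis by (simp add: q_def r_def h_def H'_def H_def algebra_simps)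
qed

subsection \<open>Minimal polynomials\<close>

lemma int_minpoly_facts:
  assumes "algebraic x"
  shows int_minpoly_content: "content (int_minpoly x) = 1"
    and int_minpoly_nonzero: "int_minpoly x \<noteq> 0"
    and int_minpoly_root: "eval_int_poly (int_minpoly x) x = 0"
    and int_minpoly_degree_le: "\<And>Q. Q \<noteq> 0 \<Longrightarrow> eval_int_poly Q x = 0 \<Longrightarrow> degree (int_minpoly x) \<le> degree Q"
  using is_int_minpoly_int_minpoly[OF assms] by (auto simp: is_int_minpoly_def)

lemma int_minpoly_degree_ge_1:
  assumes "algebraic x"
  shows "1 \<le> degree (int_minpoly x)"
proof (rule ccontr)
  assume "\<not> ?thesis"
  then obtain c where c: "int_minpoly x = [:c:]" by (metis degree_eq_zeroE less_one not_le)
  then have "c \<noteq> 0" using int_minpoly_nonzero[OF assms] by auto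
  then show False using int_minpoly_root[OF assms] c by (simp add: eval_int_poly_pCons)
qed

text \<open>Over the integers primitivity matters besides minimality: the cofactor of a factor
  vanishing at x is constant by minimality of the degree, and its content divides 1.\<close>

lemma irreducible_int_minpoly:
  assumes "algebraic x"
  shows "irreducible (int_minpoly x)"
proof (rule irreducibleI)
  let ?R = "int_minpoly x"
  show "?R \<noteq> 0" using int_minpoly_nonzero[OF assms] .
  show "\<not> is_unit ?R" using int_minpoly_degree_ge_1[OF assms] by (auto simp: is_unit_poly_iff)
  have unit: "is_unit T" if ST: "?R = S * T" and S: "eval_int_poly S x = 0" for S T
  proof -
    have "S \<noteq> 0" "T \<noteq> 0" using ST \<open>?R \<noteq> 0\<close> by auto
    then have "degree ?R = degree S + degree T" using ST by (simp add: degree_mult_eq)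
    moreover have "degree ?R \<le> degree S"
      by (rule int_minpoly_degree_le[OF assms \<open>S \<noteq> 0\<close> S])
    ultimately have "degree T = 0" by simp
    then obtain c where c: "T = [:c:]" by (auto elim: degree_eq_zeroE)
    have "content T dvd 1"
      using content_mult[of S T] ST int_minpoly_content[OF assms] by (metis dvd_triv_right)
    then show ?thesis using c by (simp add: is_unit_poly_iff)
  qed
  fix S T assume ST: "?R = S * T"
  have "eval_int_poly S x * eval_int_poly T x = 0"
    using int_minpoly_root[OF assms] ST by (simp add: eval_int_poly_mult)
  then show "is_unit S \<or> is_unit T"
    using unit[of S T] unit[of T S] ST by (auto simp: mult.commute)
qed

text \<open>Pseudo-division only shows that the minimal polynomial divides an integer multiple k Q.
  Being prime and of positive degree, it cannot divide the constant k, so it divides Q.\<close>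

lemma int_minpoly_dvd:
  assumes "algebraic x" "eval_int_poly Q x = 0"
  shows "int_minpoly x dvd Q"
proof -
  let ?R = "int_minpoly x"
  have R0: "?R \<noteq> 0" using int_minpoly_nonzero[OF assms(1)] .
  obtain q r where qr: "pseudo_divmod Q ?R = (q, r)" by fastforce
  define k where "k = lead_coeff ?R ^ (Suc (degree Q) - degree ?R)"
  have e: "smult k Q = ?R * q + r" and r: "r = 0 \<or> degree r < degree ?R"
    using pseudo_divmod[OF R0 qr] by (auto simp: k_def)
  have k0: "k \<noteq> 0" using R0 by (simp add: k_def)
  have "eval_int_poly r x = eval_int_poly (smult k Q) x - eval_int_poly (?R * q) x"
    unfolding e by (simp add: eval_int_poly_add)
  then have "eval_int_poly r x = 0"
    using assms int_minpoly_root[OF assms(1)] by (simp add: eval_int_poly_mult eval_int_poly_smult)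
  then have "r = 0" using r int_minpoly_degree_le[OF assms(1), of r] by fastforce
  then have "[:k:] * Q = ?R * q" using e by simp
  then have "?R dvd [:k:] * Q" by simp
  moreover have "prime_elem ?R"
    by (rule irreducible_imp_prime_poly[OF irreducible_int_minpoly[OF assms(1)]])
  ultimately have "?R dvd [:k:] \<or> ?R dvd Q" using prime_elem_dvd_multD by blast
  moreover have "\<not> ?R dvd [:k:]"
  proof
    assume d: "?R dvd [:k:]"
    have "[:k:] \<noteq> 0" using k0 by simp
    from dvd_imp_degree_le[OF d this] show False using int_minpoly_degree_ge_1[OF assms(1)] by simp
  qed
  ultimately show ?thesis by blast
qed

section \<open>Exponents from a sequence of good quadratic polynomials\<close>

text \<open>Allows the lower bounds for the exponents to be proved without showing that the
  approximations attached to different blocks are distinct: it is enough that they become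
  arbitrarily good.\<close>

lemma infinite_if_arbitrarily_small:
  fixes f :: "'a \<Rightarrow> real"
  assumes "\<And>e. e > 0 \<Longrightarrow> \<exists>x\<in>S. 0 < f x \<and> f x < e"
  shows "infinite S"
proof
  assume fin: "finite S"
  define T where "T = {f x | x. x \<in> S \<and> 0 < f x}"
  have finT: "finite T" unfolding T_def using fin by simp
  obtain x where "x \<in> S" "0 < f x" using assms[of 1] by auto
  then have T0: "T \<noteq> {}" unfolding T_def by blast
  have "Min T \<in> T" using finT T0 by (rule Min_in)
  then have "Min T > 0" by (auto simp: T_def)
  then obtain y where y: "y \<in> S" "0 < f y" "f y < Min T" using assms by blast
  then have "f y \<in> T" unfolding T_def by blast
  then have "Min T \<le> f y" using finT by simp
  with y show False by simp
qed

text \<open>Restricting the lower bound to positive v is harmless because a is positive, and it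
  fixes the sign of v where logarithmic inequalities are multiplied by it.\<close>

lemma Sup_ereal_eqI:
  assumes upper: "\<And>v. a < v \<Longrightarrow> \<not> Q v" and lower: "\<And>v. 0 < v \<Longrightarrow> v < a \<Longrightarrow> Q v" and "0 < a"
  shows "Sup {ereal v | v :: real. Q v} = ereal a"
proof (rule antisym)
  show "Sup {ereal v | v. Q v} \<le> ereal a"
    using upper by (intro Sup_least) (auto simp: not_less[symmetric])
  show "ereal a \<le> Sup {ereal v | v. Q v}"
  proof (rule ccontr)
    assume "\<not> ?thesis"
    then have "max 0 (Sup {ereal v | v. Q v}) < ereal a" using \<open>0 < a\<close> by (auto simp: not_le)
    then obtain z where z: "max 0 (Sup {ereal v | v. Q v}) < ereal z" "ereal z < ereal a"
      using ereal_dense2 by blast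
    then have "Q z" by (intro lower) auto
    then have "ereal z \<le> Sup {ereal v | v. Q v}" by (intro Sup_upper) auto
    with z show False by auto
  qed
qed

lemma le_powr_iff_ln_le:
  assumes "0 < y" "0 < x"
  shows "y \<le> x powr e \<longleftrightarrow> ln y \<le> e * ln (x :: real)"
  using assms by (metis ln_le_cancel_iff ln_powr powr_gt_zero less_irrefl)

lemma powr_le_iff_le_ln:
  assumes "0 < y" "0 < x"
  shows "x powr e \<le> y \<longleftrightarrow> e * ln (x :: real) \<le> ln y"
  using assms by (metis ln_le_cancel_iff ln_powr powr_gt_zero less_irrefl)

text \<open>Here f and D are value and derivative at x, so y = x + z with A z^2 + D z + f = 0. The
  rationalised formula z = -2 f/E is used, with the sign in E = D \<plusminus> sqrt \<Delta> chosen
  so that nothing cancels and |E| \<ge> |D|.\<close>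

lemma quadratic_root_near:
  fixes A B C x :: real
  defines "f \<equiv> C + B * x + A * x\<^sup>2" and "D \<equiv> 2 * A * x + B"
  assumes D0: "D \<noteq> 0" and disc: "4 * \<bar>A\<bar> * \<bar>f\<bar> \<le> D\<^sup>2"
  shows "\<exists>y. C + B * y + A * y\<^sup>2 = 0 \<and> \<bar>x - y\<bar> \<le> 2 * \<bar>f\<bar> / \<bar>D\<bar>"
proof -
  define \<Delta> where "\<Delta> = D\<^sup>2 - 4 * A * f"
  have "4 * A * f \<le> 4 * \<bar>A\<bar> * \<bar>f\<bar>"
    using abs_ge_self[of "A * f"] by (simp add: abs_mult)
  then have "\<Delta> \<ge> 0" using disc by (simp add: \<Delta>_def)
  define E where "E = D + sgn D * sqrt \<Delta>"
  have "sqrt \<Delta> \<ge> 0" using \<open>\<Delta> \<ge> 0\<close> by simp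
  then have ED: "\<bar>E\<bar> \<ge> \<bar>D\<bar>"
    unfolding E_def sgn_if using D0 by (cases "D > 0") (simp_all del: real_sqrt_ge_0_iff)
  then have E0: "E \<noteq> 0" using D0 by auto
  have "(E - D)\<^sup>2 = \<Delta>"
    using D0 \<open>\<Delta> \<ge> 0\<close> by (auto simp: E_def power_mult_distrib sgn_if)
  then have EE: "E\<^sup>2 - 2 * D * E = - 4 * A * f"
    by (simp add: \<Delta>_def power2_eq_square algebra_simps)
  define z where "z = - 2 * f / E"
  have "E\<^sup>2 * (A * z\<^sup>2 + D * z + f) = f * (4 * A * f + (E\<^sup>2 - 2 * D * E))"
    using E0 by (simp add: z_def field_simps power2_eq_square)
  then have "A * z\<^sup>2 + D * z + f = 0" using EE E0 by simp
  then have "C + B * (x + z) + A * (x + z)\<^sup>2 = 0"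
    unfolding f_def D_def by (simp add: power2_eq_square algebra_simps)
  moreover have "\<bar>x - (x + z)\<bar> \<le> 2 * \<bar>f\<bar> / \<bar>D\<bar>"
  proof -
    have "\<bar>x - (x + z)\<bar> = 2 * \<bar>f\<bar> / \<bar>E\<bar>" by (simp add: z_def abs_mult)
    also have "\<dots> \<le> 2 * \<bar>f\<bar> / \<bar>D\<bar>" using ED D0 by (intro divide_left_mono) auto
    finally show ?thesis .
  qed
  ultimately show ?thesis by blast
qed

text \<open>\<open>X i\<close> is \<open>w\<^sup>i\<close> up to a constant factor; heights, values and derivatives of the quadratic
  polynomials \<open>P i\<close> are measured on the logarithmic scale \<open>X\<close>.\<close>

locale quadratic_sequence =
  fixes \<xi> w \<eta> G \<kappa> :: real and d :: nat and P :: "nat \<Rightarrow> int poly" and X :: "nat \<Rightarrow> real"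
  assumes abs_xi: "\<bar>\<xi>\<bar> \<le> 1"
    and d: "2 \<le> d"
    and w: "121 * (real d)\<^sup>2 \<le> w"
    and eta: "0 < \<eta>" "\<eta> < sqrt w / real d"
    and X_0: "0 < X 0" and X_Suc: "\<And>i. X (Suc i) = w * X i"
    and degree_P: "\<And>i. degree (P i) = 2"
    and content_P: "\<And>i. of_int (content (P i)) \<le> G"
    and value_nonzero: "\<And>i. eval_int_poly (P i) \<xi> \<noteq> 0"
    and deriv_nonzero: "\<And>i. 2 * of_int (coeff (P i) 2) * \<xi> + of_int (coeff (P i) 1) \<noteq> 0"
    and lim_height: "(\<lambda>i. ln (of_int (poly_height (P i))) / X i) \<longlonglongrightarrow> 2 + \<eta>"
    and lim_value: "(\<lambda>i. ln \<bar>eval_int_poly (P i) \<xi>\<bar> / X i) \<longlonglongrightarrow> - (2 * w - \<eta>)"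
    and lim_deriv:
      "(\<lambda>i. ln \<bar>2 * of_int (coeff (P i) 2) * \<xi> + of_int (coeff (P i) 1)\<bar> / X i) \<longlonglongrightarrow> \<eta>"
    and kappa: "0 < \<kappa>"
    and badly_approximable: "\<And>p q :: int. q \<noteq> 0 \<Longrightarrow> \<kappa> \<le> \<bar>of_int q\<bar> * \<bar>of_int q * \<xi> - of_int p\<bar>"
begin

abbreviation ht :: "int poly \<Rightarrow> real" where "ht R \<equiv> of_int (poly_height R)"

abbreviation dP :: "nat \<Rightarrow> real" where
  "dP i \<equiv> 2 * of_int (coeff (P i) 2) * \<xi> + of_int (coeff (P i) 1)"

definition W :: real where "W = (2 * w - \<eta>) / (2 + \<eta>)"
definition W' :: real where "W' = (2 * w - 2 - \<eta>) / (2 + \<eta>)"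

section \<open>Numerical consequences of the conditions on w and \<eta>\<close>

lemma sqrt_w: "11 * real d \<le> sqrt w" "22 \<le> sqrt w" "\<eta> * real d < sqrt w" "\<eta> < sqrt w / 2"
proof -
  have "(11 * real d)\<^sup>2 \<le> w" using w by (simp add: power_mult_distrib)
  then show 1: "11 * real d \<le> sqrt w" by (rule real_le_rsqrt)
  show "22 \<le> sqrt w" using 1 d by simp
  show 2: "\<eta> * real d < sqrt w" using eta d by (simp add: field_simps)
  have "\<eta> * 2 \<le> \<eta> * real d" using eta d by (intro mult_left_mono) auto
  then show "\<eta> < sqrt w / 2" using 2 by simp
qed

lemma sqrt_w_square: "sqrt w * sqrt w = w" and w_ge: "484 \<le> w"
proof -
  have "0 \<le> w" using w by (meson mult_nonneg_nonneg order_trans zero_le_numeral zero_le_power2)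
  then show *: "sqrt w * sqrt w = w" by simp
  show "484 \<le> w" using mult_mono[of 22 "sqrt w" 22 "sqrt w"] sqrt_w(2) * by simp
qed

text \<open>The first inequality makes the elimination bound better than \<open>W'\<close>, the
  second makes the term with the value of \<open>P i\<close> negligible. The dominant contribution
  is (8/3) \<eta> (\<eta> d) \<le> (4/3) w, from \<eta> < sqrt w / 2 and \<eta> d < sqrt w; what is
  linear in d, \<eta> d and \<eta> is absorbed by sqrt w \<ge> 11 d and w \<ge> 22 sqrt w.\<close>

lemma numeric_gap:
  "4 / 3 * ((2 * real d - 1) * (2 + \<eta>)\<^sup>2) + 4 + 2 * \<eta> < 2 * w"
  "3 * w / 2 + (2 * real d - 1) * (2 + \<eta>) < 2 * w - \<eta>"
proof -
  define s where "s = sqrt w"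
  define x where "x = \<eta> * real d"
  have s: "11 * real d \<le> s" "22 \<le> s" "x < s" "\<eta> < s / 2" "s * s = w"
    using sqrt_w sqrt_w_square by (auto simp: s_def x_def)
  have x2: "\<eta> * x \<le> s / 2 * s" using s eta by (intro mult_mono) (auto simp: x_def)
  have s22: "22 * s \<le> s * s" using s by (intro mult_right_mono) auto
  have eta2: "0 \<le> \<eta> * \<eta>" by simp
  have "(2 * real d - 1) * (2 + \<eta>)\<^sup>2 = 8 * real d - 4 + 8 * x - 4 * \<eta> + 2 * (\<eta> * x) - \<eta> * \<eta>"
    by (simp add: x_def power2_eq_square algebra_simps)
  then show "4 / 3 * ((2 * real d - 1) * (2 + \<eta>)\<^sup>2) + 4 + 2 * \<eta> < 2 * w"
    using s x2 s22 eta eta2 by linarith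
  have "(2 * real d - 1) * (2 + \<eta>) = 4 * real d - 2 + 2 * x - \<eta>"
    by (simp add: x_def algebra_simps)
  then show "3 * w / 2 + (2 * real d - 1) * (2 + \<eta>) < 2 * w - \<eta>"
    using s s22 eta by linarith
qed

lemma W'_gt: "1 + 4 / 3 * ((2 * real d - 1) * (2 + \<eta>)) < W'"
proof -
  have "(1 + 4 / 3 * ((2 * real d - 1) * (2 + \<eta>))) * (2 + \<eta>) < 2 * w - 2 - \<eta>"
    using numeric_gap(1) by (simp add: field_simps power2_eq_square)
  then show ?thesis using eta by (simp add: W'_def pos_less_divide_eq)
qed

lemma W'_eq: "W' + 1 = 2 * w / (2 + \<eta>)"
  and W_bounds: "1 < W'" "W' < W"
proof -
  have 1: "W = W' + 2 / (2 + \<eta>)" by (simp add: W_def W'_def add_divide_distrib[symmetric])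
  show "W' + 1 = 2 * w / (2 + \<eta>)" using eta by (simp add: W'_def field_simps)
  have "0 \<le> (2 * real d - 1) * (2 + \<eta>)" using d eta by (intro mult_nonneg_nonneg) auto
  then show "1 < W'" using W'_gt by simp
  show "W' < W" using 1 eta by simp
qed

section \<open>The logarithmic scale\<close>

lemma X_pos: "0 < X i"
  using w_ge by (induction i) (auto simp: X_0 X_Suc)

lemma X_mono: "i \<le> j \<Longrightarrow> X i \<le> X j"
proof (rule lift_Suc_mono_le)
  fix n
  have "1 * X n \<le> w * X n" using w_ge X_pos[of n] by (intro mult_right_mono) auto
  then show "X n \<le> X (Suc n)" by (simp add: X_Suc)
qed

lemma X_unbounded: "\<exists>i0. \<forall>i\<ge>i0. c \<le> X i"
proof -
  have X: "X i = X 0 * w ^ i" for i by (induction i) (simp_all add: X_Suc)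
  obtain i where "c / X 0 < w ^ i" using real_arch_pow[of w "c / X 0"] w_ge by auto
  then have "c \<le> X i" using X_0 by (subst X) (simp add: field_simps)
  then show ?thesis using X_mono order_trans by blast
qed

lemma eventually_near_limit:
  assumes "(\<lambda>i. f i / X i) \<longlonglongrightarrow> l" "0 < e"
  shows "eventually (\<lambda>i. \<bar>f i - l * X i\<bar> \<le> e * X i) sequentially"
proof -
  have "eventually (\<lambda>i. \<bar>f i / X i - l\<bar> < e) sequentially"
    using assms by (auto simp: tendsto_iff dist_real_def)
  then show ?thesis
  proof eventually_elim
    case (elim i)
    then have "\<bar>f i / X i - l\<bar> * X i \<le> e * X i" using X_pos[of i] by (intro mult_right_mono) auto
    also have "\<bar>f i / X i - l\<bar> * X i = \<bar>f i - l * X i\<bar>"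
    proof -
      have "\<bar>f i / X i - l\<bar> * X i = \<bar>(f i / X i - l) * X i\<bar>" using X_pos[of i] by (simp add: abs_mult)
      then show ?thesis using X_pos[of i] by (simp add: algebra_simps)
    qed
    finally show ?case .
  qed
qed

text \<open>Later estimates choose e below the available slack and put every multiplicative constant
  into c, so that all errors become multiples of \<open>e * X i\<close>.\<close>

lemma eventually_bounds:
  assumes "0 < e"
  shows "\<exists>i0. \<forall>i\<ge>i0. c \<le> e * X i \<and> \<bar>ln (ht (P i)) - (2 + \<eta>) * X i\<bar> \<le> e * X i \<and>
    \<bar>ln \<bar>eval_int_poly (P i) \<xi>\<bar> + (2 * w - \<eta>) * X i\<bar> \<le> e * X i \<and> \<bar>ln \<bar>dP i\<bar> - \<eta> * X i\<bar> \<le> e * X i"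
proof -
  have "eventually (\<lambda>i. c / e \<le> X i) sequentially"
    using X_unbounded by (simp add: eventually_sequentially)
  then have "eventually (\<lambda>i. c \<le> e * X i \<and> \<bar>ln (ht (P i)) - (2 + \<eta>) * X i\<bar> \<le> e * X i \<and>
    \<bar>ln \<bar>eval_int_poly (P i) \<xi>\<bar> - (- (2 * w - \<eta>)) * X i\<bar> \<le> e * X i \<and> \<bar>ln \<bar>dP i\<bar> - \<eta> * X i\<bar> \<le> e * X i) sequentially"
    using eventually_near_limit[OF lim_height assms] eventually_near_limit[OF lim_value assms]
      eventually_near_limit[OF lim_deriv assms]
    by eventually_elim (use assms in \<open>auto simp: field_simps\<close>)
  moreover have eq: "x - - (2 * w - \<eta>) * X i = x + (2 * w - \<eta>) * X i" for x i
    by (simp add: algebra_simps)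
  ultimately show ?thesis unfolding eventually_sequentially eq by blast
qed

section \<open>Lower bounds for the values of integer polynomials at \<xi>\<close>

lemma P_nonzero: "P i \<noteq> 0"
  using degree_P[of i] by auto

lemma eval_P: "eval_int_poly (P i) x
    = of_int (coeff (P i) 0) + of_int (coeff (P i) 1) * x + of_int (coeff (P i) 2) * x\<^sup>2"
  by (rule eval_int_poly_quadratic) (simp add: degree_P)

lemma ht_ge_1: "R \<noteq> 0 \<Longrightarrow> 1 \<le> ht R"
  using poly_height_ge_1[of R] by simp

text \<open>R is eliminated against a single well chosen \<open>P i\<close>. The exponent obtained
  is \<open>W'\<close> and not merely \<open>W\<close>, so that polynomials dividing no
  \<open>P i\<close> are harmless for both exponents.\<close>

lemma non_dividing_lower_bound:
  "\<exists>T. \<forall>R. irreducible R \<and> 2 \<le> degree R \<and> degree R \<le> d \<and> (\<forall>i. \<not> R dvd P i) \<and> T < ht R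
     \<longrightarrow> ht R powr (- W') \<le> \<bar>eval_int_poly R \<xi>\<bar>"
proof -
  define m where "m = d - 1"
  have dm: "d = Suc m" using d by (simp add: m_def)
  define n where "n = 2 * real d - 1"
  have n: "real (2 * m + 1) = n" and n0: "n > 0" using d by (simp_all add: n_def dm)
  define K where "K = (6 + 5 * real m) * 4 ^ m"
  have K0: "K > 0" by (simp add: K_def)
  \<comment> \<open>The common slack of the two inequalities in \<open>numeric_gap\<close>; e below
    satisfies 4 (n + 1) e = g, which covers all errors in \<open>gap1\<close> and
    \<open>gap2\<close>.\<close>
  define g where "g = min (W' - (1 + 4 / 3 * (n * (2 + \<eta>)))) (2 * w - \<eta> - (3 * w / 2 + n * (2 + \<eta>)))"
  have g0: "g > 0" using W'_gt numeric_gap(2) by (simp add: g_def n_def)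
  define e where "e = g / (4 * (n + 1))"
  have e0: "e > 0" using g0 n0 by (simp add: e_def)
  have "g = 4 * (n + 1) * e" using n0 by (simp add: e_def field_simps)
  then have ge: "4 * (n * e) + 4 * e = g" by (simp add: algebra_simps)
  have ne0: "n * e > 0" using n0 e0 by simp
  have gap1: "1 + 4 / 3 * (n * (2 + \<eta> + e) + e) \<le> W'"
  proof -
    have "g \<le> W' - (1 + 4 / 3 * (n * (2 + \<eta>)))" by (simp add: g_def)
    then show ?thesis using ge e0 ne0 by (simp add: algebra_simps)
  qed
  have gap2: "3 * w / 2 + n * (2 + \<eta> + e) + 2 * e \<le> 2 * w - \<eta>"
  proof -
    have "g \<le> 2 * w - \<eta> - (3 * w / 2 + n * (2 + \<eta>))" by (simp add: g_def)
    then show ?thesis using ge e0 ne0 by (simp add: algebra_simps)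
  qed
  obtain i0 where i0: "\<And>i. i \<ge> i0 \<Longrightarrow> ln (2 * K) \<le> e * X i \<and> \<bar>ln (ht (P i)) - (2 + \<eta>) * X i\<bar> \<le> e * X i
      \<and> \<bar>ln \<bar>eval_int_poly (P i) \<xi>\<bar> + (2 * w - \<eta>) * X i\<bar> \<le> e * X i"
    using eventually_bounds[OF e0, of "ln (2 * K)"] by blast
  \<comment> \<open>A height above T forces the index chosen below to exceed i0, so it has a
    predecessor and the asymptotic bounds apply.\<close>
  define T where "T = exp (3 * w / 4 * X i0)"
  have "ht R powr (- W') \<le> \<bar>eval_int_poly R \<xi>\<bar>"
    if R: "irreducible R" "2 \<le> degree R" "degree R \<le> d" and nd: "\<And>i. \<not> R dvd P i" and big: "T < ht R"
    for R
  proof -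
    have R0: "R \<noteq> 0" using R by auto
    define h where "h = ln (ht R)"
    have h1: "ht R \<ge> 1" by (rule ht_ge_1[OF R0])
    have h0: "h \<ge> 0" using h1 by (simp add: h_def)
    have "ln T < ln (ht R)" using big h1 by (subst ln_less_cancel_iff) (auto simp: T_def)
    then have hbig: "3 * w / 4 * X i0 < h" by (simp add: T_def h_def)
    obtain j where "h \<le> 3 * w / 4 * X j"
    proof -
      obtain j where "h \<le> X j" using X_unbounded by blast
      moreover have "1 * X j \<le> 3 * w / 4 * X j"
        using w_ge X_pos[of j] by (intro mult_right_mono) auto
      ultimately show ?thesis using that[of j] by simp
    qed
    \<comment> \<open>Membership bounds h from above and makes the term with \<open>P i\<close> at
      most 1/2. Minimality fails at the predecessor, and \<open>X_Suc\<close> turns this into X i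
      \<le> 4/3 h, which bounds the height of \<open>P i\<close> by a power of that of R.\<close>
    define i where "i = (LEAST j. h \<le> 3 * w / 4 * X j)"
    have hi: "h \<le> 3 * w / 4 * X i" unfolding i_def by (rule LeastI) fact
    have "i0 < i"
    proof (rule ccontr)
      assume "\<not> i0 < i"
      then have "3 * w / 4 * X i \<le> 3 * w / 4 * X i0"
        using w_ge X_mono[of i i0] by (intro mult_left_mono) auto
      then show False using hi hbig by simp
    qed
    then obtain j where j: "i = Suc j" "i0 \<le> j" by (metis less_imp_Suc_add le_add1)
    have "\<not> h \<le> 3 * w / 4 * X j"
      using not_less_Least[of j "\<lambda>j. h \<le> 3 * w / 4 * X j"] j unfolding i_def by simp
    then have Xh: "X i \<le> 4 / 3 * h" by (simp add: j X_Suc)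
    define hP v where "hP = ln (ht (P i))" and "v = \<bar>eval_int_poly (P i) \<xi>\<bar>"
    have hP1: "ht (P i) \<ge> 1" by (rule ht_ge_1[OF P_nonzero])
    have v0: "v > 0" using value_nonzero by (simp add: v_def)
    have b: "ln (2 * K) \<le> e * X i" "hP \<le> (2 + \<eta> + e) * X i" "ln v \<le> - (2 * w - \<eta> - e) * X i"
      using i0[of i] \<open>i0 < i\<close> by (auto simp: hP_def v_def abs_le_iff algebra_simps)
    have nhP: "n * hP \<le> n * (2 + \<eta> + e) * X i" using b(2) n0 by simp
    define r where "r = \<bar>eval_int_poly R \<xi>\<bar>"
    define Z where "Z = K * ht R * ht (P i) ^ (2 * m + 1)"
    have Z0: "Z > 0" using K0 h1 hP1 by (simp add: Z_def)
    have lnZ: "ln Z = ln K + h + n * hP"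
      unfolding Z_def h_def hP_def using K0 h1 hP1
      by (simp add: ln_mult ln_realpow algebra_simps flip: n)
    have main: "1 \<le> Z * (ht R * v) + Z * r"
      using elimination_inequality[OF R(1,2) _ degree_P nd abs_xi, of m] R(3)
      unfolding Z_def K_def r_def v_def dm by (simp add: algebra_simps)
    have ln2K: "ln (2 * K) = ln 2 + ln K" using K0 by (simp add: ln_mult)
    have "Z * (ht R * v) \<le> 1 / 2"
    proof -
      have "ln (Z * (ht R * v)) = ln K + 2 * h + n * hP + ln v"
        using Z0 h1 v0 by (simp add: ln_mult lnZ h_def)
      also have "\<dots> \<le> ln K + (3 * w / 2 + n * (2 + \<eta> + e) - (2 * w - \<eta> - e)) * X i"
        using hi nhP b by (simp add: algebra_simps)
      also have "\<dots> \<le> ln K + (- e) * X i"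
        using gap2 X_pos[of i] by (intro add_left_mono mult_right_mono) auto
      also have "\<dots> \<le> - ln 2" using b(1) ln2K by simp
      also have "- ln 2 = ln (1 / 2 :: real)" by (simp add: ln_div)
      finally show ?thesis using Z0 h1 v0 by (subst (asm) ln_le_cancel_iff) auto
    qed
    then have "1 / 2 \<le> Z * r" using main by linarith
    then have r_ge: "1 / (2 * Z) \<le> r" using Z0 by (simp add: field_simps)
    moreover have "0 < 1 / (2 * Z)" using Z0 by simp
    ultimately have r0: "r > 0" by linarith
    have "ln (1 / (2 * Z)) \<le> ln r" using r_ge r0 Z0 by (subst ln_le_cancel_iff) auto
    then have "- ln 2 - ln Z \<le> ln r" using Z0 by (simp add: ln_div ln_mult)
    then have "- (ln (2 * K) + h + n * hP) \<le> ln r" using lnZ ln2K by simp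
    moreover have "ln (2 * K) + h + n * hP \<le> W' * h"
    proof -
      have "ln (2 * K) + h + n * hP \<le> h + (n * (2 + \<eta> + e) + e) * X i"
        using b(1) nhP by (simp add: algebra_simps)
      also have "\<dots> \<le> h + (n * (2 + \<eta> + e) + e) * (4 / 3 * h)"
        using Xh n0 eta e0 by (intro add_left_mono mult_left_mono) auto
      also have "\<dots> = (1 + 4 / 3 * (n * (2 + \<eta> + e) + e)) * h" by (simp add: algebra_simps)
      also have "\<dots> \<le> W' * h" using gap1 h0 by (intro mult_right_mono) auto
      finally show ?thesis .
    qed
    ultimately have "- W' * h \<le> ln r" by linarith
    then show ?thesis using r0 h1 by (simp add: powr_le_iff_le_ln r_def h_def)
  qed
  then show ?thesis by blast
qed

text \<open>Takes the place of irreducibility of \<open>P i\<close>: a factor of degree at least 2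
  has a constant cofactor g, and |g| is at most the content of \<open>P i\<close>.\<close>

lemma dividing_factor:
  assumes "irreducible R" "2 \<le> degree R" "R dvd P i"
  obtains g where "P i = smult g R" "g \<noteq> 0" "\<bar>of_int g\<bar> \<le> G" "ht (P i) = \<bar>of_int g\<bar> * ht R"
proof -
  obtain S where S: "P i = R * S" using assms(3) by (elim dvdE)
  have "R \<noteq> 0" "S \<noteq> 0" using S P_nonzero[of i] by auto
  then have "degree R + degree S = 2" using S degree_P[of i] by (simp add: degree_mult_eq)
  then have "degree S = 0" using assms(2) by simp
  then obtain g where "S = [:g:]" by (elim degree_eq_zeroE)
  then have g: "P i = smult g R" using S by (simp add: mult.commute)
  have g0: "g \<noteq> 0" using g P_nonzero[of i] by auto
  have "content (P i) = \<bar>g\<bar> * content R" using g by simp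
  moreover have "content R > 0"
    using \<open>R \<noteq> 0\<close> normalize_content[of R] content_eq_zero_iff[of R]
    by (metis abs_ge_zero normalize_int_def order_le_less)
  ultimately have "\<bar>g\<bar> \<le> content (P i)"
    using mult_left_mono[of 1 "content R" "\<bar>g\<bar>"] by simp
  then have "\<bar>of_int g\<bar> \<le> G" using content_P[of i] by linarith
  moreover have "ht (P i) = \<bar>of_int g\<bar> * ht R" by (simp add: g poly_height_smult)
  ultimately show ?thesis using that g g0 by blast
qed

text \<open>Up to the bounded factor g, R is \<open>P i\<close>, so value and height are known. For
  a root y the identity P i(\<xi>) = (\<xi> - y) (P i'(\<xi>) - A (\<xi> - y)), with A the leading
  coefficient, converts the value into the distance.\<close>

lemma dividing_lower_bound:
  assumes "W < V" "W' + 1 < V'"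
  shows "\<exists>T. \<forall>R i. irreducible R \<and> 2 \<le> degree R \<and> R dvd P i \<and> T < ht R
     \<longrightarrow> ht R powr (- V) \<le> \<bar>eval_int_poly R \<xi>\<bar> \<and>
       (\<forall>y. eval_int_poly R y = 0 \<longrightarrow> ht R powr (- V') \<le> \<bar>\<xi> - y\<bar>)"
proof -
  have V0: "V > 0" "V' > 0" using assms W_bounds by auto
  define g where "g = min (V * (2 + \<eta>) - (2 * w - \<eta>)) (V' * (2 + \<eta>) - 2 * w)"
  have g0: "g > 0"
  proof -
    have "2 * w - \<eta> < V * (2 + \<eta>)" using assms(1) eta by (simp add: W_def pos_divide_less_eq)
    moreover have "2 * w < V' * (2 + \<eta>)"
      using assms(2) eta unfolding W'_eq by (simp add: pos_divide_less_eq)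
    ultimately show ?thesis by (simp add: g_def)
  qed
  define e where "e = g / (4 + 2 * V + 2 * V')"
  have e0: "e > 0" using g0 V0 by (simp add: e_def)
  have "e * (4 + 2 * V + 2 * V') \<le> g"
  proof -
    have "e * (4 + 2 * V + 2 * V') = g" using V0 by (simp add: e_def)
    then show ?thesis by simp
  qed
  moreover have "e * V > 0" "e * V' > 0" using e0 V0 by auto
  ultimately have gap: "2 * w - \<eta> + 2 * e \<le> V * (2 + \<eta> - 2 * e)" "2 * w + 3 * e \<le> V' * (2 + \<eta> - 2 * e)"
    using e0 by (auto simp: g_def algebra_simps)
  define c where "c = max (ln 2) (ln (max 1 G))"
  obtain i0 where i0: "\<And>i. i \<ge> i0 \<Longrightarrow> c \<le> e * X i \<and> \<bar>ln (ht (P i)) - (2 + \<eta>) * X i\<bar> \<le> e * X i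
      \<and> \<bar>ln \<bar>eval_int_poly (P i) \<xi>\<bar> + (2 * w - \<eta>) * X i\<bar> \<le> e * X i \<and> \<bar>ln \<bar>dP i\<bar> - \<eta> * X i\<bar> \<le> e * X i"
    using eventually_bounds[OF e0, of c] by blast
  \<comment> \<open>The sum dominates each of the first i0 heights, so a factor of larger height can
    only divide a \<open>P i\<close> with i \<ge> i0.\<close>
  define T where "T = (\<Sum>i<i0. ht (P i))"
  have "ht R powr (- V) \<le> \<bar>eval_int_poly R \<xi>\<bar> \<and>
       (\<forall>y. eval_int_poly R y = 0 \<longrightarrow> ht R powr (- V') \<le> \<bar>\<xi> - y\<bar>)"
    if R: "irreducible R" "2 \<le> degree R" "R dvd P i" "T < ht R" for R i
  proof -
    obtain g where g: "P i = smult g R" "g \<noteq> 0" "\<bar>of_int g\<bar> \<le> G" "ht (P i) = \<bar>of_int g\<bar> * ht R"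
      using dividing_factor[OF R(1-3)] .
    have g1: "1 \<le> \<bar>real_of_int g\<bar>" using g(2) by (simp flip: of_int_abs)
    have R0: "R \<noteq> 0" using R by auto
    have h1: "ht R \<ge> 1" by (rule ht_ge_1[OF R0])
    have hP1: "ht (P i) \<ge> 1" by (rule ht_ge_1[OF P_nonzero])
    have "i0 \<le> i"
    proof (rule ccontr)
      assume "\<not> i0 \<le> i"
      then have "ht (P i) \<le> T" unfolding T_def
        by (intro member_le_sum) (auto simp: poly_height_nonneg)
      moreover have "ht R \<le> ht (P i)" using g(4) mult_right_mono[OF g1, of "ht R"] h1 by simp
      ultimately show False using R(4) by simp
    qed
    define h f D x where "h = ln (ht R)" and "f = \<bar>eval_int_poly (P i) \<xi>\<bar>" and "D = \<bar>dP i\<bar>" and "x = X i"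
    have x0: "x > 0" by (simp add: x_def X_pos)
    have f0: "f > 0" and D0: "D > 0" using value_nonzero deriv_nonzero by (auto simp: f_def D_def)
    define A where "A = real_of_int (coeff (P i) 2)"
    have "coeff (P i) 2 \<noteq> 0" using P_nonzero[of i] degree_P[of i] by (metis leading_coeff_0_iff)
    then have A0: "A \<noteq> 0" by (simp add: A_def)
    have "\<bar>coeff (P i) 2\<bar> \<le> poly_height (P i)" by (rule abs_coeff_le_poly_height)
    then have Ah: "\<bar>A\<bar> \<le> ht (P i)" unfolding A_def by (simp flip: of_int_abs)
    have c: "ln 2 \<le> c" "ln \<bar>real_of_int g\<bar> \<le> c"
    proof -
      have "ln \<bar>real_of_int g\<bar> \<le> ln (max 1 G)" using g1 g(3) by (subst ln_le_cancel_iff) auto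
      then show "ln \<bar>real_of_int g\<bar> \<le> c" by (simp add: c_def)
    qed (simp add: c_def)
    have lnP: "ln (ht (P i)) = ln \<bar>real_of_int g\<bar> + h"
      using g1 h1 unfolding g(4) h_def by (subst ln_mult) auto
    have b: "c \<le> e * x" "(2 + \<eta> - e) * x \<le> ln (ht (P i))" "ln (ht (P i)) \<le> (2 + \<eta> + e) * x"
      "- (2 * w - \<eta> + e) * x \<le> ln f" "ln D \<le> (\<eta> + e) * x"
      using i0[OF \<open>i0 \<le> i\<close>] by (auto simp: x_def f_def D_def abs_le_iff algebra_simps)
    have hx: "(2 + \<eta> - 2 * e) * x \<le> h" using b c lnP by (simp add: algebra_simps)
    have fR: "f = \<bar>of_int g\<bar> * \<bar>eval_int_poly R \<xi>\<bar>"
      unfolding f_def g(1) by (simp add: eval_int_poly_smult abs_mult)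
    have r0: "\<bar>eval_int_poly R \<xi>\<bar> > 0" using fR f0 by (auto simp: zero_less_mult_iff)
    have "ln f = ln \<bar>real_of_int g\<bar> + ln \<bar>eval_int_poly R \<xi>\<bar>"
      unfolding fR using g1 r0 by (subst ln_mult) auto
    then have "- (2 * w - \<eta> + 2 * e) * x \<le> ln \<bar>eval_int_poly R \<xi>\<bar>"
      using b c by (simp add: algebra_simps)
    moreover have "(2 * w - \<eta> + 2 * e) * x \<le> V * h"
    proof -
      have "(2 * w - \<eta> + 2 * e) * x \<le> V * (2 + \<eta> - 2 * e) * x"
        using gap x0 by (intro mult_right_mono) auto
      also have "\<dots> \<le> V * h" using hx V0 by (simp add: mult.assoc)
      finally show ?thesis .
    qed
    ultimately have "- V * h \<le> ln \<bar>eval_int_poly R \<xi>\<bar>" by linarith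
    then have part1: "ht R powr (- V) \<le> \<bar>eval_int_poly R \<xi>\<bar>"
      using r0 h1 by (simp add: powr_le_iff_le_ln h_def)
    have part2: "ht R powr (- V') \<le> \<bar>\<xi> - y\<bar>" if y: "eval_int_poly R y = 0" for y
    proof -
      have "eval_int_poly (P i) y = 0" unfolding g(1) using y by (simp add: eval_int_poly_smult)
      then have "eval_int_poly (P i) \<xi> = (\<xi> - y) * (dP i - A * (\<xi> - y))"
        unfolding eval_P A_def by (simp add: algebra_simps power2_eq_square)
      then have fe: "f = \<bar>\<xi> - y\<bar> * \<bar>dP i - A * (\<xi> - y)\<bar>" unfolding f_def by (simp add: abs_mult)
      define z where "z = \<bar>\<xi> - y\<bar>"
      have z0: "z > 0" using fe f0 by (auto simp: z_def)
      have "\<bar>dP i - A * (\<xi> - y)\<bar> \<le> D + \<bar>A\<bar> * z"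
        unfolding D_def z_def abs_mult[symmetric] by linarith
      then have fz: "f \<le> z * (D + \<bar>A\<bar> * z)"
        unfolding fe z_def by (intro mult_left_mono) auto
      \<comment> \<open>If the derivative dominates, the distance is about f/D, giving exponent 2 w.
        Otherwise its square is at least f/(2 |A|), giving only w + 1, which is much less than 2
        w.\<close>
      have "- (2 * w + 3 * e) * x \<le> ln z"
      proof (cases "\<bar>A\<bar> * z \<le> D")
        case True
        then have "f \<le> z * (2 * D)" using fz z0 mult_left_mono[of "D + \<bar>A\<bar> * z" "2 * D" z] by linarith
        then have "ln f \<le> ln (z * (2 * D))" using f0 z0 D0 by (subst ln_le_cancel_iff) auto
        also have "\<dots> = ln z + (ln 2 + ln D)" using z0 D0 by (simp add: ln_mult)
        finally show ?thesis using b c by (simp add: algebra_simps)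
      next
        case False
        then have "f \<le> z * (2 * (\<bar>A\<bar> * z))"
          using fz z0 mult_left_mono[of "D + \<bar>A\<bar> * z" "2 * (\<bar>A\<bar> * z)" z] by linarith
        then have "ln f \<le> ln (z * (2 * (\<bar>A\<bar> * z)))" using f0 z0 A0 by (subst ln_le_cancel_iff) auto
        also have "\<dots> = 2 * ln z + ln 2 + ln \<bar>A\<bar>" using z0 A0 by (simp add: ln_mult)
        also have "ln \<bar>A\<bar> \<le> ln (ht (P i))" using A0 Ah hP1 by (subst ln_le_cancel_iff) auto
        finally have "- (2 * w + 2 + 3 * e) * x \<le> 2 * ln z" using b c by (simp add: algebra_simps)
        moreover have "(2 * w + 2 + 3 * e) * x \<le> 2 * (2 * w + 3 * e) * x"
          using w_ge e0 x0 by (intro mult_right_mono) auto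
        ultimately show ?thesis by (simp add: algebra_simps)
      qed
      moreover have "(2 * w + 3 * e) * x \<le> V' * h"
      proof -
        have "(2 * w + 3 * e) * x \<le> V' * (2 + \<eta> - 2 * e) * x"
          using gap x0 by (intro mult_right_mono) auto
        also have "\<dots> \<le> V' * h" using hx V0 by (simp add: mult.assoc)
        finally show ?thesis .
      qed
      ultimately have "- V' * h \<le> ln z" by linarith
      then show ?thesis using z0 h1 by (simp add: powr_le_iff_le_ln h_def z_def)
    qed
    from part1 part2 show ?thesis by blast
  qed
  then show ?thesis by blast
qed

lemma linear_lower_bound:
  assumes "degree R = 1"
  shows "\<kappa> / ht R \<le> \<bar>eval_int_poly R \<xi>\<bar>"
proof -
  have R: "R = [:coeff R 0, coeff R 1:]"
  proof (rule poly_eqI)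
    fix n
    show "coeff R n = coeff [:coeff R 0, coeff R 1:] n"
      using assms by (cases n; cases "n - 1") (auto simp: coeff_eq_0)
  qed
  have c: "coeff R 1 \<noteq> 0" using assms by (metis degree_0 leading_coeff_0_iff zero_neq_one)
  have e: "eval_int_poly R \<xi> = of_int (coeff R 1) * \<xi> - of_int (- coeff R 0)"
    by (subst R) (simp add: eval_int_poly_pCons)
  have "\<kappa> \<le> \<bar>of_int (coeff R 1)\<bar> * \<bar>eval_int_poly R \<xi>\<bar>"
    unfolding e by (rule badly_approximable[OF c])
  also have "\<dots> \<le> ht R * \<bar>eval_int_poly R \<xi>\<bar>"
    using abs_coeff_le_poly_height[of R 1] by (intro mult_right_mono) (auto simp flip: of_int_abs)
  finally show ?thesis
    using ht_ge_1[of R] assms by (cases "R = 0") (auto simp: field_simps)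
qed

lemma linear_lower_bound_powr:
  assumes "1 < V"
  shows "\<exists>T. \<forall>R. degree R = 1 \<and> T < ht R \<longrightarrow> ht R powr (- V) \<le> \<bar>eval_int_poly R \<xi>\<bar>"
proof -
  define T where "T = (1 / \<kappa>) powr (1 / (V - 1))"
  have "ht R powr (- V) \<le> \<bar>eval_int_poly R \<xi>\<bar>" if R: "degree R = 1" "T < ht R" for R
  proof -
    have "R \<noteq> 0" using R by auto
    then have h1: "ht R \<ge> 1" by (rule ht_ge_1)
    have "T powr (V - 1) \<le> ht R powr (V - 1)"
      using R assms by (intro powr_mono2) (auto simp: T_def)
    then have "1 / \<kappa> \<le> ht R powr (V - 1)" using assms kappa by (simp add: T_def powr_powr)
    also have "\<dots> = ht R powr V / ht R" using h1 by (simp add: powr_diff)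
    finally have "1 / ht R powr V \<le> \<kappa> / ht R" using kappa h1 by (simp add: field_simps)
    then show ?thesis using linear_lower_bound[OF R(1)] by (simp add: powr_minus_divide)
  qed
  then show ?thesis by blast
qed

text \<open>The three kinds of irreducible polynomials are treated for large height; the finitely
  many remaining ones are absorbed by c. The condition c \<le> 1 allows c to be raised to powers
  when factors are multiplied.\<close>

lemma irreducible_lower_bound:
  assumes V: "W < V"
  shows "\<exists>c>0. c \<le> 1 \<and> (\<forall>R. irreducible R \<and> 1 \<le> degree R \<and> degree R \<le> d \<and> eval_int_poly R \<xi> \<noteq> 0
    \<longrightarrow> c * ht R powr (- V) \<le> \<bar>eval_int_poly R \<xi>\<bar>)"
proof -
  obtain T1 where T1: "\<And>R. irreducible R \<Longrightarrow> 2 \<le> degree R \<Longrightarrow> degree R \<le> d \<Longrightarrow> (\<forall>i. \<not> R dvd P i) \<Longrightarrow>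
      T1 < ht R \<Longrightarrow> ht R powr (- W') \<le> \<bar>eval_int_poly R \<xi>\<bar>"
    using non_dividing_lower_bound by blast
  obtain T2 where T2: "\<And>R i. irreducible R \<Longrightarrow> 2 \<le> degree R \<Longrightarrow> R dvd P i \<Longrightarrow>
      T2 < ht R \<Longrightarrow> ht R powr (- V) \<le> \<bar>eval_int_poly R \<xi>\<bar>"
    using dividing_lower_bound[OF V, of "W' + 2"] by auto
  obtain T3 where T3: "\<And>R. degree R = 1 \<Longrightarrow> T3 < ht R \<Longrightarrow> ht R powr (- V) \<le> \<bar>eval_int_poly R \<xi>\<bar>"
    using linear_lower_bound_powr[of V] V W_bounds by auto
  define T where "T = max T1 (max T2 T3)"
  define S where "S = {R. degree R \<le> d \<and> poly_height R \<le> \<lfloor>T\<rfloor>}"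
  have finS: "finite S" unfolding S_def by (rule finite_bounded_height)
  \<comment> \<open>Inserting 1 keeps the set nonempty and ensures c \<le> 1.\<close>
  define c where "c = Min (insert 1 ((\<lambda>R. \<bar>eval_int_poly R \<xi>\<bar>) ` {R \<in> S. eval_int_poly R \<xi> \<noteq> 0}))"
  have fin: "finite (insert 1 ((\<lambda>R. \<bar>eval_int_poly R \<xi>\<bar>) ` {R \<in> S. eval_int_poly R \<xi> \<noteq> 0}))"
    using finS by simp
  have c1: "c \<le> 1" unfolding c_def using fin by (intro Min_le) auto
  have "c \<in> insert 1 ((\<lambda>R. \<bar>eval_int_poly R \<xi>\<bar>) ` {R \<in> S. eval_int_poly R \<xi> \<noteq> 0})"
    unfolding c_def using fin by (intro Min_in) auto
  then have c0: "c > 0" by auto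
  have "c * ht R powr (- V) \<le> \<bar>eval_int_poly R \<xi>\<bar>"
    if R: "irreducible R" "1 \<le> degree R" "degree R \<le> d" "eval_int_poly R \<xi> \<noteq> 0" for R
  proof (cases "T < ht R")
    case True
    have h1: "ht R \<ge> 1" by (rule ht_ge_1) (use R in auto)
    have "ht R powr (- V) \<le> \<bar>eval_int_poly R \<xi>\<bar>"
    proof (cases "degree R = 1")
      case True
      then show ?thesis using T3[of R] \<open>T < ht R\<close> by (simp add: T_def)
    next
      case False
      then have d2: "2 \<le> degree R" using R by simp
      show ?thesis
      proof (cases "\<exists>i. R dvd P i")
        case True
        then show ?thesis using T2[OF R(1) d2] \<open>T < ht R\<close> by (auto simp: T_def)
      next
        case False
        then have "ht R powr (- W') \<le> \<bar>eval_int_poly R \<xi>\<bar>"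
          using T1[OF R(1) d2 R(3)] \<open>T < ht R\<close> by (auto simp: T_def)
        moreover have "ht R powr (- V) \<le> ht R powr (- W')"
          using h1 V W_bounds by (intro powr_mono) auto
        ultimately show ?thesis by linarith
      qed
    qed
    moreover have "c * ht R powr (- V) \<le> 1 * ht R powr (- V)"
      using c1 by (intro mult_right_mono) auto
    ultimately show ?thesis by linarith
  next
    case False
    have h1: "ht R \<ge> 1" by (rule ht_ge_1) (use R in auto)
    have "R \<in> S" using False R by (simp add: S_def le_floor_iff)
    then have "c \<le> \<bar>eval_int_poly R \<xi>\<bar>" unfolding c_def using fin R by (intro Min_le) auto
    moreover have "ht R powr (- V) \<le> 1"
      using h1 V W_bounds powr_mono[of "- V" 0 "ht R"] by simp
    then have "c * ht R powr (- V) \<le> c * 1" using c0 by (intro mult_left_mono) auto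
    ultimately show ?thesis by linarith
  qed
  with c0 c1 show ?thesis by blast
qed

text \<open>Induction over the prime factorisation. Every nonconstant factor costs k = c C^(-V),
  where C is Gelfond's constant, and there are at most d of them. A constant factor costs nothing,
  since it enlarges both the height and the value.\<close>

lemma lower_bound:
  assumes V: "W < V"
  shows "\<exists>c>0. \<forall>R. degree R \<le> d \<and> eval_int_poly R \<xi> \<noteq> 0 \<longrightarrow> c * ht R powr (- V) \<le> \<bar>eval_int_poly R \<xi>\<bar>"
proof -
  obtain c where c: "c > 0" "c \<le> 1" and irr: "\<And>R. irreducible R \<Longrightarrow> 1 \<le> degree R \<Longrightarrow> degree R \<le> d \<Longrightarrow>
      eval_int_poly R \<xi> \<noteq> 0 \<Longrightarrow> c * ht R powr (- V) \<le> \<bar>eval_int_poly R \<xi>\<bar>"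
    using irreducible_lower_bound[OF V] by blast
  obtain C where C: "C \<ge> 1" and gelfond: "\<And>P Q. degree P \<le> d \<Longrightarrow> degree Q \<le> d \<Longrightarrow>
      ht P * ht Q \<le> C * ht (P * Q)"
    using poly_height_mult_ge[of d] by blast
  have V0: "V > 0" using V W_bounds by simp
  define k where "k = c * C powr (- V)"
  have "C powr (- V) \<le> 1" using C V0 powr_mono[of "- V" 0 C] by simp
  then have k: "0 < k" "k \<le> 1" using c C mult_mono[of c 1 "C powr (- V)" 1] by (auto simp: k_def)
  have *: "k ^ degree R * ht R powr (- V) \<le> \<bar>eval_int_poly R \<xi>\<bar>"
    if "degree R \<le> d" "eval_int_poly R \<xi> \<noteq> 0" for R
    using that
  proof (induction R rule: prime_divisors_induct)
    case zero
    then show ?case by simp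
  next
    case (unit x)
    then obtain u where u: "x = [:u:]" "is_unit u" by (auto simp: is_unit_poly_iff)
    then have "\<bar>u\<bar> = 1" by simp
    then have "poly_height x = 1" "\<bar>eval_int_poly x \<xi>\<bar> = 1"
      using u by (auto simp: poly_height_def eval_int_poly_pCons simp flip: of_int_abs)
    then show ?case using u by simp
  next
    case (factor p x)
    have nz: "eval_int_poly p \<xi> \<noteq> 0" "eval_int_poly x \<xi> \<noteq> 0"
      using factor.prems by (auto simp: eval_int_poly_mult)
    then have p0: "p \<noteq> 0" and x0: "x \<noteq> 0" by auto
    then have deg: "degree (p * x) = degree p + degree x" by (simp add: degree_mult_eq)
    then have dp: "degree p \<le> d" and dx: "degree x \<le> d" using factor.prems by auto
    have hp: "ht p \<ge> 1" and hx: "ht x \<ge> 1" and hpx: "ht (p * x) \<ge> 1"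
      using ht_ge_1 p0 x0 by auto
    have IH: "k ^ degree x * ht x powr (- V) \<le> \<bar>eval_int_poly x \<xi>\<bar>"
      using factor.IH dx nz by blast
    have irrp: "irreducible p"
      using factor.hyps by (simp add: prime_elem_imp_irreducible prime_imp_prime_elem)
    show ?case
    proof (cases "degree p = 0")
      case True
      then obtain u where u: "p = [:u:]" by (elim degree_eq_zeroE)
      have u1: "1 \<le> \<bar>real_of_int u\<bar>" using u p0 by (simp flip: of_int_abs)
      have "ht (p * x) = \<bar>of_int u\<bar> * ht x" by (simp add: u poly_height_smult)
      then have "ht x \<le> ht (p * x)" using u1 hx mult_right_mono[of 1 "\<bar>real_of_int u\<bar>" "ht x"] by simp
      then have "ht (p * x) powr (- V) \<le> ht x powr (- V)" using V0 hx by (intro powr_mono2') auto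
      then have "k ^ degree (p * x) * ht (p * x) powr (- V) \<le> k ^ degree x * ht x powr (- V)"
        using True deg k by (simp add: mult_left_mono)
      also have "\<dots> \<le> 1 * \<bar>eval_int_poly x \<xi>\<bar>" using IH by simp
      also have "\<dots> \<le> \<bar>real_of_int u\<bar> * \<bar>eval_int_poly x \<xi>\<bar>" using u1 by (intro mult_right_mono) auto
      also have "\<dots> = \<bar>eval_int_poly (p * x) \<xi>\<bar>"
        by (simp add: u eval_int_poly_smult abs_mult)
      finally show ?thesis .
    next
      case False
      have "ht (p * x) powr (- V) * C powr (- V) = (C * ht (p * x)) powr (- V)"
        using C hpx by (simp add: powr_mult mult.commute)
      also have "\<dots> \<le> (ht p * ht x) powr (- V)"
        using gelfond[OF dp dx] V0 hp hx by (intro powr_mono2') auto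
      also have "\<dots> = ht p powr (- V) * ht x powr (- V)" using hp hx by (simp add: powr_mult)
      finally have le: "ht (p * x) powr (- V) * C powr (- V) \<le> ht p powr (- V) * ht x powr (- V)" .
      have "k ^ degree (p * x) * ht (p * x) powr (- V)
          = k ^ degree p * (k ^ degree x * ht (p * x) powr (- V))"
        by (simp add: deg power_add)
      also have "\<dots> \<le> k ^ 1 * (k ^ degree x * ht (p * x) powr (- V))"
        using False k by (intro mult_right_mono power_decreasing) auto
      also have "\<dots> = c * k ^ degree x * (ht (p * x) powr (- V) * C powr (- V))"
        by (simp add: k_def)
      also have "\<dots> \<le> c * k ^ degree x * (ht p powr (- V) * ht x powr (- V))"
        using le c k by (intro mult_left_mono) auto
      also have "\<dots> = (c * ht p powr (- V)) * (k ^ degree x * ht x powr (- V))" by simp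
      also have "\<dots> \<le> \<bar>eval_int_poly p \<xi>\<bar> * \<bar>eval_int_poly x \<xi>\<bar>"
        using irr[OF irrp _ dp nz(1)] False IH c k by (intro mult_mono) auto
      also have "\<dots> = \<bar>eval_int_poly (p * x) \<xi>\<bar>" by (simp add: eval_int_poly_mult abs_mult)
      finally show ?thesis .
    qed
  qed
  have "k ^ d * ht R powr (- V) \<le> \<bar>eval_int_poly R \<xi>\<bar>"
    if R: "degree R \<le> d" "eval_int_poly R \<xi> \<noteq> 0" for R
  proof -
    have "k ^ d * ht R powr (- V) \<le> k ^ degree R * ht R powr (- V)"
      using R k by (intro mult_right_mono power_decreasing) auto
    then show ?thesis using *[OF R] by linarith
  qed
  moreover have "k ^ d > 0" using k by simp
  ultimately show ?thesis by blast
qed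

section \<open>The values of the two exponents\<close>

theorem w_exponent_eq:
  assumes n: "2 \<le> n" "n \<le> d"
  shows "w_exponent n \<xi> = ereal W"
  unfolding w_exponent_def
proof (rule Sup_ereal_eqI)
  show "0 < W" using W_bounds by simp
next
  fix v assume "W < v"
  define V where "V = (W + v) / 2"
  have V: "W < V" "V < v" using \<open>W < v\<close> by (auto simp: V_def)
  obtain c where c: "c > 0" and lb: "\<And>R. degree R \<le> d \<Longrightarrow> eval_int_poly R \<xi> \<noteq> 0 \<Longrightarrow>
      c * ht R powr (- V) \<le> \<bar>eval_int_poly R \<xi>\<bar>"
    using lower_bound[OF V(1)] by blast
  \<comment> \<open>Comparing exponent V below with v above gives c H^(v - V) \<le> 1, that is, H
    \<le> T.\<close>
  define T where "T = (1 / c) powr (1 / (v - V))"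
  have "ht R \<le> T" if R: "degree R \<le> n" "0 < \<bar>eval_int_poly R \<xi>\<bar>" "\<bar>eval_int_poly R \<xi>\<bar> \<le> ht R powr (- v)" for R
  proof -
    have h1: "ht R \<ge> 1" by (rule ht_ge_1) (use R in auto)
    have "c * ht R powr (- V) \<le> ht R powr (- v)" using lb[of R] R n by force
    then have "c * (ht R powr (- V) * ht R powr v) \<le> ht R powr (- v) * ht R powr v"
      by (metis (no_types) mult.assoc mult_right_mono powr_ge_zero)
    then have "c * ht R powr (v - V) \<le> 1" using h1 by (simp flip: powr_add)
    then have "ht R powr (v - V) \<le> 1 / c" using c by (simp add: field_simps)
    then have "(ht R powr (v - V)) powr (1 / (v - V)) \<le> T"
      unfolding T_def using V by (intro powr_mono2) auto
    then show ?thesis using V h1 by (simp add: powr_powr)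
  qed
  then have "{R. degree R \<le> n \<and> 0 < \<bar>eval_int_poly R \<xi>\<bar> \<and> \<bar>eval_int_poly R \<xi>\<bar> \<le> ht R powr (- v)}
      \<subseteq> {R. degree R \<le> n \<and> poly_height R \<le> \<lfloor>T\<rfloor>}"
    by (auto simp: le_floor_iff)
  then show "\<not> infinite {R. degree R \<le> n \<and> 0 < \<bar>eval_int_poly R \<xi>\<bar> \<and>
      \<bar>eval_int_poly R \<xi>\<bar> \<le> ht R powr (- v)}"
    using finite_bounded_height finite_subset by blast
next
  fix v assume v: "0 < v" "v < W"
  show "infinite {R. degree R \<le> n \<and> 0 < \<bar>eval_int_poly R \<xi>\<bar> \<and>
      \<bar>eval_int_poly R \<xi>\<bar> \<le> ht R powr (- v)}" (is "infinite ?S")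
  proof (rule infinite_if_arbitrarily_small[where f = "\<lambda>R. \<bar>eval_int_poly R \<xi>\<bar>"])
    fix t :: real assume t: "t > 0"
    define g where "g = 2 * w - \<eta> - v * (2 + \<eta>)"
    have g0: "g > 0" using v eta by (simp add: g_def W_def pos_less_divide_eq)
    \<comment> \<open>The quotient keeps the exponent v attainable by \<open>P i\<close>; the bound
      1 is for the end of the argument, where the value has to drop below t.\<close>
    define e where "e = min 1 (g / (1 + v))"
    have e0: "e > 0" "e \<le> 1" using g0 v by (simp_all add: e_def)
    have "e \<le> g / (1 + v)" by (simp add: e_def)
    then have "e * (1 + v) \<le> g" using v by (simp add: pos_le_divide_eq)
    then have gap: "v * (2 + \<eta> + e) \<le> 2 * w - \<eta> - e" by (simp add: g_def algebra_simps)
    obtain i where b: "- ln (t / 2) \<le> e * X i" "\<bar>ln (ht (P i)) - (2 + \<eta>) * X i\<bar> \<le> e * X i"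
      "\<bar>ln \<bar>eval_int_poly (P i) \<xi>\<bar> + (2 * w - \<eta>) * X i\<bar> \<le> e * X i"
      using eventually_bounds[OF e0(1), of "- ln (t / 2)"] by blast
    have h1: "ht (P i) \<ge> 1" by (rule ht_ge_1[OF P_nonzero])
    have v0: "0 < \<bar>eval_int_poly (P i) \<xi>\<bar>" using value_nonzero by simp
    have up: "ln \<bar>eval_int_poly (P i) \<xi>\<bar> \<le> - (2 * w - \<eta> - e) * X i"
      using b by (simp add: abs_le_iff algebra_simps)
    have "v * ln (ht (P i)) \<le> v * ((2 + \<eta> + e) * X i)"
      using b v by (intro mult_left_mono) (auto simp: abs_le_iff algebra_simps)
    also have "\<dots> \<le> (2 * w - \<eta> - e) * X i"
      using gap X_pos[of i] by (simp add: mult_right_mono flip: mult.assoc)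
    finally have "ln \<bar>eval_int_poly (P i) \<xi>\<bar> \<le> - v * ln (ht (P i))" using up by (simp add: algebra_simps)
    then have 1: "\<bar>eval_int_poly (P i) \<xi>\<bar> \<le> ht (P i) powr (- v)"
      using v0 h1 by (subst le_powr_iff_ln_le) auto
    have "\<eta> < w" using eta sqrt_w sqrt_w_square w_ge mult_right_mono[of 1 "sqrt w" "sqrt w"] by linarith
    then have "e * X i \<le> (2 * w - \<eta> - e) * X i"
      using X_pos[of i] e0 w_ge by (intro mult_right_mono) auto
    then have "ln \<bar>eval_int_poly (P i) \<xi>\<bar> \<le> ln (t / 2)" using up b(1) by (simp add: algebra_simps)
    then have "\<bar>eval_int_poly (P i) \<xi>\<bar> \<le> t / 2" using t v0 by (subst (asm) ln_le_cancel_iff) auto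
    then have 2: "\<bar>eval_int_poly (P i) \<xi>\<bar> < t" using t by linarith
    show "\<exists>R\<in>?S. 0 < \<bar>eval_int_poly R \<xi>\<bar> \<and> \<bar>eval_int_poly R \<xi>\<bar> < t"
      using 1 2 v0 n degree_P[of i] by (intro bexI[of _ "P i"]) auto
  qed
qed

text \<open>For the upper bound, roots of some \<open>P i\<close> are handled by their distance to
  \<xi>, and any other y through H(R)^(-W') \<le> |R(\<xi>)| \<le> K H(R) |\<xi> - y| for its
  minimal polynomial R. The lower bound is attained by the root of \<open>P i\<close> near
  \<xi>.\<close>

theorem w_star_exponent_eq:
  assumes n: "2 \<le> n" "n \<le> d"
  shows "w_star_exponent n \<xi> = ereal W'"
  unfolding w_star_exponent_def
proof (rule Sup_ereal_eqI)
  show "0 < W'" using W_bounds by simp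
next
  fix v assume v: "W' < v"
  define V where "V = (W' + v) / 2"
  have V: "W' < V" "V < v" using v by (auto simp: V_def)
  obtain T1 where T1: "\<And>R. irreducible R \<Longrightarrow> 2 \<le> degree R \<Longrightarrow> degree R \<le> d \<Longrightarrow> (\<forall>i. \<not> R dvd P i) \<Longrightarrow>
      T1 < ht R \<Longrightarrow> ht R powr (- W') \<le> \<bar>eval_int_poly R \<xi>\<bar>"
    using non_dividing_lower_bound by blast
  \<comment> \<open>The choice \<open>W + 1\<close> is just some exponent above \<open>W\<close>;
    for roots the relevant inequality is \<open>W' + 1 < V + 1\<close>.\<close>
  obtain T2 where T2: "\<And>R i y. irreducible R \<Longrightarrow> 2 \<le> degree R \<Longrightarrow> R dvd P i \<Longrightarrow>
      T2 < ht R \<Longrightarrow> eval_int_poly R y = 0 \<Longrightarrow> ht R powr (- (V + 1)) \<le> \<bar>\<xi> - y\<bar>"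
    using dividing_lower_bound[of "W + 1" "V + 1"] V by auto
  obtain T3 where T3: "\<And>R. degree R = 1 \<Longrightarrow> T3 < ht R \<Longrightarrow> ht R powr (- W') \<le> \<bar>eval_int_poly R \<xi>\<bar>"
    using linear_lower_bound_powr[of W'] W_bounds by auto
  \<comment> \<open>The Lipschitz constant on [-2, 2] for degree n; y lies there because |\<xi>|
    \<le> 1 and |\<xi> - y| \<le> 1.\<close>
  define K where "K = real n * (real (Suc n) * 2 ^ n) + 1"
  define T4 where "T4 = K powr (1 / (v - W'))"
  define T where "T = max 1 (max (max T1 T2) (max T3 T4))"
  have "ht (int_minpoly y) \<le> T"
    if y: "algebraic y" "alg_degree y \<le> n" "\<bar>\<xi> - y\<bar> \<le> of_int (alg_height y) powr (- v - 1)" for y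
  proof (rule ccontr)
    define R where "R = int_minpoly y"
    assume "\<not> ht (int_minpoly y) \<le> T"
    then have big: "1 < ht R" "T1 < ht R" "T2 < ht R" "T3 < ht R" "T4 < ht R"
      by (auto simp: T_def R_def)
    have R: "irreducible R" "1 \<le> degree R" "degree R \<le> n" "eval_int_poly R y = 0"
      using irreducible_int_minpoly int_minpoly_degree_ge_1 int_minpoly_root y
      by (auto simp: R_def alg_degree_def)
    have dist: "\<bar>\<xi> - y\<bar> \<le> ht R powr (- v - 1)" using y by (simp add: R_def alg_height_def)
    show False
    proof (cases "\<exists>i. R dvd P i \<and> 2 \<le> degree R")
      case True
      then have "ht R powr (- (V + 1)) \<le> \<bar>\<xi> - y\<bar>" using T2 R big by blast
      moreover have "ht R powr (- v - 1) < ht R powr (- (V + 1))"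
        using V big by (intro powr_less_mono) auto
      ultimately show False using dist by linarith
    next
      case False
      have low: "ht R powr (- W') \<le> \<bar>eval_int_poly R \<xi>\<bar>"
      proof (cases "degree R = 1")
        case True
        then show ?thesis using T3 big by blast
      next
        case d1: False
        then show ?thesis using T1 R big False n by force
      qed
      have "ht R powr (- v - 1) \<le> ht R powr 0"
        using big v W_bounds by (intro powr_mono) auto
      then have "\<bar>\<xi> - y\<bar> \<le> 1" using dist big by simp
      then have y2: "\<bar>y\<bar> \<le> 2" using abs_xi by linarith
      have up: "\<bar>eval_int_poly R \<xi>\<bar> \<le> K * (\<bar>\<xi> - y\<bar> * ht R)"
      proof -
        have "\<bar>eval_int_poly R \<xi>\<bar> = \<bar>eval_int_poly R \<xi> - eval_int_poly R y\<bar>" using R(4) by simp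
        also have "\<dots> \<le> real (Suc n) * (\<bar>\<xi> - y\<bar> * (real n * 2 ^ n)) * ht R"
          using abs_xi y2 R(3) by (intro abs_eval_int_poly_diff_le) auto
        also have "\<dots> = (K - 1) * (\<bar>\<xi> - y\<bar> * ht R)" by (simp add: K_def)
        also have "\<dots> \<le> K * (\<bar>\<xi> - y\<bar> * ht R)" using big by (intro mult_right_mono) auto
        finally show ?thesis .
      qed
      have "ht R powr (- W') \<le> K * (ht R powr (- v - 1) * ht R)"
      proof -
        have "K * (\<bar>\<xi> - y\<bar> * ht R) \<le> K * (ht R powr (- v - 1) * ht R)"
          using dist big by (intro mult_left_mono mult_right_mono) (auto simp: K_def)
        then show ?thesis using low up by linarith
      qed
      also have "ht R powr (- v - 1) * ht R = ht R powr (- v)"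
        using big powr_add[of "ht R" "- v - 1" 1] by simp
      finally have "ht R powr (- W') * ht R powr v \<le> K * ht R powr (- v) * ht R powr v"
        by (intro mult_right_mono) auto
      then have "ht R powr (v - W') \<le> K" using big by (simp add: mult.assoc flip: powr_add)
      then have "(ht R powr (v - W')) powr (1 / (v - W')) \<le> T4"
        unfolding T4_def using v by (intro powr_mono2) auto
      then have "ht R \<le> T4" using v big by (simp add: powr_powr)
      then show False using big by simp
    qed
  qed
  then have "int_minpoly ` {y. algebraic y \<and> alg_degree y \<le> n \<and> 0 < \<bar>\<xi> - y\<bar> \<and>
        \<bar>\<xi> - y\<bar> \<le> of_int (alg_height y) powr (- v - 1)}
      \<subseteq> {R. degree R \<le> n \<and> poly_height R \<le> \<lfloor>T\<rfloor>}" (is "int_minpoly ` ?S \<subseteq> ?F")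
    by (auto simp: le_floor_iff alg_degree_def)
  then have "finite (int_minpoly ` ?S)" using finite_bounded_height finite_subset by blast
  \<comment> \<open>Finitely many minimal polynomials, each with finitely many roots, leave finitely
    many numbers y.\<close>
  moreover have "finite {y \<in> ?S. int_minpoly y = R}" if R: "R \<in> int_minpoly ` ?S" for R
  proof (rule finite_subset)
    show "{y \<in> ?S. int_minpoly y = R} \<subseteq> {y. eval_int_poly R y = 0}"
      using int_minpoly_root by auto
    have "R \<noteq> 0" using R int_minpoly_nonzero by auto
    then have "map_poly (of_int :: int \<Rightarrow> real) R \<noteq> 0" by (simp add: map_poly_eq_0_iff)
    then show "finite {y. eval_int_poly R y = 0}" by (rule poly_roots_finite)
  qed
  ultimately have "finite (\<Union>R\<in>int_minpoly ` ?S. {y \<in> ?S. int_minpoly y = R})" by blast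
  then have "finite ?S" by (rule rev_finite_subset) auto
  then show "\<not> infinite ?S" by simp
next
  fix v assume v: "0 < v" "v < W'"
  obtain C where C: "C \<ge> 1" and gelfond: "\<And>P Q. degree P \<le> 2 \<Longrightarrow> degree Q \<le> 2 \<Longrightarrow>
      ht P * ht Q \<le> C * ht (P * Q)"
    using poly_height_mult_ge[of 2] by blast
  show "infinite {y. algebraic y \<and> alg_degree y \<le> n \<and> 0 < \<bar>\<xi> - y\<bar> \<and>
        \<bar>\<xi> - y\<bar> \<le> of_int (alg_height y) powr (- v - 1)}" (is "infinite ?S")
  proof (rule infinite_if_arbitrarily_small[where f = "\<lambda>y. \<bar>\<xi> - y\<bar>"])
    fix t :: real assume t: "t > 0"
    define g where "g = 2 * w - (v + 1) * (2 + \<eta>)"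
    have "v + 1 < 2 * w / (2 + \<eta>)" using v W'_eq by linarith
    then have g0: "g > 0" using eta by (simp add: g_def pos_less_divide_eq)
    define e where "e = min 1 (g / (5 + 2 * v))"
    have e0: "e > 0" "e \<le> 1" using g0 v by (simp_all add: e_def)
    have "e \<le> g / (5 + 2 * v)" by (simp add: e_def)
    then have "e * (5 + 2 * v) \<le> g" using v by (simp add: pos_le_divide_eq)
    then have gap: "(v + 1) * (2 + \<eta> + 2 * e) \<le> 2 * w - 3 * e" by (simp add: g_def algebra_simps)
    define c where "c = max (max (ln 4) (ln C)) (- ln (t / 2))"
    obtain i where b: "c \<le> e * X i" "\<bar>ln (ht (P i)) - (2 + \<eta>) * X i\<bar> \<le> e * X i"
      "\<bar>ln \<bar>eval_int_poly (P i) \<xi>\<bar> + (2 * w - \<eta>) * X i\<bar> \<le> e * X i" "\<bar>ln \<bar>dP i\<bar> - \<eta> * X i\<bar> \<le> e * X i"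
      using eventually_bounds[OF e0(1), of c] by blast
    define x where "x = X i"
    have x0: "x > 0" by (simp add: x_def X_pos)
    define f D A where "f = \<bar>eval_int_poly (P i) \<xi>\<bar>" and "D = \<bar>dP i\<bar>" and "A = real_of_int (coeff (P i) 2)"
    have f0: "f > 0" and D0: "D > 0" using value_nonzero deriv_nonzero by (auto simp: f_def D_def)
    have "coeff (P i) 2 \<noteq> 0" using P_nonzero[of i] degree_P[of i] by (metis leading_coeff_0_iff)
    then have A0: "A \<noteq> 0" by (simp add: A_def)
    have "\<bar>coeff (P i) 2\<bar> \<le> poly_height (P i)" by (rule abs_coeff_le_poly_height)
    then have Ah: "\<bar>A\<bar> \<le> ht (P i)" unfolding A_def by (simp flip: of_int_abs)
    have hP1: "ht (P i) \<ge> 1" by (rule ht_ge_1[OF P_nonzero])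
    have bb: "ln 4 \<le> e * x" "ln C \<le> e * x" "- ln (t / 2) \<le> e * x" "ln (ht (P i)) \<le> (2 + \<eta> + e) * x"
      "ln f \<le> - (2 * w - \<eta> - e) * x" "(\<eta> - e) * x \<le> ln D"
      using b by (auto simp: c_def x_def f_def D_def abs_le_iff algebra_simps)
    \<comment> \<open>The discriminant condition of \<open>quadratic_root_near\<close>: on the scale
      x the left side has exponent about 2 + 2 \<eta> - 2 w and the right side about 2
      \<eta>.\<close>
    have "4 * \<bar>A\<bar> * f \<le> D\<^sup>2"
    proof -
      have "ln (4 * \<bar>A\<bar> * f) = ln 4 + ln \<bar>A\<bar> + ln f" using A0 f0 by (simp add: ln_mult)
      also have "\<dots> \<le> ln 4 + ln (ht (P i)) + ln f"
        using A0 Ah hP1 by (simp add: ln_le_cancel_iff)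
      also have "\<dots> \<le> (2 + 2 * \<eta> + 3 * e - 2 * w) * x"
        using bb by (simp add: algebra_simps)
      also have "\<dots> \<le> (2 * (\<eta> - e)) * x" using x0 e0 w_ge by (intro mult_right_mono) auto
      also have "\<dots> \<le> ln D + ln D" using bb by (simp add: algebra_simps)
      also have "\<dots> = ln (D\<^sup>2)" using D0 by (simp add: power2_eq_square ln_mult)
      finally show ?thesis using A0 f0 D0 by (subst (asm) ln_le_cancel_iff) auto
    qed
    then obtain y where y: "eval_int_poly (P i) y = 0" and close: "\<bar>\<xi> - y\<bar> \<le> 2 * f / D"
      using quadratic_root_near[of A \<xi> "of_int (coeff (P i) 1)" "of_int (coeff (P i) 0)"] deriv_nonzero[of i]
      unfolding f_def D_def A_def eval_P by auto
    have z0: "0 < \<bar>\<xi> - y\<bar>" using y value_nonzero[of i] by auto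
    have alg: "algebraic y"
    proof (rule algebraicI)
      show "map_poly of_int (P i) \<noteq> (0 :: real poly)" using P_nonzero[of i] by (simp add: map_poly_eq_0_iff)
      show "poly (map_poly of_int (P i)) y = 0" by (rule y)
    qed (simp add: coeff_map_poly)
    define R where "R = int_minpoly y"
    have R0: "R \<noteq> 0" using int_minpoly_nonzero[OF alg] by (simp add: R_def)
    have h1: "ht R \<ge> 1" by (rule ht_ge_1[OF R0])
    obtain S where S: "P i = R * S" using int_minpoly_dvd[OF alg y] by (auto simp: R_def elim: dvdE)
    have S0: "S \<noteq> 0" using S P_nonzero[of i] by auto
    have degs: "degree R + degree S = 2" using S R0 S0 degree_P[of i] by (simp add: degree_mult_eq)
    \<comment> \<open>Should \<open>P i\<close> split, R is a proper factor, and Gelfond's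
      inequality still bounds its height by a constant times that of \<open>P i\<close>.\<close>
    have "ht R * 1 \<le> ht R * ht S" using h1 ht_ge_1[OF S0] by (intro mult_left_mono) auto
    also have "\<dots> \<le> C * ht (P i)" unfolding S using degs by (intro gelfond) auto
    finally have "ln (ht R) \<le> ln (C * ht (P i))" using h1 C hP1 by (subst ln_le_cancel_iff) auto
    also have "\<dots> = ln C + ln (ht (P i))" using C hP1 by (simp add: ln_mult)
    finally have hR: "ln (ht R) \<le> (2 + \<eta> + 2 * e) * x" using bb by (simp add: algebra_simps)
    have "ln \<bar>\<xi> - y\<bar> \<le> ln (2 * f / D)" using close z0 f0 D0 by (subst ln_le_cancel_iff) auto
    also have "\<dots> = ln 2 + ln f - ln D" using f0 D0 by (simp add: ln_mult ln_div)
    also have "ln 2 \<le> ln (4::real)" by simp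
    finally have lz: "ln \<bar>\<xi> - y\<bar> \<le> - (2 * w - 3 * e) * x" using bb by (simp add: algebra_simps)
    have "(v + 1) * ln (ht R) \<le> (v + 1) * ((2 + \<eta> + 2 * e) * x)"
      using hR v by (intro mult_left_mono) auto
    also have "\<dots> \<le> (2 * w - 3 * e) * x"
      using gap x0 by (simp add: mult_right_mono flip: mult.assoc)
    finally have "ln \<bar>\<xi> - y\<bar> \<le> (- v - 1) * ln (ht R)" using lz by (simp add: algebra_simps)
    then have 1: "\<bar>\<xi> - y\<bar> \<le> ht R powr (- v - 1)" using z0 h1 by (subst le_powr_iff_ln_le) auto
    have "e * x \<le> (2 * w - 3 * e) * x" using x0 e0 w_ge by (intro mult_right_mono) auto
    then have "ln \<bar>\<xi> - y\<bar> \<le> ln (t / 2)" using lz bb by (simp add: algebra_simps)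
    then have "\<bar>\<xi> - y\<bar> \<le> t / 2" using t z0 by (subst (asm) ln_le_cancel_iff) auto
    then have 2: "\<bar>\<xi> - y\<bar> < t" using t by linarith
    have "y \<in> ?S" using alg degs n 1 z0 by (auto simp: alg_degree_def alg_height_def R_def)
    then show "\<exists>y\<in>?S. 0 < \<bar>\<xi> - y\<bar> \<and> \<bar>\<xi> - y\<bar> < t" using z0 2 by blast
  qed
qed

end

section \<open>Continued fractions with bounded partial quotients\<close>

text \<open>The third bound keeps every convergent after the initial one uniformly above 1; this is
  the source of the contraction in \<open>cfrac_convergent_Cauchy_bound\<close>.\<close>

lemma cfrac_convergent_bounds:
  assumes "\<And>i. 1 \<le> s i" "\<And>i. s i \<le> B"
  shows "1 \<le> cfrac_convergent s n" "cfrac_convergent s n \<le> of_int B + 1"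
    and "1 + 1 / (of_int B + 1) \<le> cfrac_convergent s (Suc n)"
proof -
  have *: "1 \<le> cfrac_convergent s n \<and> cfrac_convergent s n \<le> of_int B + 1"
    if "\<And>i. 1 \<le> s i" "\<And>i. s i \<le> B" for s :: "nat \<Rightarrow> int"
    using that
  proof (induction n arbitrary: s)
    case 0
    have "1 \<le> s 0" "s 0 \<le> B" by (rule 0)+
    then have "1 \<le> s 0" "s 0 \<le> B + 1" by linarith+
    then have "1 \<le> real_of_int (s 0)" "real_of_int (s 0) \<le> of_int (B + 1)" by (simp_all only: of_int_le_iff of_int_1_le_iff)
    then show ?case by simp
  next
    case (Suc n)
    have "1 \<le> cfrac_convergent (\<lambda>i. s (Suc i)) n"
      using Suc.IH[of "\<lambda>i. s (Suc i)"] Suc.prems by simp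
    then have "0 < 1 / cfrac_convergent (\<lambda>i. s (Suc i)) n" "1 / cfrac_convergent (\<lambda>i. s (Suc i)) n \<le> 1"
      by auto
    moreover have "1 \<le> s 0" "s 0 \<le> B" by (rule Suc.prems)+
    then have "1 \<le> real_of_int (s 0)" "real_of_int (s 0) \<le> of_int B" by simp_all
    ultimately show ?case unfolding cfrac_convergent.simps by linarith
  qed
  show "1 \<le> cfrac_convergent s n" "cfrac_convergent s n \<le> of_int B + 1"
    using *[of s] assms by auto
  have "1 \<le> cfrac_convergent (\<lambda>i. s (Suc i)) n" "cfrac_convergent (\<lambda>i. s (Suc i)) n \<le> of_int B + 1"
    using *[of "\<lambda>i. s (Suc i)"] assms by auto
  then have "1 / (of_int B + 1) \<le> 1 / cfrac_convergent (\<lambda>i. s (Suc i)) n"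
    by (intro divide_left_mono) auto
  moreover have "1 \<le> real_of_int (s 0)" using assms(1)[of 0] by simp
  ultimately show "1 + 1 / (of_int B + 1) \<le> cfrac_convergent s (Suc n)" by simp
qed

text \<open>Since 1/x - 1/y = (y - x)/(x y) and both tails are at least r > 1, prepending a digit
  contracts distances by 1/r^2. The bound is uniform in s, so the induction can pass to the shifted
  sequence.\<close>

lemma cfrac_convergent_Cauchy_bound:
  fixes B :: int
  defines "r \<equiv> 1 + 1 / (of_int B + 1 :: real)"
  assumes "\<And>i. 1 \<le> s i" "\<And>i. s i \<le> B"
  shows "\<bar>cfrac_convergent s (Suc N + n) - cfrac_convergent s (Suc N + m)\<bar> \<le> (of_int B + 1) * (1 / (r * r)) ^ N"
  using assms(2,3)
proof (induction N arbitrary: s)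
  case 0
  then show ?case
    using cfrac_convergent_bounds(1,2)[of s B "Suc n"] cfrac_convergent_bounds(1,2)[of s B "Suc m"]
    unfolding power_0 mult_1_right by (simp del: cfrac_convergent.simps)
next
  case (Suc N)
  let ?s = "\<lambda>i. s (Suc i)"
  define x y where "x = cfrac_convergent ?s (Suc N + n)" and "y = cfrac_convergent ?s (Suc N + m)"
  have B0: "B \<ge> 1" using Suc.prems order_trans by blast
  have r: "1 \<le> r" using B0 by (simp add: r_def)
  have xy: "r \<le> x" "r \<le> y"
    using cfrac_convergent_bounds(3)[of ?s B] Suc.prems unfolding x_def y_def r_def by auto
  have pos: "0 < x" "0 < y" using xy r by auto
  have IH: "\<bar>x - y\<bar> \<le> (of_int B + 1) * (1 / (r * r)) ^ N"
    unfolding x_def y_def by (rule Suc.IH) (rule Suc.prems)+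
  have "cfrac_convergent s (Suc (Suc N) + n) - cfrac_convergent s (Suc (Suc N) + m) = 1 / x - 1 / y"
    unfolding x_def y_def by simp
  also have "\<bar>\<dots>\<bar> = \<bar>x - y\<bar> * (1 / (x * y))"
  proof -
    have "1 / x - 1 / y = (y - x) * (1 / (x * y))" using pos by (simp add: field_simps)
    then show ?thesis using pos by (simp add: abs_mult abs_minus_commute)
  qed
  also have "\<dots> \<le> (of_int B + 1) * (1 / (r * r)) ^ N * (1 / (r * r))"
    using IH xy r pos by (intro mult_mono divide_left_mono) auto
  finally show ?case by simp
qed

lemma convergent_cfrac:
  assumes "\<And>i. 1 \<le> s i" "\<And>i. s i \<le> B"
  shows "convergent (cfrac_convergent s)"
proof -
  define r where "r = 1 + 1 / (of_int B + 1 :: real)"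
  have B0: "B \<ge> 1" using assms order_trans by blast
  have "r > 1" using B0 by (simp add: r_def)
  then have rr: "r * r > 1" using mult_strict_mono[of 1 r 1 r] by simp
  have "Cauchy (cfrac_convergent s)"
  proof (rule metric_CauchyI)
    fix e :: real assume "e > 0"
    then have "0 < e / (of_int B + 1)" using B0 by simp
    then obtain N where N: "(1 / (r * r)) ^ N < e / (of_int B + 1)"
      using real_arch_pow_inv[of _ "1 / (r * r)"] rr by auto
    have small: "(of_int B + 1) * (1 / (r * r)) ^ N < e" using N B0 by (simp add: field_simps)
    show "\<exists>M. \<forall>m\<ge>M. \<forall>n\<ge>M. dist (cfrac_convergent s m) (cfrac_convergent s n) < e"
    proof (intro exI[of _ "Suc N"] allI impI)
      fix m n assume "Suc N \<le> m" "Suc N \<le> n"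
      then show "dist (cfrac_convergent s m) (cfrac_convergent s n) < e"
        using cfrac_convergent_Cauchy_bound[of s B N "m - Suc N" "n - Suc N"] assms small
        unfolding dist_real_def r_def by simp
    qed
  qed
  then show ?thesis by (simp add: Cauchy_convergent_iff)
qed

lemma cfrac_value_bounds:
  assumes "\<And>i. 1 \<le> s i" "\<And>i. s i \<le> B"
  shows "1 \<le> cfrac_value s" "cfrac_value s \<le> of_int B + 1"
proof -
  have lim: "cfrac_convergent s \<longlonglongrightarrow> cfrac_value s"
    unfolding cfrac_value_def using convergent_cfrac[OF assms] by (simp add: convergent_LIMSEQ_iff)
  show "1 \<le> cfrac_value s" "cfrac_value s \<le> of_int B + 1"
    using LIMSEQ_le_const[OF lim] LIMSEQ_le_const2[OF lim] cfrac_convergent_bounds[of s B] assms by blast+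
qed

lemma cfrac_value_rec:
  assumes "\<And>i. 1 \<le> s (Suc i)" "\<And>i. s (Suc i) \<le> B"
  shows "cfrac_value s = of_int (s 0) + 1 / cfrac_value (\<lambda>i. s (Suc i))"
proof -
  have lim: "cfrac_convergent (\<lambda>i. s (Suc i)) \<longlonglongrightarrow> cfrac_value (\<lambda>i. s (Suc i))"
    unfolding cfrac_value_def using convergent_cfrac[of "\<lambda>i. s (Suc i)" B] assms
    by (simp add: convergent_LIMSEQ_iff)
  moreover have "cfrac_value (\<lambda>i. s (Suc i)) \<noteq> 0"
    using cfrac_value_bounds(1)[of "\<lambda>i. s (Suc i)" B] assms by auto
  ultimately have "(\<lambda>n. cfrac_convergent s (Suc n)) \<longlonglongrightarrow> of_int (s 0) + 1 / cfrac_value (\<lambda>i. s (Suc i))"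
    by (auto intro!: tendsto_intros)
  then have "cfrac_convergent s \<longlonglongrightarrow> of_int (s 0) + 1 / cfrac_value (\<lambda>i. s (Suc i))"
    by (rule LIMSEQ_imp_Suc)
  then show ?thesis unfolding cfrac_value_def[of s] by (rule limI)
qed

text \<open>The continuants are shifted by one index: in classical notation \<open>qd n\<close> and \<open>pd n\<close> are
  \<open>q\<^sub>n\<^sub>-\<^sub>1\<close> and \<open>p\<^sub>n\<^sub>-\<^sub>1\<close>. The digit \<open>s 0\<close> is not used.\<close>

fun qd :: "(nat \<Rightarrow> int) \<Rightarrow> nat \<Rightarrow> int" where
  "qd s 0 = 0"
| "qd s (Suc 0) = 1"
| "qd s (Suc (Suc n)) = s (Suc n) * qd s (Suc n) + qd s n"

fun pd :: "(nat \<Rightarrow> int) \<Rightarrow> nat \<Rightarrow> int" where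
  "pd s 0 = 1"
| "pd s (Suc 0) = 0"
| "pd s (Suc (Suc n)) = s (Suc n) * pd s (Suc n) + pd s n"

lemma continuant_det: "qd s (Suc n) * pd s n - qd s n * pd s (Suc n) = (- 1) ^ n"
  by (induction n) (auto simp: algebra_simps)

section \<open>Complete quotients, convergents and bad approximability\<close>

locale bounded_cfrac =
  fixes s :: "nat \<Rightarrow> int" and B :: int
  assumes digit_ge_1: "\<And>i. 1 \<le> s i" and digit_le: "\<And>i. s i \<le> B"
begin

text \<open>\<open>t n\<close> is the n-th complete quotient and \<open>x\<close> the number
  [0, s 1, s 2, ...]; because of the index shift, \<open>D (Suc n)\<close> is q_n x - p_n in
  classical notation.\<close>

definition t :: "nat \<Rightarrow> real" where "t n = cfrac_value (\<lambda>i. s (n + i))"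

definition x :: real where "x = 1 / t 1"

definition D :: "nat \<Rightarrow> real" where "D n = of_int (qd s n) * x - of_int (pd s n)"

abbreviation q :: "nat \<Rightarrow> real" where "q n \<equiv> of_int (qd s n)"

text \<open>One constant serves several purposes: complete quotients are at most
  \<open>C - 1\<close>, consecutive denominators have ratio at most \<open>C\<close>, and
  \<open>t (Suc n) * q (Suc n) + q n\<close> is at most \<open>C * q (Suc n)\<close>.\<close>

definition C :: real where "C = of_int B + 2"

lemma C_ge: "3 \<le> C"
proof -
  have "1 \<le> B" using digit_ge_1[of 0] digit_le[of 0] by simp
  then show ?thesis by (simp add: C_def)
qed

lemma t_bounds: "1 \<le> t n" "t n \<le> C - 1"
  using cfrac_value_bounds[of "\<lambda>i. s (n + i)" B] digit_ge_1 digit_le by (auto simp: t_def C_def)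

lemma t_rec: "t n = of_int (s n) + 1 / t (Suc n)"
  using cfrac_value_rec[of "\<lambda>i. s (n + i)" B] digit_ge_1 digit_le by (simp add: t_def)

lemma inverse_t: "1 / C \<le> 1 / t n" "1 / t n \<le> 1"
  using t_bounds[of n] C_ge by (auto intro: divide_left_mono)

lemma x_bounds: "0 < x" "x \<le> 1"
  using inverse_t[of 1] t_bounds[of 1] by (auto simp: x_def)

lemma D_rec: "D (Suc (Suc n)) = of_int (s (Suc n)) * D (Suc n) + D n"
  by (simp add: D_def algebra_simps)

lemma D_ratio: "D n = - t (Suc n) * D (Suc n)"
proof (induction n)
  case 0
  then show ?case using t_bounds[of 1] by (simp add: D_def x_def)
next
  case (Suc n)
  have "D (Suc (Suc n)) = (of_int (s (Suc n)) - t (Suc n)) * D (Suc n)"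
    using D_rec[of n] Suc by (simp add: algebra_simps)
  also have "of_int (s (Suc n)) - t (Suc n) = - 1 / t (Suc (Suc n))"
    using t_rec[of "Suc n"] by simp
  finally show ?case using t_bounds[of "Suc (Suc n)"] by simp
qed

lemma q_rec: "q (Suc (Suc n)) = of_int (s (Suc n)) * q (Suc n) + q n"
  by simp

lemma qd_nonneg: "0 \<le> qd s n" and qd_pos: "1 \<le> qd s (Suc n)"
proof -
  have "0 \<le> qd s n \<and> 1 \<le> qd s (Suc n)"
  proof (induction n)
    case (Suc n)
    have "1 * 1 \<le> s (Suc n) * qd s (Suc n)"
      using Suc digit_ge_1[of "Suc n"] by (intro mult_mono) auto
    then show ?case using Suc by simp
  qed simp
  then show "0 \<le> qd s n" "1 \<le> qd s (Suc n)" by auto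
qed

lemma q_ge_1: "1 \<le> n \<Longrightarrow> 1 \<le> q n"
  using qd_pos[of "n - 1"] by simp

lemma q_nonneg: "0 \<le> q n"
  using qd_nonneg[of n] by simp

lemma q_le_Suc: "q n \<le> q (Suc n)"
proof (cases n)
  case (Suc m)
  have "1 * q (Suc m) \<le> of_int (s (Suc m)) * q (Suc m)"
    using q_nonneg digit_ge_1[of "Suc m"] by (intro mult_right_mono) auto
  then show ?thesis using q_nonneg[of m] unfolding Suc q_rec by simp
qed simp

lemma q_mono: "m \<le> n \<Longrightarrow> q m \<le> q n"
  by (rule lift_Suc_mono_le[of q]) (rule q_le_Suc)

lemma q_Suc_le: "1 \<le> n \<Longrightarrow> q (Suc n) \<le> C * q n"
proof -
  assume "1 \<le> n"
  then obtain m where m: "n = Suc m" by (cases n) auto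
  have "of_int (s (Suc m)) * q (Suc m) \<le> of_int B * q (Suc m)"
    using q_nonneg digit_le[of "Suc m"] by (intro mult_right_mono) auto
  then show ?thesis
    using q_le_Suc[of m] q_nonneg[of "Suc m"] unfolding m q_rec C_def
    by (simp only: distrib_right)
qed

lemma pd_bounds: "0 \<le> pd s (Suc n)" "pd s (Suc n) \<le> qd s (Suc n)"
proof -
  have "0 \<le> pd s (Suc n) \<and> pd s (Suc n) \<le> qd s (Suc n) \<and> 0 \<le> pd s (Suc (Suc n)) \<and> pd s (Suc (Suc n)) \<le> qd s (Suc (Suc n))"
  proof (induction n)
    case 0
    then show ?case using digit_ge_1[of 1] by simp
  next
    case (Suc n)
    have "0 \<le> s (Suc (Suc n)) * pd s (Suc (Suc n))"
      "s (Suc (Suc n)) * pd s (Suc (Suc n)) \<le> s (Suc (Suc n)) * qd s (Suc (Suc n))"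
      using Suc digit_ge_1[of "Suc (Suc n)"] by (auto intro!: mult_left_mono mult_nonneg_nonneg simp del: pd.simps qd.simps)
    then show ?case using Suc pd.simps(3)[of s "Suc n"] qd.simps(3)[of s "Suc n"] by linarith
  qed
  then show "0 \<le> pd s (Suc n)" "pd s (Suc n) \<le> qd s (Suc n)" by auto
qed

lemma abs_D: "\<bar>D (Suc n)\<bar> * (t (Suc n) * q (Suc n) + q n) = 1"
proof -
  have "q (Suc n) * D n - q n * D (Suc n) = - of_int (qd s (Suc n) * pd s n - qd s n * pd s (Suc n))"
    by (simp add: D_def algebra_simps)
  then have "\<bar>q (Suc n) * D n - q n * D (Suc n)\<bar> = 1" unfolding continuant_det by simp
  also have "q (Suc n) * D n - q n * D (Suc n) = - (D (Suc n) * (t (Suc n) * q (Suc n) + q n))"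
    unfolding D_ratio[of n] by (simp add: algebra_simps)
  finally have "\<bar>D (Suc n)\<bar> * \<bar>t (Suc n) * q (Suc n) + q n\<bar> = 1" by (simp add: abs_mult)
  moreover have "0 \<le> t (Suc n) * q (Suc n) + q n"
    using t_bounds[of "Suc n"] q_nonneg by (intro add_nonneg_nonneg mult_nonneg_nonneg) auto
  ultimately show ?thesis by simp
qed

lemma D_bounds:
  assumes "1 \<le> n"
  shows "1 / (C * q n) \<le> \<bar>D n\<bar>" "\<bar>D n\<bar> \<le> 1 / q n"
proof -
  obtain m where m: "n = Suc m" using assms by (cases n) auto
  have qn: "1 \<le> q n" using q_ge_1[OF assms] .
  define y where "y = t n * q n + q m"
  have "1 * q n \<le> t n * q n" "t n * q n \<le> (C - 1) * q n"
    using t_bounds[of n] qn by (auto intro: mult_right_mono)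
  then have y: "q n \<le> y" "y \<le> C * q n"
    using q_le_Suc[of m] q_nonneg[of m] by (auto simp: y_def m algebra_simps)
  have "\<bar>D n\<bar> = 1 / y" using abs_D[of m] qn y by (simp add: y_def m field_simps)
  then show "1 / (C * q n) \<le> \<bar>D n\<bar>" "\<bar>D n\<bar> \<le> 1 / q n"
    using y qn C_ge by (auto intro!: divide_left_mono)
qed

text \<open>Take a convergent p/q with 2 |v| < q \<le> 2 C^2 |v| that differs from u/v. The integer
  v p - u q is nonzero and equals q (v x - u) - v (q x - p), whose second term is at most 1/2. Two
  consecutive convergents cannot both equal u/v, by the determinant identity, so one of two
  candidates works.\<close>

lemma badly_approximable:
  fixes u v :: int
  assumes "v \<noteq> 0"
  shows "1 / (4 * C * C) \<le> \<bar>of_int v\<bar> * \<bar>of_int v * x - of_int u\<bar>"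
proof -
  define y where "y = \<bar>real_of_int v\<bar>"
  have y1: "1 \<le> y" using assms by (simp add: y_def flip: of_int_abs)
  have unb: "\<exists>n. 2 * y < q n"
  proof -
    have "real n \<le> q (n + 2)" for n
    proof (induction n)
      case (Suc n)
      have "q (Suc n + 2) \<ge> q (n + 2) + q (n + 1)"
        using mult_right_mono[of 1 "real_of_int (s (Suc (Suc n)))" "q (n + 2)"] digit_ge_1[of "Suc (Suc n)"] q_nonneg[of "n + 2"]
          q_rec[of "Suc n"] by (simp del: qd.simps)
      then show ?case using Suc q_ge_1[of "n + 1"] by simp
    qed (use q_nonneg[of 2] in \<open>simp add: numeral_2_eq_2\<close>)
    moreover obtain N where "2 * y < real N" using reals_Archimedean2 by blast
    ultimately have "2 * y < q (N + 2)" by (rule order_less_le_trans[rotated])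
    then show ?thesis by blast
  qed
  define n where "n = (LEAST n. 2 * y < q n)"
  have qn: "2 * y < q n" unfolding n_def using unb by (rule LeastI_ex)
  have "n \<noteq> 0" using qn y1 by (intro notI) simp
  moreover have "n \<noteq> Suc 0" using qn y1 by (intro notI) simp
  ultimately obtain m where m: "n = Suc m" "1 \<le> m" by (cases n) auto
  have "\<not> 2 * y < q m" using not_less_Least[of m "\<lambda>n. 2 * y < q n"] m unfolding n_def by simp
  then have "C * q m \<le> C * (2 * y)" using C_ge by (intro mult_left_mono) auto
  then have "q n \<le> C * (2 * y)" using q_Suc_le[OF m(2)] unfolding m by linarith
  then have qb1: "q n \<le> 2 * C * y" by (simp add: mult_ac)
  have "q (Suc n) \<le> C * q n" using m by (intro q_Suc_le) simp
  also have "\<dots> \<le> C * (2 * C * y)" using qb1 C_ge by (intro mult_left_mono) auto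
  finally have qb2: "q (Suc n) \<le> 2 * C * C * y" by (simp add: mult_ac)
  have key: "1 / (4 * C * C) \<le> y * \<bar>of_int v * x - of_int u\<bar>"
    if k: "n \<le> k" "q k \<le> 2 * C * C * y" and nz: "v * pd s k - u * qd s k \<noteq> 0" for k
  proof -
    have k1: "1 \<le> k" using k m by simp
    have qk: "2 * y < q k" using qn q_mono[OF k(1)] by simp
    have "1 \<le> \<bar>v * pd s k - u * qd s k\<bar>" using nz by linarith
    then have "1 \<le> \<bar>real_of_int (v * pd s k - u * qd s k)\<bar>"
      by (simp only: of_int_abs[symmetric] of_int_1_le_iff)
    also have "real_of_int (v * pd s k - u * qd s k) = q k * (of_int v * x - of_int u) - of_int v * D k"
      by (simp add: D_def algebra_simps)
    also have "\<bar>\<dots>\<bar> \<le> \<bar>q k * (of_int v * x - of_int u)\<bar> + \<bar>of_int v * D k\<bar>" by linarith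
    also have "\<dots> = q k * \<bar>of_int v * x - of_int u\<bar> + y * \<bar>D k\<bar>"
      using q_nonneg[of k] by (simp add: abs_mult y_def)
    also have "y * \<bar>D k\<bar> \<le> 1 / 2"
    proof -
      have "y * \<bar>D k\<bar> \<le> y * (1 / q k)" using D_bounds(2)[OF k1] y1 by (intro mult_left_mono) auto
      also have "\<dots> \<le> 1 / 2" using qk y1 by (simp add: field_simps)
      finally show ?thesis .
    qed
    also have "q k * \<bar>of_int v * x - of_int u\<bar> \<le> 2 * C * C * y * \<bar>of_int v * x - of_int u\<bar>"
      using k by (intro mult_right_mono) auto
    finally have "1 / 2 \<le> 2 * C * C * (y * \<bar>of_int v * x - of_int u\<bar>)" by (simp add: mult_ac)
    then show ?thesis using C_ge by (simp add: pos_divide_le_eq mult_ac)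
  qed
  show ?thesis
  proof (cases "v * pd s n - u * qd s n = 0")
    case False
    have "2 * C * y * 1 \<le> 2 * C * y * C" using C_ge y1 by (intro mult_left_mono) auto
    then have "q n \<le> 2 * C * C * y" using qb1 by (simp add: mult_ac)
    then show ?thesis using key[OF order_refl _ False] by (simp add: y_def)
  next
    case True
    have "v * pd s (Suc n) - u * qd s (Suc n) \<noteq> 0"
    proof
      assume *: "v * pd s (Suc n) - u * qd s (Suc n) = 0"
      have "v * (qd s (Suc n) * pd s n - qd s n * pd s (Suc n))
          = qd s (Suc n) * (v * pd s n - u * qd s n) - qd s n * (v * pd s (Suc n) - u * qd s (Suc n))"
        by (simp add: algebra_simps del: pd.simps qd.simps)
      then have "v * (- 1) ^ n = 0" unfolding continuant_det True * by simp
      then show False using assms by simp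
    qed
    then show ?thesis using key[OF le_SucI[OF order_refl] qb2] by (simp add: y_def)
  qed
qed

subsection \<open>The quadratic polynomials\<close>

text \<open>The linear form with value \<open>D n\<close> at x. It obeys the recurrence of the
  continuants, so identities for the quadratics can be proved without looking at
  coefficients.\<close>

definition lin :: "nat \<Rightarrow> int poly" where "lin n = [:- pd s n, qd s n:]"

text \<open>Up to sign \<open>quad L j\<close> is the polynomial vanishing at the quadratic irrational whose continued
  fraction has the digits \<open>s 1, \<dots>, s j\<close> as preperiod and \<open>s (j + 1), \<dots>, s (j + L)\<close> as period.\<close>

definition quad :: "nat \<Rightarrow> nat \<Rightarrow> int poly" where
  "quad L j = lin j * lin (Suc (j + L)) - lin (Suc j) * lin (j + L)"

lemma lin_rec: "lin (Suc (Suc n)) = smult (s (Suc n)) (lin (Suc n)) + lin n"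
  by (simp add: lin_def)

lemma eval_lin: "eval_int_poly (lin n) x = D n"
  by (simp add: lin_def D_def eval_int_poly_pCons)

text \<open>\<open>quad L j\<close> is the determinant with rows (lin j, lin (j + 1)) and (lin (j +
  L), lin (j + L + 1)). When the next digits agree, passing to j + 1 swaps the columns and adds the
  same multiple of one to the other in both rows.\<close>

lemma quad_Suc:
  assumes "s (Suc j) = s (Suc j + L)"
  shows "quad L (Suc j) = - quad L j"
  using assms by (simp add: quad_def lin_rec algebra_simps smult_add_right)

lemma quad_shift:
  assumes "\<And>n. i < n \<Longrightarrow> n \<le> j \<Longrightarrow> s n = s (n + L)" "i \<le> j"
  shows "quad L j = quad L i \<or> quad L j = - quad L i"
  using assms(2,1)
proof (induction j rule: dec_induct)
  case (step n)
  have "quad L (Suc n) = - quad L n" using step by (intro quad_Suc) auto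
  moreover have "quad L n = quad L i \<or> quad L n = - quad L i" using step by auto
  ultimately show ?case by auto
qed simp

lemma coeff_quad:
  "coeff (quad L j) 2 = qd s j * qd s (Suc (j + L)) - qd s (Suc j) * qd s (j + L)"
  "coeff (quad L j) 1 = - (qd s j * pd s (Suc (j + L)) + pd s j * qd s (Suc (j + L))
     - qd s (Suc j) * pd s (j + L) - pd s (Suc j) * qd s (j + L))"
  "coeff (quad L j) 0 = pd s j * pd s (Suc (j + L)) - pd s (Suc j) * pd s (j + L)"
  by (simp_all add: quad_def lin_def numeral_2_eq_2 algebra_simps)

lemma degree_quad_le: "degree (quad L j) \<le> 2"
proof -
  have "degree (lin m * lin n) \<le> 2" for m n
    using degree_mult_le[of "lin m" "lin n"] unfolding lin_def
    by (rule order_trans) (auto simp: degree_pCons_le)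
  then show ?thesis unfolding quad_def by (intro degree_diff_le)
qed

text \<open>The size is governed by two values of \<open>D\<close> as soon as the complete quotients
  are well separated, which \<open>t_diff\<close> provides where the periodicity breaks.\<close>

lemma eval_quad: "eval_int_poly (quad L j) x = D (Suc j) * D (Suc (j + L)) * (t (Suc (j + L)) - t (Suc j))"
proof -
  have "eval_int_poly (quad L j) x = D j * D (Suc (j + L)) - D (Suc j) * D (j + L)"
    by (simp add: quad_def eval_int_poly_diff eval_int_poly_mult eval_lin)
  then show ?thesis unfolding D_ratio[of j] D_ratio[of "j + L"] by (simp add: algebra_simps)
qed

text \<open>The fractional contributions 1/t lie between 1/C and 1, so they cannot compensate a
  difference of at least 1 between the digits.\<close>

lemma t_diff:
  assumes "s m \<noteq> s n"
  shows "1 / C \<le> \<bar>t m - t n\<bar>" "\<bar>t m - t n\<bar> \<le> C"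
proof -
  show "\<bar>t m - t n\<bar> \<le> C" using t_bounds[of m] t_bounds[of n] by linarith
  have *: "1 / C \<le> t m - t n" if "s n < s m" for m n
  proof -
    have "real_of_int (s n) + 1 \<le> of_int (s m)" using that by linarith
    then show ?thesis using t_rec[of m] t_rec[of n] inverse_t[of "Suc m"] inverse_t[of "Suc n"] by linarith
  qed
  show "1 / C \<le> \<bar>t m - t n\<bar>"
    using *[of n m] *[of m n] assms by (cases "s n < s m") auto
qed

lemma abs_eval_quad_bounds:
  assumes "s (Suc j) \<noteq> s (Suc (j + L))"
  shows "1 / (C ^ 3 * (q (Suc j) * q (Suc (j + L)))) \<le> \<bar>eval_int_poly (quad L j) x\<bar>"
    and "\<bar>eval_int_poly (quad L j) x\<bar> \<le> C / (q (Suc j) * q (Suc (j + L)))"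
proof -
  have e: "\<bar>eval_int_poly (quad L j) x\<bar> = \<bar>D (Suc j)\<bar> * \<bar>D (Suc (j + L))\<bar> * \<bar>t (Suc (j + L)) - t (Suc j)\<bar>"
    unfolding eval_quad by (simp add: abs_mult)
  have q1: "1 \<le> q (Suc j)" "1 \<le> q (Suc (j + L))" by (rule q_ge_1, simp)+
  have td: "1 / C \<le> \<bar>t (Suc (j + L)) - t (Suc j)\<bar>" "\<bar>t (Suc (j + L)) - t (Suc j)\<bar> \<le> C"
    using t_diff[of "Suc (j + L)" "Suc j"] assms by auto
  have "1 / (C * q (Suc j)) * (1 / (C * q (Suc (j + L)))) * (1 / C) \<le> \<bar>eval_int_poly (quad L j) x\<bar>"
    unfolding e using D_bounds[of "Suc j"] D_bounds[of "Suc (j + L)"] td C_ge q1 by (intro mult_mono) auto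
  then show "1 / (C ^ 3 * (q (Suc j) * q (Suc (j + L)))) \<le> \<bar>eval_int_poly (quad L j) x\<bar>"
    by (simp add: power3_eq_cube mult_ac del: qd.simps)
  have "\<bar>eval_int_poly (quad L j) x\<bar> \<le> 1 / q (Suc j) * (1 / q (Suc (j + L))) * C"
    unfolding e using D_bounds[of "Suc j"] D_bounds[of "Suc (j + L)"] td C_ge q1 by (intro mult_mono) auto
  then show "\<bar>eval_int_poly (quad L j) x\<bar> \<le> C / (q (Suc j) * q (Suc (j + L)))" by (simp del: qd.simps)
qed

lemma poly_height_quad_le:
  assumes "1 \<le> j"
  shows "of_int (poly_height (quad L j)) \<le> 4 * (q (Suc j) * q (Suc (j + L)))"
proof -
  define Q where "Q = qd s (Suc j) * qd s (Suc (j + L))"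
  have pq: "0 \<le> pd s n \<and> pd s n \<le> qd s n" if "1 \<le> n" for n
    using pd_bounds[of "n - 1"] that by simp
  have mono: "qd s m \<le> qd s (Suc m)" for m using q_le_Suc[of m] by simp
  have bnd: "0 \<le> a * b \<and> a * b \<le> Q" if "0 \<le> a" "a \<le> qd s (Suc j)" "0 \<le> b" "b \<le> qd s (Suc (j + L))" for a b
    unfolding Q_def using that qd_nonneg by (auto intro: mult_mono)
  have le: "0 \<le> qd s j" "qd s j \<le> qd s (Suc j)" "0 \<le> pd s j" "pd s j \<le> qd s (Suc j)"
    "0 \<le> qd s (Suc j)" "0 \<le> pd s (Suc j)" "pd s (Suc j) \<le> qd s (Suc j)"
    "0 \<le> qd s (j + L)" "qd s (j + L) \<le> qd s (Suc (j + L))" "0 \<le> pd s (j + L)" "pd s (j + L) \<le> qd s (Suc (j + L))"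
    "0 \<le> qd s (Suc (j + L))" "0 \<le> pd s (Suc (j + L))" "pd s (Suc (j + L)) \<le> qd s (Suc (j + L))"
    using pq[of j] pq[of "Suc j"] pq[of "j + L"] pq[of "Suc (j + L)"] mono[of j] mono[of "j + L"]
      qd_nonneg[of j] qd_nonneg[of "Suc j"] qd_nonneg[of "j + L"] qd_nonneg[of "Suc (j + L)"] assms
    by (auto simp del: pd.simps qd.simps)
  have "\<bar>coeff (quad L j) n\<bar> \<le> 4 * Q" for n
  proof -
    consider "n = 0" | "n = 1" | "n = 2" | "n > 2" by linarith
    then show ?thesis
    proof cases
      case 1
      show ?thesis unfolding 1 coeff_quad using bnd le by (smt (verit))
    next
      case 2
      show ?thesis unfolding 2 coeff_quad using bnd le by (smt (verit))
    next
      case 3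
      show ?thesis unfolding 3 coeff_quad using bnd le by (smt (verit))
    next
      case 4
      then have "coeff (quad L j) n = 0" using degree_quad_le[of L j] by (intro coeff_eq_0) simp
      then show ?thesis using bnd[of 0 0] qd_nonneg by simp
    qed
  qed
  then have "poly_height (quad L j) \<le> 4 * Q" by (simp add: poly_height_le_iff)
  then have "real_of_int (poly_height (quad L j)) \<le> of_int (4 * Q)" by (simp only: of_int_le_iff)
  then show ?thesis by (simp add: Q_def del: qd.simps)
qed

text \<open>Unfolding the recurrence once gives (s (j + L) - s j) a' b' + a' b - a b'. The last two
  terms lie in [0, a' b'] and are at least a' b'/C, so they cannot cancel a nonzero integer multiple
  of a' b'.\<close>

lemma lead_coeff_quad_ge:
  assumes "2 \<le> j" "1 \<le> L" "s j \<noteq> s (j + L)"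
  shows "q j * q (j + L) / C \<le> \<bar>of_int (coeff (quad L j) 2)\<bar>"
proof -
  obtain i where i: "j = Suc i" "1 \<le> i" using assms(1) by (cases j) auto
  define a b where "a = q i" and "b = q (i + L)"
  define a' b' where "a' = q j" and "b' = q (j + L)"
  have ab: "1 \<le> a" "1 \<le> b" "a \<le> a'" "b \<le> b'" "a' \<le> C * a" "b' \<le> C * b"
    using i q_ge_1[of i] q_ge_1[of "i + L"] q_le_Suc[of i] q_le_Suc[of "i + L"] q_Suc_le[of i] q_Suc_le[of "i + L"]
    by (simp_all add: a_def b_def a'_def b'_def del: qd.simps)
  define k where "k = real_of_int (s (j + L) - s j)"
  have "of_int (coeff (quad L j) 2) = k * (a' * b') + a' * b - a * b'"
    unfolding coeff_quad a_def b_def a'_def b'_def k_def i by (simp add: algebra_simps)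
  moreover have "a' * b' / C \<le> \<bar>k * (a' * b') + a' * b - a * b'\<bar>"
  proof -
    have p: "0 < a' * b'" "a * b' \<le> a' * b'" "a' * b \<le> a' * b'" using ab by (auto intro: mult_mono)
    have c: "a' * b' / C \<le> a' * b" "a' * b' / C \<le> a * b'"
      using ab C_ge by (auto simp: field_simps)
    consider "k \<ge> 1" | "k \<le> - 1" using assms(3) unfolding k_def by linarith
    then show ?thesis
    proof cases
      case 1
      then have "1 * (a' * b') \<le> k * (a' * b')" using p by (intro mult_right_mono) auto
      then show ?thesis using p c by linarith
    next
      case 2
      then have "k * (a' * b') \<le> - 1 * (a' * b')" using p by (intro mult_right_mono) auto
      then show ?thesis using p c by linarith
    qed
  qed
  ultimately show ?thesis by (simp add: a'_def b'_def)
qed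

text \<open>By the product rule E is a sum of four products of one \<open>D\<close> and one
  \<open>q\<close>. The two pairing the larger \<open>q\<close> with the earlier \<open>D\<close>
  form the main part; each of the others is at most 1 in absolute value.\<close>

lemma deriv_quad_bounds:
  fixes j L :: nat
  defines "E \<equiv> 2 * of_int (coeff (quad L j) 2) * x + of_int (coeff (quad L j) 1)"
  assumes "1 \<le> j" "1 \<le> L"
  shows "q (Suc (j + L)) / (C * q (Suc j)) - 2 \<le> \<bar>E\<bar>" "\<bar>E\<bar> \<le> C * (q (Suc (j + L)) / q (Suc j)) + 2"
proof -
  define m where "m = D j * q (Suc (j + L)) - D (Suc j) * q (j + L)"
  define r where "r = q j * D (Suc (j + L)) - q (Suc j) * D (j + L)"
  have E: "E = m + r" unfolding E_def m_def r_def coeff_quad D_def by (simp add: algebra_simps)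
  have q1: "1 \<le> q j" "1 \<le> q (Suc j)" "1 \<le> q (j + L)" "1 \<le> q (Suc (j + L))"
    by (rule q_ge_1, use assms in simp)+
  have le: "q j \<le> q (j + L)" "q (Suc j) \<le> q (j + L)" "q (j + L) \<le> q (Suc (j + L))" "q j \<le> q (Suc (j + L))"
    by (rule q_mono, use assms in simp)+
  have r2: "\<bar>r\<bar> \<le> 2"
  proof -
    have "\<bar>q j * D (Suc (j + L))\<bar> \<le> 1"
    proof -
      have "\<bar>q j * D (Suc (j + L))\<bar> \<le> q (Suc (j + L)) * (1 / q (Suc (j + L)))"
        unfolding abs_mult using D_bounds(2)[of "Suc (j + L)"] le q1 by (intro mult_mono) auto
      then show ?thesis using q1 by (simp del: qd.simps)
    qed
    moreover have "\<bar>q (Suc j) * D (j + L)\<bar> \<le> 1"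
    proof -
      have "\<bar>q (Suc j) * D (j + L)\<bar> \<le> q (j + L) * (1 / q (j + L))"
        unfolding abs_mult using D_bounds(2)[of "j + L"] le q1 assms by (intro mult_mono) (auto simp del: qd.simps)
      then show ?thesis using q1 by (simp del: qd.simps)
    qed
    ultimately show ?thesis unfolding r_def by linarith
  qed
  have m: "m = - (D (Suc j) * (t (Suc j) * q (Suc (j + L)) + q (j + L)))"
    unfolding m_def D_ratio[of j] by (simp add: algebra_simps)
  define y where "y = t (Suc j) * q (Suc (j + L)) + q (j + L)"
  have "1 * q (Suc (j + L)) \<le> t (Suc j) * q (Suc (j + L))" "t (Suc j) * q (Suc (j + L)) \<le> (C - 1) * q (Suc (j + L))"
    using t_bounds[of "Suc j"] q1 by (auto intro: mult_right_mono)
  then have y: "q (Suc (j + L)) \<le> y" "y \<le> C * q (Suc (j + L))"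
    unfolding y_def left_diff_distrib mult_1_left using le q1 by linarith+
  have y0: "0 \<le> y" using y q1 by linarith
  have my: "\<bar>m\<bar> = \<bar>D (Suc j)\<bar> * y"
    using y0 unfolding m y_def[symmetric] by (simp add: abs_mult)
  have "1 / (C * q (Suc j)) * q (Suc (j + L)) \<le> \<bar>m\<bar>"
    unfolding my using D_bounds(1)[of "Suc j"] y q1 by (intro mult_mono) auto
  moreover have "\<bar>m\<bar> \<le> 1 / q (Suc j) * (C * q (Suc (j + L)))"
    unfolding my using D_bounds(2)[of "Suc j"] y y0 q1 by (intro mult_mono) auto
  ultimately show "q (Suc (j + L)) / (C * q (Suc j)) - 2 \<le> \<bar>E\<bar>" "\<bar>E\<bar> \<le> C * (q (Suc (j + L)) / q (Suc j)) + 2"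
    using r2 unfolding E by (auto simp del: qd.simps)
qed

end

section \<open>Content of the quadratics and growth of the denominators\<close>

context bounded_cfrac
begin

text \<open>\<open>quad L j\<close> is a binary quadratic form in lin j and lin (j + 1), which are
  related to X and 1 by a matrix of determinant \<plusminus>1. So the content divides the outer
  coefficients z and y of this form, hence z - y = (c - a) pd_L, with pd_L the continuant of the
  constant digit a. The determinant identity for that constant sequence removes the factor
  pd_L.\<close>

lemma content_quad_dvd:
  assumes L: "1 \<le> L" and digits: "\<And>m. 1 \<le> m \<Longrightarrow> m < L \<Longrightarrow> s (j + m) = a" and last: "s (j + L) = c"
  shows "content (quad L j) dvd c - a"
proof -
  let ?a = "\<lambda>_. a"
  have lin: "lin (j + m) = smult (qd ?a m) (lin (Suc j)) + smult (pd ?a m) (lin j)" if "m \<le> L" for m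
    using that
  proof (induction m rule: induct_nat_012)
    case (ge2 n)
    have "lin (j + Suc (Suc n)) = smult (s (j + Suc n)) (lin (j + Suc n)) + lin (j + n)"
      using lin_rec[of "j + n"] by simp
    also have "s (j + Suc n) = a" using ge2 by (intro digits) auto
    finally show ?case using ge2 by (simp add: algebra_simps smult_add_left smult_add_right)
  qed auto
  obtain L' where L': "L = Suc L'" using L by (cases L) auto
  define e where "e = c - a"
  define z y m where "z = pd ?a (Suc L) + e * pd ?a L" and "y = qd ?a L"
    and "m = qd ?a (Suc L) + e * qd ?a L - pd ?a L"
  have "lin (Suc (j + L)) = smult c (lin (j + L)) + lin (j + L')"
    using lin_rec[of "j + L'"] last by (simp add: L')
  also have "\<dots> = smult a (lin (j + L)) + lin (j + L') + smult e (lin (j + L))"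
    by (simp add: e_def algebra_simps smult_diff_left)
  also have "smult a (lin (j + L)) + lin (j + L')
      = smult (qd ?a (Suc L)) (lin (Suc j)) + smult (pd ?a (Suc L)) (lin j)"
    using lin[of L] lin[of L'] by (simp add: L' algebra_simps smult_add_left smult_add_right)
  finally have l2: "lin (Suc (j + L)) = smult (m + pd ?a L) (lin (Suc j)) + smult z (lin j)"
    using lin[of L] by (simp add: z_def m_def algebra_simps smult_add_left smult_add_right)
  have quad: "quad L j = smult z (lin j * lin j) + smult m (lin j * lin (Suc j)) - smult y (lin (Suc j) * lin (Suc j))"
    unfolding quad_def l2 lin[OF order_refl] y_def
    by (simp add: algebra_simps smult_add_left)
  define p p' u u' where "p = pd s j" and "p' = pd s (Suc j)" and "u = qd s j" and "u' = qd s (Suc j)"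
  define A2 A1 A0 where "A2 = coeff (quad L j) 2" and "A1 = coeff (quad L j) 1" and "A0 = coeff (quad L j) 0"
  have A: "A2 = z * u\<^sup>2 + m * u * u' - y * u'\<^sup>2"
    "A1 = - (2 * z * u * p + m * (u * p' + p * u') - 2 * y * u' * p')"
    "A0 = z * p\<^sup>2 + m * p * p' - y * p'\<^sup>2"
    unfolding A2_def A1_def A0_def quad lin_def p_def p'_def u_def u'_def
    by (simp_all add: numeral_2_eq_2 algebra_simps del: pd.simps qd.simps)
  have "(u' * p - u * p')\<^sup>2 = 1"
    using continuant_det[of s j] unfolding p_def p'_def u_def u'_def by (simp flip: power_mult add: mult.commute)
  then have det: "(u * p' - p * u')\<^sup>2 = 1" by (simp add: power2_eq_square algebra_simps)
  \<comment> \<open>The homogenised quadratic is evaluated at (p', u'), where lin (j + 1) vanishes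
    and only z times the square of lin j survives; below, (p, u) isolates y in the same way.\<close>
  have "A2 * p'\<^sup>2 + A1 * (p' * u') + A0 * u'\<^sup>2 = z * (u * p' - p * u')\<^sup>2"
    unfolding A by (simp add: power2_eq_square algebra_simps)
  then have z: "z = A2 * p'\<^sup>2 + A1 * (p' * u') + A0 * u'\<^sup>2" using det by simp
  have "A2 * p\<^sup>2 + A1 * (p * u) + A0 * u\<^sup>2 = - y * (u * p' - p * u')\<^sup>2"
    unfolding A by (simp add: power2_eq_square algebra_simps)
  then have y: "- y = A2 * p\<^sup>2 + A1 * (p * u) + A0 * u\<^sup>2" using det by simp
  define g where "g = content (quad L j)"
  have gA: "g dvd A2" "g dvd A1" "g dvd A0" by (simp_all add: g_def A2_def A1_def A0_def)
  have gz: "g dvd z" unfolding z using gA by (intro dvd_add dvd_mult2)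
  have "g dvd - y" unfolding y using gA by (intro dvd_add dvd_mult2)
  then have gy: "g dvd y" by simp
  have pd_Suc: "pd ?a (Suc n) = qd ?a n" for n
    by (induction n rule: induct_nat_012) auto
  have "z = y + e * pd ?a L" by (simp add: z_def y_def pd_Suc)
  then have ge: "g dvd e * pd ?a L" using gz gy by (simp add: dvd_add_right_iff)
  have "e * (- 1) ^ L = e * (qd ?a (Suc L) * pd ?a L - qd ?a L * pd ?a (Suc L))"
    by (simp only: continuant_det)
  also have "\<dots> = e * pd ?a L * qd ?a (Suc L) - y * (e * pd ?a (Suc L))"
    by (simp add: y_def algebra_simps del: pd.simps qd.simps)
  also have "g dvd \<dots>" by (intro dvd_diff dvd_mult2[OF ge] dvd_mult2[OF gy])
  finally have "g dvd e * (- 1) ^ L" .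
  then have "g dvd e" by (cases "even L") auto
  then show ?thesis by (simp add: g_def e_def)
qed

text \<open>\<open>q (n + 1) + q n / M\<close> is multiplied by exactly \<open>M\<close> at each digit \<open>a\<close>.\<close>

lemma ln_q_approx:
  fixes a :: int
  assumes "1 \<le> a"
  defines "M \<equiv> (of_int a + sqrt ((of_int a)\<^sup>2 + 4)) / 2"
  shows "1 < M"
    and "\<bar>ln (q (Suc n)) - real n * ln M\<bar> \<le> real (card {i \<in> {1..n}. s i \<noteq> a}) * ln (C + M) + ln 2"
proof -
  define r where "r = sqrt ((of_int a)\<^sup>2 + 4 :: real)"
  have a1: "1 \<le> real_of_int a" using assms by simp
  have "(2::real)\<^sup>2 \<le> (of_int a)\<^sup>2 + 4" by simp
  then have r2: "2 \<le> r" unfolding r_def by (rule real_le_rsqrt)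
  have rr: "r * r = (of_int a)\<^sup>2 + 4" unfolding r_def by simp
  have Mr: "M = (of_int a + r) / 2" by (simp add: M_def r_def)
  show M1: "1 < M" using a1 r2 by (simp add: Mr)
  have M2: "M * M = of_int a * M + 1"
    using rr unfolding Mr by (simp add: field_simps power2_eq_square)
  have aM: "of_int a + 1 / M = M" using M2 M1 by (simp add: field_simps)
  define V where "V = (\<lambda>n. q (Suc n) + q n / M)"
  have qV: "q (Suc n) \<le> V n" "V n \<le> 2 * q (Suc n)" for n
  proof -
    have "0 \<le> q n / M" using q_nonneg[of n] M1 by simp
    then show "q (Suc n) \<le> V n" by (simp add: V_def)
    have "q n / M \<le> q n / 1" using q_nonneg[of n] M1 by (intro divide_left_mono) auto
    then show "V n \<le> 2 * q (Suc n)" using q_le_Suc[of n] by (simp add: V_def del: qd.simps)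
  qed
  have q1: "1 \<le> q (Suc n)" for n by (rule q_ge_1) simp
  have V1: "1 \<le> V n" for n using qV(1)[of n] q1[of n] by linarith
  define K where "K = ln (C + M)"
  have MK: "0 < ln M" "ln M \<le> K" using M1 C_ge by (auto simp: K_def)
  \<comment> \<open>Each digit different from a increases ln V by an amount between 0 and K. As ln M
    lies in the same range, it adds at most K to the deviation.\<close>
  have V: "\<bar>ln (V n) - real n * ln M\<bar> \<le> real (card {i \<in> {1..n}. s i \<noteq> a}) * K" for n
  proof (induction n)
    case 0
    then show ?case by (simp add: V_def)
  next
    case (Suc n)
    have S: "{i \<in> {1..Suc n}. s i \<noteq> a} = (if s (Suc n) = a then {i \<in> {1..n}. s i \<noteq> a}
        else insert (Suc n) {i \<in> {1..n}. s i \<noteq> a})"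
      by (auto simp: le_Suc_eq)
    have VS: "V (Suc n) = (of_int (s (Suc n)) + 1 / M) * q (Suc n) + q n"
      by (simp add: V_def algebra_simps)
    show ?case
    proof (cases "s (Suc n) = a")
      case True
      have "V (Suc n) = M * V n"
        unfolding VS using True aM M1 by (simp add: V_def algebra_simps del: qd.simps)
      then have "ln (V (Suc n)) = ln M + ln (V n)" using M1 V1[of n] by (simp add: ln_mult)
      then show ?thesis using Suc True unfolding S by (simp add: algebra_simps)
    next
      case False
      have up: "V (Suc n) \<le> (C + M) * V n"
      proof -
        have 1: "1 / M \<le> 1" using M1 by simp
        have "real_of_int (s (Suc n)) \<le> of_int B" using digit_le by simp
        then have "of_int (s (Suc n)) + 1 / M \<le> C" using 1 by (simp add: C_def)
        then have "(of_int (s (Suc n)) + 1 / M) * q (Suc n) \<le> C * q (Suc n)"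
          using q_nonneg[of "Suc n"] by (intro mult_right_mono)
        moreover have "C * q (Suc n) \<le> C * V n" using qV(1)[of n] C_ge by (intro mult_left_mono) auto
        moreover have "q n \<le> M * V n"
          using M1 q_nonneg[of "Suc n"] by (simp add: V_def algebra_simps del: qd.simps)
        ultimately show ?thesis unfolding VS distrib_right by linarith
      qed
      have low: "V n \<le> V (Suc n)"
      proof -
        have 1: "1 \<le> real_of_int (s (Suc n))" using digit_ge_1 by simp
        have "0 < 1 / M" using M1 by simp
        then have "1 \<le> of_int (s (Suc n)) + 1 / M" using 1 by linarith
        then have "1 * q (Suc n) \<le> (of_int (s (Suc n)) + 1 / M) * q (Suc n)"
          using q_nonneg[of "Suc n"] by (rule mult_right_mono)
        moreover have "q n / M \<le> q n / 1" using q_nonneg[of n] M1 by (intro divide_left_mono) auto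
        ultimately show ?thesis unfolding VS unfolding V_def by linarith
      qed
      have "ln (V (Suc n)) \<le> ln ((C + M) * V n)" "ln (V n) \<le> ln (V (Suc n))"
        using up low V1[of n] V1[of "Suc n"] M1 C_ge by (subst ln_le_cancel_iff; auto)+
      moreover have "ln ((C + M) * V n) = K + ln (V n)"
        unfolding K_def using V1[of n] M1 C_ge by (subst ln_mult) auto
      moreover have "real (card {i \<in> {1..Suc n}. s i \<noteq> a}) = real (card {i \<in> {1..n}. s i \<noteq> a}) + 1"
        unfolding S using False by simp
      ultimately show ?thesis using Suc MK by (simp add: algebra_simps)
    qed
  qed
  have "ln (q (Suc n)) \<le> ln (V n)" "ln (V n) \<le> ln (2 * q (Suc n))"
    using qV[of n] q1[of n] by (subst ln_le_cancel_iff; simp del: qd.simps)+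
  moreover have "ln (2 * q (Suc n)) = ln 2 + ln (q (Suc n))" using q1[of n] by (subst ln_mult) (auto simp del: qd.simps)
  ultimately show "\<bar>ln (q (Suc n)) - real n * ln M\<bar> \<le> real (card {i \<in> {1..n}. s i \<noteq> a}) * ln (C + M) + ln 2"
    using V[of n] unfolding K_def by linarith
qed

end

section \<open>The digit sequence\<close>

text \<open>Constant factors disappear once logarithms are divided by a quantity tending to
  infinity, so bounds up to constants already determine the limit.\<close>

lemma tendsto_ln_sandwich:
  fixes f g h Y :: "nat \<Rightarrow> real"
  assumes Y: "filterlim Y at_top sequentially" and c: "0 < c" "0 < c'"
    and f0: "eventually (\<lambda>i. 0 < f i) sequentially"
    and fg: "eventually (\<lambda>i. c * f i \<le> g i) sequentially" and gh: "eventually (\<lambda>i. g i \<le> c' * h i) sequentially"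
    and f: "(\<lambda>i. ln (f i) / Y i) \<longlonglongrightarrow> l" and h: "(\<lambda>i. ln (h i) / Y i) \<longlonglongrightarrow> l"
  shows "(\<lambda>i. ln (g i) / Y i) \<longlonglongrightarrow> l"
proof (rule tendsto_sandwich)
  have c0: "(\<lambda>i. e / Y i) \<longlonglongrightarrow> 0" for e
    by (rule tendsto_divide_0[OF tendsto_const]) (rule filterlim_at_top_imp_at_infinity[OF Y])
  have Y0: "eventually (\<lambda>i. 0 < Y i) sequentially" using Y by (simp add: filterlim_at_top_dense)
  show "(\<lambda>i. ln c / Y i + ln (f i) / Y i) \<longlonglongrightarrow> l" using tendsto_add[OF c0 f] by simp
  show "(\<lambda>i. ln c' / Y i + ln (h i) / Y i) \<longlonglongrightarrow> l" using tendsto_add[OF c0 h] by simp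
  show "eventually (\<lambda>i. ln c / Y i + ln (f i) / Y i \<le> ln (g i) / Y i) sequentially"
    using f0 fg Y0
  proof eventually_elim
    case (elim i)
    then have cf: "0 < c * f i" using c by simp
    then have "ln (c * f i) \<le> ln (g i)" using elim by (subst ln_le_cancel_iff) auto
    moreover have "ln (c * f i) = ln c + ln (f i)" using c elim by (simp add: ln_mult)
    ultimately show ?case using elim by (simp add: divide_right_mono flip: add_divide_distrib)
  qed
  show "eventually (\<lambda>i. ln (g i) / Y i \<le> ln c' / Y i + ln (h i) / Y i) sequentially"
    using f0 fg gh Y0
  proof eventually_elim
    case (elim i)
    then have cf: "0 < c * f i" using c by simp
    then have h0: "0 < c' * h i" using elim by linarith
    then have "0 < h i" using c by (simp add: zero_less_mult_iff)
    have "ln (g i) \<le> ln (c' * h i)" using elim cf h0 by (subst ln_le_cancel_iff) auto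
    moreover have "ln (c' * h i) = ln c' + ln (h i)" using c \<open>0 < h i\<close> by (simp add: ln_mult)
    ultimately show ?case using elim by (simp add: divide_right_mono flip: add_divide_distrib)
  qed
qed

text \<open>The conditions involving d enter here only through weak consequences; \<eta> \<le> w/4
  ensures that two full periods fit into each block.\<close>

locale sparse_digits =
  fixes a b c :: int and w \<eta> :: real
  assumes abc: "0 < a" "0 < b" "0 < c" "a \<noteq> b" "a \<noteq> c" "b \<noteq> c"
    and w_ge: "484 \<le> w" and eta_pos: "0 < \<eta>" and eta_le: "\<eta> \<le> w / 4"
begin

abbreviation s :: "nat \<Rightarrow> int" where "s \<equiv> cf_digit a b c w \<eta>"

sublocale bounded_cfrac s "max a (max b c)"
  using abc by unfold_locales (auto simp: cf_digit_def)

section \<open>Positions of the digits\<close>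

definition k :: "nat \<Rightarrow> nat" where "k i = nat \<lfloor>w ^ i\<rfloor>"

definition L :: "nat \<Rightarrow> nat" where "L i = nat \<lfloor>\<eta> * w ^ i\<rfloor>"

lemma w_pow_ge_1: "1 \<le> w ^ i"
  using w_ge by (intro one_le_power) simp

lemma int_k: "int (k i) = \<lfloor>w ^ i\<rfloor>"
  using w_pow_ge_1[of i] by (simp add: k_def)

lemma int_L: "int (L i) = \<lfloor>\<eta> * w ^ i\<rfloor>"
  using w_pow_ge_1[of i] eta_pos by (simp add: L_def)

lemma k_bounds: "w ^ i - 1 < real (k i)" "real (k i) \<le> w ^ i"
  using int_k[of i] by linarith+

lemma L_bounds: "\<eta> * w ^ i - 1 < real (L i)" "real (L i) \<le> \<eta> * w ^ i"
  using int_L[of i] by linarith+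

lemma k_pos: "1 \<le> k i"
  using int_k[of i] w_pow_ge_1[of i] by (metis le_floor_iff of_int_1 of_nat_1 of_nat_le_iff)

lemma k_less: "k i + 2 < k (Suc i)"
proof -
  have "484 * w ^ i \<le> w * w ^ i" using w_ge w_pow_ge_1[of i] by (intro mult_right_mono) auto
  then have "real (k i) + 2 < real (k (Suc i))"
    using k_bounds[of i] k_bounds[of "Suc i"] w_pow_ge_1[of i] unfolding power_Suc by linarith
  then show ?thesis by linarith
qed

lemma k_mono: "i \<le> j \<Longrightarrow> k i \<le> k j"
proof (erule lift_Suc_mono_le[rotated])
  show "k n \<le> k (Suc n)" for n using k_less[of n] by linarith
qed

text \<open>The numerator in \<open>block_count\<close> equals k (j + 1) - k j + 1, so a progression
  may overshoot its block by one position. This is the reason for the offset 2 in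
  \<open>digit_a\<close> and \<open>digit_periodic\<close>.\<close>

lemma block_count_le:
  assumes "m \<le> block_count w \<eta> j"
  shows "m * int (L j) \<le> int (k (Suc j)) - int (k j) + 1"
proof (cases "L j = 0")
  case True
  then show ?thesis using k_less[of j] by simp
next
  case False
  have e: "\<lfloor>w ^ j - 1\<rfloor> = int (k j) - 1" using int_k[of j] by simp
  have "real_of_int m \<le> of_int (\<lfloor>w ^ (j + 1)\<rfloor> - \<lfloor>w ^ j - 1\<rfloor>) / of_int \<lfloor>\<eta> * w ^ j\<rfloor>"
    using assms unfolding block_count_def by (simp only: le_floor_iff)
  also have "\<dots> = of_int (int (k (Suc j)) - int (k j) + 1) / real (L j)"
    unfolding e int_L[symmetric] int_k[symmetric] Suc_eq_plus1[symmetric] by simp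
  finally have "real_of_int (m * int (L j)) \<le> of_int (int (k (Suc j)) - int (k j) + 1)"
    using False by (simp add: pos_le_divide_eq)
  then show ?thesis by (simp only: of_int_le_iff)
qed

lemma block_count_ge:
  assumes "1 \<le> L j" "m * int (L j) \<le> int (k (Suc j)) - int (k j) + 1"
  shows "m \<le> block_count w \<eta> j"
proof -
  have e: "\<lfloor>w ^ j - 1\<rfloor> = int (k j) - 1" using int_k[of j] by simp
  have "real_of_int (m * int (L j)) \<le> of_int (int (k (Suc j)) - int (k j) + 1)"
    using assms(2) by (simp only: of_int_le_iff)
  then have "real_of_int m \<le> of_int (int (k (Suc j)) - int (k j) + 1) / real (L j)"
    using assms(1) by (simp add: pos_le_divide_eq)
  also have "\<dots> = of_int (\<lfloor>w ^ (j + 1)\<rfloor> - \<lfloor>w ^ j - 1\<rfloor>) / of_int \<lfloor>\<eta> * w ^ j\<rfloor>"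
    unfolding e int_L[symmetric] int_k[symmetric] Suc_eq_plus1[symmetric] by simp
  finally show ?thesis unfolding block_count_def by (simp only: le_floor_iff)
qed

lemma digit_altdef:
  "s n = (if \<exists>i. n = k i then b
    else if \<exists>j m. 1 \<le> j \<and> 1 \<le> m \<and> m \<le> block_count w \<eta> j \<and> int n = int (k j) + m * int (L j) then c else a)"
  unfolding cf_digit_def int_k[symmetric] int_L[symmetric] by simp

lemma digit_k: "s (k i) = b"
  unfolding digit_altdef by auto

lemma not_k:
  assumes "k i < n" "n < k (Suc i)"
  shows "n \<noteq> k j"
  using assms k_mono[of j i] k_mono[of "Suc i" j] by (cases "j \<le> i") auto

lemma digit_c:
  assumes "1 \<le> i" "k i < n" "n < k (Suc i)" "L i dvd n - k i" "1 \<le> L i"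
  shows "s n = c"
proof -
  obtain m where m: "n - k i = L i * m" using assms(4) by (elim dvdE)
  then have n: "n = k i + m * L i" using assms(2) by (simp add: mult.commute)
  have "1 \<le> m" using n assms(2) by (cases m) auto
  moreover have "int m \<le> block_count w \<eta> i"
  proof (rule block_count_ge[OF assms(5)])
    have "m * L i + k i < k (Suc i)" using n assms(3) by simp
    then have "int (m * L i + k i) < int (k (Suc i))" by (simp only: of_nat_less_iff)
    then show "int m * int (L i) \<le> int (k (Suc i)) - int (k i) + 1" by simp
  qed
  ultimately have "1 \<le> i \<and> 1 \<le> int m \<and> int m \<le> block_count w \<eta> i \<and> int n = int (k i) + int m * int (L i)"
    using assms(1) n by simp
  then show ?thesis unfolding digit_altdef using not_k[OF assms(2,3)] by (smt (verit))
qed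

text \<open>Progressions of earlier blocks end at k i + 1 at the latest and those of later blocks
  start beyond the range, so that only the progression of block i itself has to be excluded.\<close>

lemma digit_a:
  assumes "k i + 2 \<le> n" "n < k (Suc i)" "\<not> L i dvd n - k i"
  shows "s n = a"
proof -
  have "\<not> (1 \<le> m \<and> m \<le> block_count w \<eta> j \<and> int n = int (k j) + m * int (L j))" for j m
  proof
    assume *: "1 \<le> m \<and> m \<le> block_count w \<eta> j \<and> int n = int (k j) + m * int (L j)"
    consider "j < i" | "j = i" | "i < j" by linarith
    then show False
    proof cases
      case 1
      then have "k (Suc j) \<le> k i" by (intro k_mono) simp
      then show False using block_count_le[of m j] * assms(1) by linarith
    next
      case 2
      then have "int (n - k i) = m * int (L i)" using * assms(1) by simp
      then have "int (L i) dvd int (n - k i)" by simp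
      then show False using assms(3) by (simp only: int_dvd_int_iff)
    next
      case 3
      then have "k (Suc i) \<le> k j" by (intro k_mono) simp
      moreover have "0 \<le> m * int (L j)" using * by simp
      ultimately show False using * assms(2) by linarith
    qed
  qed
  moreover have "n \<noteq> k j" for j using not_k[of i n j] assms by simp
  ultimately show ?thesis unfolding digit_altdef by meson
qed

lemma digit_periodic:
  assumes "1 \<le> i" "1 \<le> L i" "k i + 2 \<le> n" "n + L i < k (Suc i)"
  shows "s n = s (n + L i)"
proof -
  have "n + L i - k i = (n - k i) + L i" using assms(3) by simp
  then have "L i dvd n + L i - k i \<longleftrightarrow> L i dvd n - k i" by simp
  then show ?thesis
    using assms digit_c[of i n] digit_c[of i "n + L i"] digit_a[of i n] digit_a[of i "n + L i"]
    by (cases "L i dvd n - k i") auto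
qed

lemma digit_before_k:
  assumes "k i + 2 \<le> n" "n < k (Suc i)"
  shows "s n \<noteq> b"
  using not_k[of i n] assms abc unfolding digit_altdef by auto

lemma block_count_bounded: "of_int (block_count w \<eta> j) \<le> 4 * w / \<eta>"
proof (cases "L j = 0")
  case True
  then have "\<lfloor>\<eta> * w ^ j\<rfloor> = 0" using int_L[of j] by simp
  then have "block_count w \<eta> j = 0" by (simp add: block_count_def)
  then show ?thesis using w_ge eta_pos by simp
next
  case False
  then have L1: "1 \<le> real (L j)" by simp
  have "of_int (block_count w \<eta> j) * real (L j) = of_int (block_count w \<eta> j * int (L j))" by simp
  also have "\<dots> \<le> of_int (int (k (Suc j)) - int (k j) + 1)"
    using block_count_le[OF order_refl, of j] by (simp only: of_int_le_iff)
  also have "\<dots> \<le> w * w ^ j" using k_bounds(2)[of "Suc j"] k_pos[of j] by simp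
  also have "w * w ^ j = w / \<eta> * (\<eta> * w ^ j)" using eta_pos by simp
  \<comment> \<open>Since \<eta> w^j < L j + 1 and L j \<ge> 1, the floor loses at most a factor
    2.\<close>
  also have "\<dots> \<le> w / \<eta> * (2 * real (L j))"
    using L_bounds(1)[of j] L1 w_ge eta_pos by (intro mult_left_mono) auto
  finally have "of_int (block_count w \<eta> j) * real (L j) \<le> 2 * w / \<eta> * real (L j)" by (simp add: mult_ac)
  then have "of_int (block_count w \<eta> j) \<le> 2 * w / \<eta>" by (rule mult_right_le_imp_le) (use L1 in linarith)
  also have "\<dots> \<le> 4 * w / \<eta>" using w_ge eta_pos by (intro divide_right_mono) auto
  finally show ?thesis .
qed

text \<open>At most i + 2 blocks meet the range, each contributing one b and boundedly many c. The
  count is linear in i, hence negligible against w^i.\<close>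

lemma card_non_a_le:
  assumes "real n \<le> w ^ Suc i + 1"
  shows "real (card {m \<in> {1..n}. s m \<noteq> a}) \<le> (1 + 4 * w / \<eta>) * (real i + 2)"
proof -
  define T where "T = (\<lambda>j. (\<lambda>m. nat (int (k j) + m * int (L j))) ` {1..block_count w \<eta> j})"
  have kn: "n < k (Suc (Suc i))"
  proof -
    have "484 * w ^ Suc i \<le> w * w ^ Suc i" using w_ge w_pow_ge_1[of "Suc i"] by (intro mult_right_mono) auto
    then have "real n < real (k (Suc (Suc i)))"
      using assms k_bounds(1)[of "Suc (Suc i)"] w_pow_ge_1[of "Suc i"] unfolding power_Suc[of w "Suc i"]
      by linarith
    then show ?thesis by simp
  qed
  have sub: "{m \<in> {1..n}. s m \<noteq> a} \<subseteq> k ` {..Suc i} \<union> (\<Union>j\<in>{..Suc i}. T j)"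
  proof
    fix m assume m: "m \<in> {m \<in> {1..n}. s m \<noteq> a}"
    then have mk: "m < k (Suc (Suc i))" using kn by simp
    have ji: "j \<le> Suc i" if "k j \<le> m" for j
    proof (rule ccontr)
      assume "\<not> ?thesis"
      then have "k (Suc (Suc i)) \<le> k j" by (intro k_mono) simp
      then show False using that mk by simp
    qed
    show "m \<in> k ` {..Suc i} \<union> (\<Union>j\<in>{..Suc i}. T j)"
    proof (cases "\<exists>j. m = k j")
      case True
      then show ?thesis using ji by auto
    next
      case False
      have "s m \<noteq> a" using m by simp
      then obtain j z where jz: "1 \<le> z" "z \<le> block_count w \<eta> j" "int m = int (k j) + z * int (L j)"
        using False unfolding digit_altdef[of m] by (auto split: if_splits)
      have "0 \<le> z * int (L j)" using jz(1) by simp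
      then have "j \<le> Suc i" using jz(3) by (intro ji) linarith
      moreover have "m \<in> T j" unfolding T_def using jz by (intro image_eqI[of _ _ z]) (auto simp flip: jz(3))
      ultimately show ?thesis by blast
    qed
  qed
  have finT: "finite (T j)" for j by (simp add: T_def)
  have cardT: "real (card (T j)) \<le> 4 * w / \<eta>" for j
  proof -
    have "card (T j) \<le> card {1..block_count w \<eta> j}" unfolding T_def by (rule card_image_le) simp
    then have "real (card (T j)) \<le> real (nat (block_count w \<eta> j))" by simp
    also have "\<dots> \<le> 4 * w / \<eta>" using block_count_bounded[of j] w_ge eta_pos by (cases "0 \<le> block_count w \<eta> j") auto
    finally show ?thesis .
  qed
  have "card {m \<in> {1..n}. s m \<noteq> a} \<le> card (k ` {..Suc i} \<union> (\<Union>j\<in>{..Suc i}. T j))"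
    using finT by (intro card_mono sub) auto
  also have "\<dots> \<le> card (k ` {..Suc i}) + card (\<Union>j\<in>{..Suc i}. T j)" by (rule card_Un_le)
  also have "\<dots> \<le> card {..Suc i} + (\<Sum>j\<in>{..Suc i}. card (T j))"
    by (intro add_mono card_image_le card_UN_le) auto
  finally have "real (card {m \<in> {1..n}. s m \<noteq> a}) \<le> real (card {..Suc i} + (\<Sum>j\<in>{..Suc i}. card (T j)))"
    by (simp only: of_nat_le_iff)
  also have "\<dots> = real (card {..Suc i}) + (\<Sum>j\<in>{..Suc i}. real (card (T j)))" by simp
  also have "\<dots> \<le> real (card {..Suc i}) + real (card {..Suc i}) * (4 * w / \<eta>)"
    using sum_bounded_above[of "{..Suc i}" "\<lambda>j. real (card (T j))" "4 * w / \<eta>"] cardT by simp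
  also have "\<dots> = (1 + 4 * w / \<eta>) * (real i + 2)" by (simp add: algebra_simps)
  finally show ?thesis .
qed

section \<open>Growth of the denominators along the digit sequence\<close>

definition M :: real where "M = (of_int a + sqrt ((of_int a)\<^sup>2 + 4)) / 2"

definition Y :: "nat \<Rightarrow> real" where "Y i = ln M * w ^ i"

lemma M_gt_1: "1 < M"
  using ln_q_approx(1)[of a] abc by (simp add: M_def)

lemma lnM_pos: "0 < ln M"
  using M_gt_1 by simp

lemma inverse_w_pow_tendsto: "(\<lambda>i. K / w ^ i) \<longlonglongrightarrow> 0"
proof -
  have "(\<lambda>i. K * (1 / w) ^ i) \<longlonglongrightarrow> K * 0"
    using w_ge by (intro tendsto_mult tendsto_const LIMSEQ_power_zero) simp
  then show ?thesis by (simp add: power_divide)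
qed

lemma Y_at_top: "filterlim Y at_top sequentially"
proof -
  have "filterlim (\<lambda>i. w ^ i) at_top sequentially"
    unfolding filterlim_at_top eventually_sequentially
  proof
    fix Z
    obtain N where "Z < w ^ N" using real_arch_pow[of w Z] w_ge by auto
    moreover have "w ^ N \<le> w ^ n" if "N \<le> n" for n using that w_ge by (intro power_increasing) auto
    ultimately show "\<exists>N. \<forall>n\<ge>N. Z \<le> w ^ n" by (meson less_imp_le order_trans)
  qed
  then show ?thesis unfolding Y_def using lnM_pos
    by (intro filterlim_tendsto_pos_mult_at_top[OF tendsto_const]) auto
qed

text \<open>The error in \<open>ln_q_approx\<close> is O(i) and vanishes after division by w^i, so
  the limit depends only on the ratio of the index to w^i. All asymptotics below become linear
  arithmetic on indices.\<close>

lemma ln_q_tendsto: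
  fixes n :: "nat \<Rightarrow> nat"
  assumes n: "\<And>i. real (n i) \<le> w ^ Suc i + 1" and lim: "(\<lambda>i. real (n i) / w ^ i) \<longlonglongrightarrow> y"
  shows "(\<lambda>i. ln (q (Suc (n i))) / Y i) \<longlonglongrightarrow> y"
proof -
  define K where "K = (1 + 4 * w / \<eta>) * ln (C + M)"
  have CM: "0 \<le> ln (C + M)" using C_ge M_gt_1 by simp
  have bound: "\<bar>ln (q (Suc (n i))) - real (n i) * ln M\<bar> \<le> K * (real i + 2) + ln 2" for i
  proof -
    have "\<bar>ln (q (Suc (n i))) - real (n i) * ln M\<bar>
        \<le> real (card {m \<in> {1..n i}. s m \<noteq> a}) * ln (C + M) + ln 2"
      using ln_q_approx(2)[of a "n i"] abc by (simp add: M_def)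
    also have "\<dots> \<le> (1 + 4 * w / \<eta>) * (real i + 2) * ln (C + M) + ln 2"
      using card_non_a_le[OF n[of i]] CM by (intro add_right_mono mult_right_mono)
    finally show ?thesis by (simp add: K_def mult_ac)
  qed
  have "(\<lambda>i. (K * (real i * (1 / w) ^ i) + (2 * K + ln 2) / w ^ i) / ln M) \<longlonglongrightarrow> (K * 0 + 0) / ln M"
  proof -
    have "(\<lambda>i. real i * (1 / w) ^ i) \<longlonglongrightarrow> 0" using w_ge by (intro powser_times_n_limit_0) simp
    then show ?thesis using lnM_pos by (intro tendsto_intros inverse_w_pow_tendsto) auto
  qed
  then have small: "(\<lambda>i. (K * (real i * (1 / w) ^ i) + (2 * K + ln 2) / w ^ i) / ln M) \<longlonglongrightarrow> 0" by simp
  have "(\<lambda>i. ln (q (Suc (n i))) / Y i - real (n i) / w ^ i) \<longlonglongrightarrow> 0"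
  proof (rule tendsto_0_le[OF small, of _ 1], intro always_eventually allI)
    fix i
    have w0: "0 < w ^ i" using w_ge by simp
    have "ln (q (Suc (n i))) / Y i - real (n i) / w ^ i = (ln (q (Suc (n i))) - real (n i) * ln M) / Y i"
      using w0 lnM_pos by (simp add: Y_def diff_divide_distrib)
    also have "\<bar>\<dots>\<bar> = \<bar>ln (q (Suc (n i))) - real (n i) * ln M\<bar> / Y i"
      using w0 lnM_pos by (simp add: Y_def abs_mult)
    also have "\<dots> \<le> (K * (real i + 2) + ln 2) / Y i"
      using bound[of i] w0 lnM_pos by (intro divide_right_mono) (auto simp: Y_def)
    also have "\<dots> = (K * (real i * (1 / w) ^ i) + (2 * K + ln 2) / w ^ i) / ln M"
    proof -
      have "(K * (real i + 2) + ln 2) / w ^ i = K * (real i * (1 / w) ^ i) + (2 * K + ln 2) / w ^ i"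
        by (simp add: power_divide algebra_simps flip: add_divide_distrib)
      then show ?thesis by (simp add: Y_def mult.commute[of "ln M"] flip: divide_divide_eq_left)
    qed
    finally show "norm (ln (q (Suc (n i))) / Y i - real (n i) / w ^ i)
        \<le> norm ((K * (real i * (1 / w) ^ i) + (2 * K + ln 2) / w ^ i) / ln M) * 1"
      unfolding real_norm_def mult_1_right by linarith
  qed
  from tendsto_add[OF this lim] show ?thesis by simp
qed

lemma k_tendsto: "(\<lambda>i. real (k i) / w ^ i) \<longlonglongrightarrow> 1"
proof (rule tendsto_sandwich)
  show "(\<lambda>i. 1 - 1 / w ^ i) \<longlonglongrightarrow> 1" using tendsto_diff[OF tendsto_const inverse_w_pow_tendsto, of 1 1] by simp
  show "eventually (\<lambda>i. 1 - 1 / w ^ i \<le> real (k i) / w ^ i) sequentially"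
  proof (intro always_eventually allI)
    fix i
    have "0 < w ^ i" using w_ge by simp
    then have "(w ^ i - 1) / w ^ i \<le> real (k i) / w ^ i"
      using k_bounds(1)[of i] by (intro divide_right_mono) auto
    then show "1 - 1 / w ^ i \<le> real (k i) / w ^ i" using \<open>0 < w ^ i\<close> w_ge by (simp add: diff_divide_distrib)
  qed
  show "eventually (\<lambda>i. real (k i) / w ^ i \<le> 1) sequentially"
    using k_bounds(2) w_pow_ge_1 by (intro always_eventually allI) (simp add: w_ge divide_le_eq_1 less_le_trans[OF zero_less_one])
qed simp

lemma L_tendsto: "(\<lambda>i. real (L i) / w ^ i) \<longlonglongrightarrow> \<eta>"
proof (rule tendsto_sandwich)
  show "(\<lambda>i. \<eta> - 1 / w ^ i) \<longlonglongrightarrow> \<eta>" using tendsto_diff[OF tendsto_const inverse_w_pow_tendsto, of \<eta> 1] by simp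
  have *: "\<eta> - 1 / w ^ i \<le> real (L i) / w ^ i" "real (L i) / w ^ i \<le> \<eta>" for i
  proof -
    have "0 < w ^ i" using w_ge by simp
    then have "(\<eta> * w ^ i - 1) / w ^ i \<le> real (L i) / w ^ i" "real (L i) / w ^ i \<le> \<eta> * w ^ i / w ^ i"
      using L_bounds[of i] by (intro divide_right_mono; simp)+
    then show "\<eta> - 1 / w ^ i \<le> real (L i) / w ^ i" "real (L i) / w ^ i \<le> \<eta>"
      using w_ge by (simp_all add: diff_divide_distrib)
  qed
  show "eventually (\<lambda>i. \<eta> - 1 / w ^ i \<le> real (L i) / w ^ i) sequentially"
    "eventually (\<lambda>i. real (L i) / w ^ i \<le> \<eta>) sequentially"
    using * by simp_all
qed simp

lemma k_Suc_tendsto: "(\<lambda>i. real (k (Suc i)) / w ^ i) \<longlonglongrightarrow> w"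
proof -
  have "(\<lambda>i. real (k (Suc i)) / w ^ Suc i) \<longlonglongrightarrow> 1" by (rule LIMSEQ_Suc[OF k_tendsto])
  from tendsto_mult[OF tendsto_const[of w] this] show ?thesis using w_ge by simp
qed

section \<open>Periods within a block and their quadratic polynomials\<close>

lemma eta_w_pow: "\<eta> * w ^ i \<le> w ^ Suc i / 4"
  using eta_le mult_right_mono[of \<eta> "w / 4" "w ^ i"] w_pow_ge_1[of i] by simp

lemma room: "k i + 2 * L i + 5 < k (Suc i)"
proof -
  have w1: "484 * w ^ i \<le> w ^ Suc i" using w_ge w_pow_ge_1[of i] by simp
  have "real (k i) + 2 * real (L i) + 5 < real (k (Suc i))"
    using k_bounds(2)[of i] k_bounds(1)[of "Suc i"] L_bounds(2)[of i] eta_w_pow[of i] w1 w_pow_ge_1[of i] by linarith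
  then show ?thesis by linarith
qed

lemma eventually_L_ge_1: "\<exists>i0\<ge>1. \<forall>i\<ge>i0. 1 \<le> L i"
proof -
  obtain i0 where i0: "1 / \<eta> < w ^ i0" using real_arch_pow[of w "1 / \<eta>"] w_ge by auto
  have "1 \<le> L i" if "Suc i0 \<le> i" for i
  proof -
    have "w ^ i0 \<le> w ^ i" using that w_ge by (intro power_increasing) auto
    then have "\<eta> * w ^ i0 \<le> \<eta> * w ^ i" using eta_pos by (intro mult_left_mono) auto
    moreover have "1 < \<eta> * w ^ i0" using i0 eta_pos by (simp add: field_simps)
    ultimately have "1 \<le> \<eta> * w ^ i" by linarith
    then have "1 \<le> \<lfloor>\<eta> * w ^ i\<rfloor>" by (simp add: le_floor_iff)
    then show ?thesis using int_L[of i] by linarith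
  qed
  then show ?thesis by (intro exI[of _ "Suc i0"]) auto
qed

text \<open>The digit at position \<open>k i + 1\<close> can be a \<open>c\<close> belonging to the previous block, so the
  periodic part is only guaranteed to start at \<open>k i + 2\<close>.\<close>

definition P :: "nat \<Rightarrow> int poly" where "P i = quad (L i) (Suc (k i))"

lemma P_eq_quad:
  assumes "1 \<le> i" "1 \<le> L i" "k i + 1 \<le> j" "j + L i < k (Suc i)"
  shows "quad (L i) j = P i \<or> quad (L i) j = - P i"
  unfolding P_def
proof (rule quad_shift)
  fix n assume "Suc (k i) < n" "n \<le> j"
  then show "s n = s (n + L i)" using assms by (intro digit_periodic) auto
qed (use assms in simp)

text \<open>The quadratic is read one full period into the block, at k i + L i. The next L i digits
  are there exactly a, ..., a, c, the pattern required by \<open>content_quad_dvd\<close>.\<close>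

lemma content_P:
  assumes "1 \<le> i" "1 \<le> L i"
  shows "content (P i) \<le> \<bar>c - a\<bar>"
proof -
  have "content (quad (L i) (k i + L i)) dvd c - a"
  proof (rule content_quad_dvd[OF assms(2)])
    fix m assume m: "1 \<le> m" "m < L i"
    have "\<not> L i dvd m" using m by (auto dest: dvd_imp_le)
    then show "s (k i + L i + m) = a" using m room[of i] assms by (intro digit_a[of i]) auto
  next
    show "s (k i + L i + L i) = c" using room[of i] assms by (intro digit_c[of i]) auto
  qed
  moreover have "quad (L i) (k i + L i) = P i \<or> quad (L i) (k i + L i) = - P i"
    using room[of i] assms by (intro P_eq_quad) auto
  moreover have "content (- P i) = content (P i)" using content_smult[of "- 1" "P i"] by simp
  ultimately have "content (P i) dvd c - a" by auto
  then have "\<bar>content (P i)\<bar> \<le> \<bar>c - a\<bar>" using abc by (intro dvd_imp_le_int) auto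
  then show ?thesis by linarith
qed

text \<open>The quadratic is read at the last possible place: one period later stands the digit b at
  k (i + 1), while the digit at k (i + 1) - L i is not b.\<close>

lemma value_P_bounds:
  assumes "1 \<le> i" "1 \<le> L i"
  defines "Q \<equiv> q (k (Suc i) - L i) * q (k (Suc i))"
  shows "1 / (C ^ 3 * Q) \<le> \<bar>eval_int_poly (P i) x\<bar>" "\<bar>eval_int_poly (P i) x\<bar> \<le> C / Q"
proof -
  define j where "j = k (Suc i) - L i - 1"
  have j: "Suc j = k (Suc i) - L i" "Suc (j + L i) = k (Suc i)"
    using room[of i] by (auto simp: j_def)
  have "s (Suc j) \<noteq> b" unfolding j using room[of i] assms(2) by (intro digit_before_k[of i]) auto
  then have ne: "s (Suc j) \<noteq> s (Suc (j + L i))" unfolding j(2) digit_k .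
  have "quad (L i) j = P i \<or> quad (L i) j = - P i"
    using room[of i] assms by (intro P_eq_quad) (auto simp: j_def)
  then have e: "\<bar>eval_int_poly (P i) x\<bar> = \<bar>eval_int_poly (quad (L i) j) x\<bar>"
    by (auto simp: eval_int_poly_uminus)
  show "1 / (C ^ 3 * Q) \<le> \<bar>eval_int_poly (P i) x\<bar>" "\<bar>eval_int_poly (P i) x\<bar> \<le> C / Q"
    using abs_eval_quad_bounds[OF ne] unfolding e Q_def j by auto
qed

text \<open>The digit at k i + 1 is uncertain. If it agrees with the digit one period later, the
  quadratic can be moved back to k i, where b faces c; if not, the two digits differ and the bound
  applies directly.\<close>

lemma lead_coeff_P_ge:
  assumes "1 \<le> i" "1 \<le> L i"
  shows "q (k i) * q (k i + L i) / C \<le> \<bar>of_int (coeff (P i) 2)\<bar>"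
proof (cases "s (Suc (k i)) = s (Suc (k i) + L i)")
  case True
  have k2: "2 \<le> k i" using assms(1) k_less[of "i - 1"] by simp
  have "s (k i + L i) = c" using room[of i] assms by (intro digit_c[of i]) auto
  then have "s (k i) \<noteq> s (k i + L i)" unfolding digit_k using abc by simp
  from lead_coeff_quad_ge[OF k2 assms(2) this] show ?thesis
    unfolding P_def quad_Suc[OF True] by simp
next
  case False
  have "q (k i) * q (k i + L i) / C \<le> q (Suc (k i)) * q (Suc (k i) + L i) / C"
    using q_le_Suc[of "k i"] q_le_Suc[of "k i + L i"] q_nonneg C_ge
    by (intro divide_right_mono mult_mono) auto
  also have "\<dots> \<le> \<bar>of_int (coeff (P i) 2)\<bar>"
    unfolding P_def using False assms k_pos[of i] by (intro lead_coeff_quad_ge) auto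
  finally show ?thesis .
qed

section \<open>Asymptotics of height, value and derivative\<close>

lemma lim_height: "(\<lambda>i. ln (of_int (poly_height (P i))) / Y i) \<longlonglongrightarrow> 2 + \<eta>"
proof -
  obtain i0 where i0: "1 \<le> i0" "\<And>i. i0 \<le> i \<Longrightarrow> 1 \<le> L i" using eventually_L_ge_1 by blast
  \<comment> \<open>Lower and upper bound involve slightly different indices, but bounded shifts do
    not affect the limit: the two factors contribute 1 and 1 + \<eta>.\<close>
  define f where "f = (\<lambda>i. q (k i) * q (k i + L i))"
  define h where "h = (\<lambda>i. q (Suc (Suc (k i))) * q (Suc (Suc (k i + L i))))"
  have q_pos: "0 < q n" if "1 \<le> n" for n using q_ge_1[OF that] by linarith
  have one: "(\<lambda>i. 1 / w ^ i) \<longlonglongrightarrow> 0" by (rule inverse_w_pow_tendsto)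
  have kL: "real (k i) + real (L i) + 5 \<le> w ^ Suc i" for i
    using room[of i] k_bounds(2)[of "Suc i"] by linarith
  show ?thesis
  proof (rule tendsto_ln_sandwich[OF Y_at_top, of "1 / C" 4 f _ h])
    show "eventually (\<lambda>i. 0 < f i) sequentially"
      using k_pos by (intro always_eventually allI) (auto simp: f_def intro!: mult_pos_pos q_pos trans_le_add1 simp del: of_int_0_less_iff)
    show "eventually (\<lambda>i. 1 / C * f i \<le> of_int (poly_height (P i))) sequentially"
      unfolding eventually_sequentially
    proof (intro exI[of _ i0] allI impI)
      fix i assume "i0 \<le> i"
      then have "1 / C * f i \<le> \<bar>of_int (coeff (P i) 2)\<bar>"
        using lead_coeff_P_ge[of i] i0 by (simp add: f_def)
      also have "\<dots> \<le> of_int (poly_height (P i))"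
        using abs_coeff_le_poly_height[of "P i" 2] by (simp flip: of_int_abs)
      finally show "1 / C * f i \<le> of_int (poly_height (P i))" .
    qed
    show "eventually (\<lambda>i. of_int (poly_height (P i)) \<le> 4 * h i) sequentially"
    proof (intro always_eventually allI)
      show "of_int (poly_height (P i)) \<le> 4 * h i" for i
        using poly_height_quad_le[of "Suc (k i)" "L i"] by (simp add: P_def h_def del: qd.simps)
    qed
    show "(\<lambda>i. ln (f i) / Y i) \<longlonglongrightarrow> 2 + \<eta>"
    proof -
      have 1: "(\<lambda>i. ln (q (Suc (k i - 1))) / Y i) \<longlonglongrightarrow> 1 - 0"
      proof (rule ln_q_tendsto)
        show "real (k i - 1) \<le> w ^ Suc i + 1" for i using kL[of i] by simp
        have "(\<lambda>i. real (k i) / w ^ i - 1 / w ^ i) \<longlonglongrightarrow> 1 - 0" by (intro tendsto_diff k_tendsto one)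
        then show "(\<lambda>i. real (k i - 1) / w ^ i) \<longlonglongrightarrow> 1 - 0"
          using k_pos by (simp add: of_nat_diff diff_divide_distrib)
      qed
      have 2: "(\<lambda>i. ln (q (Suc (k i + L i - 1))) / Y i) \<longlonglongrightarrow> 1 + \<eta> - 0"
      proof (rule ln_q_tendsto)
        show "real (k i + L i - 1) \<le> w ^ Suc i + 1" for i using kL[of i] by simp
        have "(\<lambda>i. real (k i) / w ^ i + real (L i) / w ^ i - 1 / w ^ i) \<longlonglongrightarrow> 1 + \<eta> - 0"
          by (intro tendsto_diff tendsto_add k_tendsto L_tendsto one)
        then show "(\<lambda>i. real (k i + L i - 1) / w ^ i) \<longlonglongrightarrow> 1 + \<eta> - 0"
          using k_pos by (simp add: of_nat_diff trans_le_add1 diff_divide_distrib add_divide_distrib)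
      qed
      have "ln (f i) / Y i = ln (q (Suc (k i - 1))) / Y i + ln (q (Suc (k i + L i - 1))) / Y i" for i
      proof -
        have "Suc (k i - 1) = k i" "Suc (k i + L i - 1) = k i + L i" using k_pos[of i] by auto
        then show ?thesis unfolding f_def
          using q_pos[of "k i"] q_pos[of "k i + L i"] k_pos[of i]
          by (subst ln_mult) (auto simp: add_divide_distrib)
      qed
      then show ?thesis using tendsto_add[OF 1 2] by simp
    qed
    show "(\<lambda>i. ln (h i) / Y i) \<longlonglongrightarrow> 2 + \<eta>"
    proof -
      have 1: "(\<lambda>i. ln (q (Suc (Suc (k i)))) / Y i) \<longlonglongrightarrow> 1 + 0"
      proof (rule ln_q_tendsto)
        show "real (Suc (k i)) \<le> w ^ Suc i + 1" for i using kL[of i] by simp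
        have "(\<lambda>i. real (k i) / w ^ i + 1 / w ^ i) \<longlonglongrightarrow> 1 + 0" by (intro tendsto_add k_tendsto one)
        then show "(\<lambda>i. real (Suc (k i)) / w ^ i) \<longlonglongrightarrow> 1 + 0" by (simp add: add_divide_distrib add.commute)
      qed
      have 2: "(\<lambda>i. ln (q (Suc (Suc (k i + L i)))) / Y i) \<longlonglongrightarrow> 1 + \<eta> + 0"
      proof (rule ln_q_tendsto)
        show "real (Suc (k i + L i)) \<le> w ^ Suc i + 1" for i using kL[of i] by simp
        have "(\<lambda>i. real (k i) / w ^ i + real (L i) / w ^ i + 1 / w ^ i) \<longlonglongrightarrow> 1 + \<eta> + 0"
          by (intro tendsto_add k_tendsto L_tendsto one)
        then show "(\<lambda>i. real (Suc (k i + L i)) / w ^ i) \<longlonglongrightarrow> 1 + \<eta> + 0"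
          by (simp add: add_divide_distrib add_ac)
      qed
      have "ln (h i) / Y i = ln (q (Suc (Suc (k i)))) / Y i + ln (q (Suc (Suc (k i + L i)))) / Y i" for i
        unfolding h_def using q_pos[of "Suc (Suc (k i))"] q_pos[of "Suc (Suc (k i + L i))"]
        by (subst ln_mult) (auto simp: add_divide_distrib simp del: qd.simps)
      then show ?thesis using tendsto_add[OF 1 2] by simp
    qed
  qed (use C_ge in auto)
qed

lemma lim_value: "(\<lambda>i. ln \<bar>eval_int_poly (P i) x\<bar> / Y i) \<longlonglongrightarrow> - (2 * w - \<eta>)"
proof -
  obtain i0 where i0: "1 \<le> i0" "\<And>i. i0 \<le> i \<Longrightarrow> 1 \<le> L i" using eventually_L_ge_1 by blast
  \<comment> \<open>On the scale w^i the two indices contribute w - \<eta> and w.\<close>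
  define Q where "Q = (\<lambda>i. q (k (Suc i) - L i) * q (k (Suc i)))"
  define f where "f = (\<lambda>i. 1 / Q i)"
  have one: "(\<lambda>i. 1 / w ^ i) \<longlonglongrightarrow> 0" by (rule inverse_w_pow_tendsto)
  have q_pos: "0 < q n" if "1 \<le> n" for n using q_ge_1[OF that] by linarith
  have ind: "Suc (k (Suc i) - L i - 1) = k (Suc i) - L i" "Suc (k (Suc i) - 1) = k (Suc i)" for i
    using room[of i] by auto
  have q0: "0 < q (k (Suc i) - L i)" "0 < q (k (Suc i))" for i
    using room[of i] by (auto intro!: q_pos simp del: of_int_0_less_iff)
  have 1: "(\<lambda>i. ln (q (Suc (k (Suc i) - L i - 1))) / Y i) \<longlonglongrightarrow> w - \<eta> - 0"
  proof (rule ln_q_tendsto)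
    show "real (k (Suc i) - L i - 1) \<le> w ^ Suc i + 1" for i using k_bounds(2)[of "Suc i"] by linarith
    have "(\<lambda>i. real (k (Suc i)) / w ^ i - real (L i) / w ^ i - 1 / w ^ i) \<longlonglongrightarrow> w - \<eta> - 0"
      by (intro tendsto_diff k_Suc_tendsto L_tendsto one)
    moreover have "real (k (Suc i) - L i - 1) = real (k (Suc i)) - real (L i) - 1" for i
      using room[of i] by linarith
    ultimately show "(\<lambda>i. real (k (Suc i) - L i - 1) / w ^ i) \<longlonglongrightarrow> w - \<eta> - 0"
      by (simp add: diff_divide_distrib)
  qed
  have 2: "(\<lambda>i. ln (q (Suc (k (Suc i) - 1))) / Y i) \<longlonglongrightarrow> w - 0"
  proof (rule ln_q_tendsto)
    show "real (k (Suc i) - 1) \<le> w ^ Suc i + 1" for i using k_bounds(2)[of "Suc i"] by linarith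
    have "(\<lambda>i. real (k (Suc i)) / w ^ i - 1 / w ^ i) \<longlonglongrightarrow> w - 0" by (intro tendsto_diff k_Suc_tendsto one)
    moreover have "real (k (Suc i) - 1) = real (k (Suc i)) - 1" for i using room[of i] by linarith
    ultimately show "(\<lambda>i. real (k (Suc i) - 1) / w ^ i) \<longlonglongrightarrow> w - 0" by (simp add: diff_divide_distrib)
  qed
  have "ln (f i) / Y i = - (ln (q (Suc (k (Suc i) - L i - 1))) / Y i + ln (q (Suc (k (Suc i) - 1))) / Y i)" for i
    unfolding f_def Q_def ind using q0[of i]
    by (simp add: ln_div ln_mult add_divide_distrib diff_divide_distrib)
  then have f: "(\<lambda>i. ln (f i) / Y i) \<longlonglongrightarrow> - (2 * w - \<eta>)"
    using tendsto_minus[OF tendsto_add[OF 1 2]] by simp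
  have Q0: "0 < Q i" for i unfolding Q_def using q0[of i] by (intro mult_pos_pos)
  show ?thesis
  proof (rule tendsto_ln_sandwich[OF Y_at_top, of "1 / C ^ 3" C f _ f])
    show "eventually (\<lambda>i. 0 < f i) sequentially" using Q0 by (simp add: f_def)
    show "eventually (\<lambda>i. 1 / C ^ 3 * f i \<le> \<bar>eval_int_poly (P i) x\<bar>) sequentially"
      unfolding eventually_sequentially
      using value_P_bounds(1) i0 by (intro exI[of _ i0]) (auto simp: f_def Q_def)
    show "eventually (\<lambda>i. \<bar>eval_int_poly (P i) x\<bar> \<le> C * f i) sequentially"
      unfolding eventually_sequentially
      using value_P_bounds(2) i0 by (intro exI[of _ i0]) (auto simp: f_def Q_def)
  qed (use C_ge f in auto)
qed

abbreviation deriv_P :: "nat \<Rightarrow> real" where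
  "deriv_P i \<equiv> 2 * of_int (coeff (P i) 2) * x + of_int (coeff (P i) 1)"

lemma lim_deriv: "(\<lambda>i. ln \<bar>deriv_P i\<bar> / Y i) \<longlonglongrightarrow> \<eta>"
  and eventually_deriv_nonzero: "eventually (\<lambda>i. deriv_P i \<noteq> 0) sequentially"
proof -
  obtain i0 where i0: "1 \<le> i0" "\<And>i. i0 \<le> i \<Longrightarrow> 1 \<le> L i" using eventually_L_ge_1 by blast
  define f where "f = (\<lambda>i. q (Suc (Suc (k i + L i))) / q (Suc (Suc (k i))))"
  have one: "(\<lambda>i. 1 / w ^ i) \<longlonglongrightarrow> 0" by (rule inverse_w_pow_tendsto)
  have q_pos: "0 < q (Suc n)" for n using q_ge_1[of "Suc n"] by linarith
  have kL: "real (k i) + real (L i) + 5 \<le> w ^ Suc i" for i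
    using room[of i] k_bounds(2)[of "Suc i"] by linarith
  have f0: "0 < f i" for i unfolding f_def using q_pos by (intro divide_pos_pos)
  have 1: "(\<lambda>i. ln (q (Suc (Suc (k i)))) / Y i) \<longlonglongrightarrow> 1 + 0"
  proof (rule ln_q_tendsto)
    show "real (Suc (k i)) \<le> w ^ Suc i + 1" for i using kL[of i] by simp
    have "(\<lambda>i. real (k i) / w ^ i + 1 / w ^ i) \<longlonglongrightarrow> 1 + 0" by (intro tendsto_add k_tendsto one)
    then show "(\<lambda>i. real (Suc (k i)) / w ^ i) \<longlonglongrightarrow> 1 + 0" by (simp add: add_divide_distrib add.commute)
  qed
  have 2: "(\<lambda>i. ln (q (Suc (Suc (k i + L i)))) / Y i) \<longlonglongrightarrow> 1 + \<eta> + 0"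
  proof (rule ln_q_tendsto)
    show "real (Suc (k i + L i)) \<le> w ^ Suc i + 1" for i using kL[of i] by simp
    have "(\<lambda>i. real (k i) / w ^ i + real (L i) / w ^ i + 1 / w ^ i) \<longlonglongrightarrow> 1 + \<eta> + 0"
      by (intro tendsto_add k_tendsto L_tendsto one)
    then show "(\<lambda>i. real (Suc (k i + L i)) / w ^ i) \<longlonglongrightarrow> 1 + \<eta> + 0"
      by (simp add: add_divide_distrib add_ac)
  qed
  have "ln (f i) / Y i = ln (q (Suc (Suc (k i + L i)))) / Y i - ln (q (Suc (Suc (k i)))) / Y i" for i
    unfolding f_def using q_pos[of "Suc (k i)"] q_pos[of "Suc (k i + L i)"]
    by (subst ln_div) (auto simp: diff_divide_distrib simp del: qd.simps)
  then have f: "(\<lambda>i. ln (f i) / Y i) \<longlonglongrightarrow> \<eta>" using tendsto_diff[OF 2 1] by simp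
  \<comment> \<open>As \<eta> > 0, f tends to infinity. From f \<ge> 4 C on, the additive error 2 in
    \<open>deriv_quad_bounds\<close> is at most half the main term.\<close>
  have big: "eventually (\<lambda>i. 4 * C \<le> f i) sequentially"
  proof -
    have "filterlim (\<lambda>i. (ln (f i) / Y i) * Y i) at_top sequentially"
      by (rule filterlim_tendsto_pos_mult_at_top[OF f eta_pos Y_at_top])
    then have "eventually (\<lambda>i. ln (4 * C) \<le> (ln (f i) / Y i) * Y i) sequentially"
      by (simp only: filterlim_at_top)
    then show ?thesis
    proof eventually_elim
      case (elim i)
      have "Y i \<noteq> 0" using lnM_pos w_ge by (simp add: Y_def)
      then have "ln (4 * C) \<le> ln (f i)" using elim by simp
      then show ?case using f0[of i] C_ge by (subst (asm) ln_le_cancel_iff) auto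
    qed
  qed
  have ev: "eventually (\<lambda>i. i0 \<le> i) sequentially" by (rule eventually_ge_at_top)
  have low: "eventually (\<lambda>i. 1 / (2 * C) * f i \<le> \<bar>deriv_P i\<bar>) sequentially"
    using big ev
  proof eventually_elim
    case (elim i)
    define r where "r = f i / C"
    have "r - 2 \<le> \<bar>deriv_P i\<bar>"
      using deriv_quad_bounds(1)[of "Suc (k i)" "L i"] i0(2)[OF elim(2)]
      unfolding P_def f_def r_def by (simp add: mult.commute del: qd.simps)
    moreover have "4 \<le> r" using elim C_ge by (simp add: r_def field_simps)
    ultimately have "r / 2 \<le> \<bar>deriv_P i\<bar>" by linarith
    then show ?case by (simp add: r_def mult.commute)
  qed
  have up: "eventually (\<lambda>i. \<bar>deriv_P i\<bar> \<le> (C + 1) * f i) sequentially"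
    using big ev
  proof eventually_elim
    case (elim i)
    have "\<bar>deriv_P i\<bar> \<le> C * f i + 2"
      using deriv_quad_bounds(2)[of "Suc (k i)" "L i"] i0(2)[OF elim(2)]
      unfolding P_def f_def by (simp del: qd.simps)
    then show ?case using elim C_ge by (simp add: algebra_simps)
  qed
  show "(\<lambda>i. ln \<bar>deriv_P i\<bar> / Y i) \<longlonglongrightarrow> \<eta>"
    by (rule tendsto_ln_sandwich[OF Y_at_top _ _ _ low up f f]) (use C_ge f0 in auto)
  show "eventually (\<lambda>i. deriv_P i \<noteq> 0) sequentially"
    using low
  proof eventually_elim
    case (elim i)
    have "0 < 1 / (2 * C) * f i" using f0[of i] C_ge by simp
    then show ?case using elim by linarith
  qed
qed

section \<open>Evaluation of the exponents\<close>

lemma x_eq: "\<xi>_cf a b c w \<eta> = x"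
proof -
  let ?s = "\<lambda>n. if n = 0 then 0 else s n"
  have "cfrac_value ?s = of_int (?s 0) + 1 / cfrac_value (\<lambda>i. ?s (Suc i))"
    using digit_ge_1 digit_le by (intro cfrac_value_rec[where B = "max a (max b c)"]) auto
  then show ?thesis by (simp add: \<xi>_cf_def x_def t_def)
qed

lemma exponents:
  fixes d n :: nat
  assumes d: "2 \<le> d" "121 * (real d)\<^sup>2 \<le> w" "\<eta> < sqrt w / real d" and n: "2 \<le> n" "n \<le> d"
  shows "w_star_exponent n x = ereal ((2 * w - 2 - \<eta>) / (2 + \<eta>))"
    and "w_exponent n x = ereal ((2 * w - \<eta>) / (2 + \<eta>))"
proof -
  obtain i0 where i0: "1 \<le> i0" "\<And>i. i0 \<le> i \<Longrightarrow> 1 \<le> L i" using eventually_L_ge_1 by blast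
  obtain i1 where i1: "\<And>i. i1 \<le> i \<Longrightarrow> deriv_P i \<noteq> 0"
    using eventually_deriv_nonzero by (auto simp: eventually_sequentially)
  \<comment> \<open>Dropping the first N blocks makes the eventual properties hold for all indices;
    the limits and the relation Y (i + 1) = w Y i survive the shift.\<close>
  define N where "N = max i0 i1"
  have N: "1 \<le> i + N" "1 \<le> L (i + N)" "deriv_P (i + N) \<noteq> 0" for i
    using i0(1) i0(2)[of "i + N"] i1[of "i + N"] by (auto simp: N_def)
  interpret quadratic_sequence x w \<eta> "of_int \<bar>c - a\<bar>" "1 / (4 * C * C)" d "\<lambda>i. P (i + N)" "\<lambda>i. Y (i + N)"
  proof
    show "\<bar>x\<bar> \<le> 1" using x_bounds by simp
    show "0 < Y (0 + N)" using lnM_pos w_ge by (simp add: Y_def)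
    show "Y (Suc i + N) = w * Y (i + N)" for i by (simp add: Y_def)
    show "degree (P (i + N)) = 2" for i
    proof -
      have "0 < q (k (i + N)) * q (k (i + N) + L (i + N)) / C"
        using q_ge_1[of "k (i + N)"] q_ge_1[of "k (i + N) + L (i + N)"] k_pos[of "i + N"] C_ge by simp
      then have "coeff (P (i + N)) 2 \<noteq> 0" using lead_coeff_P_ge[OF N(1,2), of i] by auto
      then have "2 \<le> degree (P (i + N))" by (rule le_degree)
      then show ?thesis using degree_quad_le[of "L (i + N)" "Suc (k (i + N))"] by (simp add: P_def)
    qed
    show "of_int (content (P (i + N))) \<le> real_of_int \<bar>c - a\<bar>" for i
      using content_P[OF N(1,2), of i] by (simp only: of_int_le_iff)
    show "eval_int_poly (P (i + N)) x \<noteq> 0" for i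
    proof -
      let ?i = "i + N"
      have "1 \<le> q (k (Suc ?i) - L ?i)" "1 \<le> q (k (Suc ?i))"
        using room[of ?i] by (intro q_ge_1; simp)+
      then have "0 < C ^ 3 * (q (k (Suc ?i) - L ?i) * q (k (Suc ?i)))" using C_ge by simp
      then have "0 < 1 / (C ^ 3 * (q (k (Suc ?i) - L ?i) * q (k (Suc ?i))))" by simp
      then show ?thesis using value_P_bounds(1)[OF N(1,2), of i] by auto
    qed
    show "2 * of_int (coeff (P (i + N)) 2) * x + of_int (coeff (P (i + N)) 1) \<noteq> 0" for i
      by (rule N(3))
    show "0 < 1 / (4 * C * C)" using C_ge by simp
    show "1 / (4 * C * C) \<le> \<bar>of_int v\<bar> * \<bar>of_int v * x - of_int u\<bar>" if "v \<noteq> 0" for u v :: int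
      by (rule badly_approximable[OF that])
  qed (use d eta_pos LIMSEQ_ignore_initial_segment[OF lim_height, of N]
      LIMSEQ_ignore_initial_segment[OF lim_value, of N] LIMSEQ_ignore_initial_segment[OF lim_deriv, of N] in auto)
  show "w_star_exponent n x = ereal ((2 * w - 2 - \<eta>) / (2 + \<eta>))"
    using w_star_exponent_eq[OF n] by (simp add: W'_def)
  show "w_exponent n x = ereal ((2 * w - \<eta>) / (2 + \<eta>))"
    using w_exponent_eq[OF n] by (simp add: W_def)
qed

end

theorem theorem5p5:
  fixes d :: nat and w \<eta> :: real and a b c :: int
  assumes "d \<ge> 2"
    and "w \<ge> 121 * (real d)\<^sup>2"
    and "a > 0" and "b > 0" and "c > 0"
    and "a \<noteq> b" and "a \<noteq> c" and "b \<noteq> c"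
    and "0 < \<eta>" and "\<eta> < sqrt w / real d"
  shows "\<forall>n. 2 \<le> n \<and> n \<le> d \<longrightarrow>
    w_star_exponent n (\<xi>_cf a b c w \<eta>) = ereal ((2 * w - 2 - \<eta>) / (2 + \<eta>)) \<and>
    w_exponent n (\<xi>_cf a b c w \<eta>) = ereal ((2 * w - \<eta>) / (2 + \<eta>)) \<and>
    w_exponent n (\<xi>_cf a b c w \<eta>) - w_star_exponent n (\<xi>_cf a b c w \<eta>) = ereal (2 / (2 + \<eta>))"
proof -
  have "(2::real)\<^sup>2 \<le> (real d)\<^sup>2" using assms(1) by (intro power_mono) auto
  then have w: "484 \<le> w" using assms(2) by simp
  have "sqrt w / real d \<le> w / 4"
  proof -
    have "(22::real)\<^sup>2 \<le> w" using w by simp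
    then have s: "22 \<le> sqrt w" by (rule real_le_rsqrt)
    have "sqrt w / real d \<le> sqrt w / 2" using assms(1) s w by (intro divide_left_mono) auto
    also have "\<dots> \<le> sqrt w * sqrt w / 4" using s w mult_right_mono[of 2 "sqrt w" "sqrt w"] by simp
    finally show ?thesis using w by simp
  qed
  then have "\<eta> \<le> w / 4" using assms(10) by linarith
  then interpret sparse_digits a b c w \<eta>
    using assms w by unfold_locales
  have "(2 * w - \<eta>) / (2 + \<eta>) - (2 * w - 2 - \<eta>) / (2 + \<eta>) = 2 / (2 + \<eta>)"
    by (simp flip: diff_divide_distrib)
  then show ?thesis
    using exponents[OF assms(1,2,10)] unfolding x_eq by simp
qed

end
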